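(* Let $T\colon X\to Y$, $A=T^*T$, Gaussian white noise $\xi$, $\zeta=T^*\xi$, and the data $z^\delta=Ax^\dagger+\delta\zeta$ be as in the context, and assume $\mathrm{Tr}[A]<\infty$. Let $x_0\in X$, let $(g_\alpha)_{\alpha>0}$ be a regularization as in the context, and suppose that $x^\dagger\in X$ satisfies the following: there exist $c_1>1$, $0<c_2<1$ and $0<t_0<\|A\|$ such that $$\int_0^\alpha d\|E_t(x^\dagger-x_0)\|^2\le c_1^2\int_{c_2\alpha}^\infty r_\alpha^2(t)\,d\|E_t(x^\dagger-x_0)\|^2\qquad\text{for all }0<\alpha\le t_0 .$$ Fix $\alpha_0>0$, $0<q<1$, $\tau>1$, $\eta>0$. For $\delta>0$ let $\alpha_{RG}$ be chosen according to the statistical RG-rule (see the context) with $\kappa=\sqrt{8|\log(1/\delta)|/\mathcal N(\alpha_0)}$. Then there is a constant $C$, independent of $\delta$, such that $$\left(\mathbb E\left[\|x^\dagger-x^\delta_{\alpha_{RG}}\|^2\right]\right)^{1/2}\le C\inf_{0<\alpha\le\alpha_0}\left\{\|x_\alpha-x^\dagger\|+\frac{\delta\,(1+\sqrt{|\log(1/\delta)|})}{\Theta_{\varrho_{\mathcal N}}(\alpha)}\right\}.$$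
   Context: **Model.** $X,Y$ are Hilbert spaces, $T\colon X\to Y$ is a nonzero compact linear operator, $A:=T^*T$, $\delta>0$ is the noise level, $x^\dagger\in X$ is the unknown solution. Gaussian white noise: $\xi=(\xi(y))_{y\in Y}$ is a stochastic process on a complete probability space $(\Omega,\mathcal F,\mathbb P)$ such that each $\xi(y)\in L_2(\Omega,\mathcal F,\mathbb P)$ is a centered Gaussian random variable and $\mathbb E[\xi(y)\xi(y')]=\langle y,y'\rangle$ for all $y,y'\in Y$. One writes $\langle\xi,y\rangle=\xi(y)$. Then $\zeta:=T^*\xi$, i.e. $\langle\zeta,w\rangle=\xi(Tw)$ for $w\in X$, has covariance $\mathbb E[\langle\zeta,w\rangle\langle\zeta,w'\rangle]=\langle w,Aw'\rangle$; when $\mathrm{Tr}[A]<\infty$ it is (almost surely) a Gaussian random element of $X$. The data are $z^\delta:=Ax^\dagger+\delta\zeta$, and the noise-free data are $z:=Ax^\dagger$. **Effective dimension.** $\mathcal N(\lambda):=\mathrm{Tr}[(A+\lambda I)^{-1}A]$, $\varrho_{\mathcal N}(t):=1/\sqrt{t\,\mathcal N(t)}$, $\Theta_{\varrho_{\mathcal N}}(t):=t\,\varrho_{\mathcal N}(t)$ for $\lambda,t>0$. **Regularization.** A family of functions $g_\alpha\colon[0,\|A\|]\to\mathbb R$, $\alpha>0$, piecewise continuous in $\alpha$, with residual functions $r_\alpha(t):=1-t\,g_\alpha(t)$, such that: (i) for each $0<t\le\|A\|$, $|r_\alpha(t)|\to0$ as $\alpha\to0$; (ii) there is $\gamma_*\ge1$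 with $\sup_{0\le t\le\|A\|}\alpha|g_\alpha(t)|\le\gamma_*$ for all $\alpha>0$; (iii) $r_\alpha(t)\le r_\beta(t)$ for $0<\alpha\le\beta$; (iv) $0\le r_\alpha(t)\le1$ for $\alpha>0$. With the initial guess $x_0\in X$ put $x_\alpha^\delta:=x_0-g_\alpha(A)(Ax_0-z^\delta)$ and $x_\alpha:=x_0-g_\alpha(A)(Ax_0-z)$. **Statistical RG-rule.** $\Delta_q:=\{q^k\alpha_0: k=0,1,2,\dots\}$ and $s_\alpha(t):=\alpha/(t+\alpha)$. Given $\tau>1$, $\eta>0$, $\kappa\ge0$, $\alpha_{RG}$ is the largest $\alpha\in\Delta_q$ for which either $$\|s_\alpha(A)(Ax_\alpha^\delta-z^\delta)\|\le\tau(1+\kappa)\frac{\delta}{\varrho_{\mathcal N}(\alpha)}\quad\text{or}\quad\Theta_{\varrho_{\mathcal N}}(\alpha)\le\eta(1+\kappa)\delta .$$ **Spectral integrals.** $(E_t)$ is the spectral resolution of $A$; integrals $\int_a^b f(t)\,d\|E_tw\|^2$ are integrals over $[a,b)$ with respect to the spectral measure $B\mapsto\|1_B(A)w\|^2$ (so $\int_0^\alpha d\|E_tw\|^2=\|1_{[0,\alpha)}(A)w\|^2$). *)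

theory Defs
  imports "HOL-Probability.Probability"
begin

definition compact_operator :: "('a::real_normed_vector \<Rightarrow> 'b::real_normed_vector) \<Rightarrow> bool" where
  "compact_operator T \<longleftrightarrow> bounded_linear T \<and> (\<forall>S. bounded S \<longrightarrow> compact (closure (T ` S)))"

definition orthonormal_basis :: "'a::real_inner set \<Rightarrow> bool" where
  "orthonormal_basis S \<longleftrightarrow>
     pairwise orthogonal S \<and> (\<forall>e\<in>S. norm e = 1) \<and> closure (span S) = UNIV"

text \<open>Trace of a positive operator, with values in \<open>[0, \<infinity>]\<close>. For such operators it does not
  depend on the chosen basis, and the truncation of negative reals by \<^const>\<open>ennreal\<close> plays no role.\<close>

definition op_trace :: "('a::real_inner \<Rightarrow> 'a) \<Rightarrow> ennreal" where
  "op_trace B = (\<Sum>\<^sub>\<infinity>e\<in>(SOME S. orthonormal_basis S). ennreal (inner (B e) e))"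

definition orth_proj :: "'a::real_inner set \<Rightarrow> 'a \<Rightarrow> 'a" where
  "orth_proj V x = (THE p. p \<in> V \<and> (\<forall>v\<in>V. inner (x - p) v = 0))"

definition eigenspace :: "('a::real_vector \<Rightarrow> 'a) \<Rightarrow> real \<Rightarrow> 'a set" where
  "eigenspace A l = {x. A x = l *\<^sub>R x}"

definition eigenvalues :: "('a::real_vector \<Rightarrow> 'a) \<Rightarrow> real set" where
  "eigenvalues A = {l. eigenspace A l \<noteq> {0}}"

text \<open>Functional calculus \<open>f(A)\<close> of a compact self-adjoint operator. Its spectral resolution is
  purely atomic, with an atom at each eigenvalue (at \<open>0\<close> if \<open>A\<close> is not injective), so
  \<open>\<integral> f dE w\<close> is the sum below. Hence \<open>f\<close> need not be measurable, and only its values on the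
  eigenvalues matter.\<close>

definition op_fun :: "('a::{real_inner,complete_space} \<Rightarrow> 'a) \<Rightarrow> (real \<Rightarrow> real) \<Rightarrow> 'a \<Rightarrow> 'a" where
  "op_fun A f w = (\<Sum>\<^sub>\<infinity>l\<in>eigenvalues A. f l *\<^sub>R orth_proj (eigenspace A l) w)"

text \<open>The measure \<open>B \<mapsto> \<parallel>1\<^sub>B(A) w\<parallel>\<^sup>2\<close>. Being atomic, it lives on all sets of reals, so that no
  measurability of the integrands in \<open>t\<close> has to be imposed.\<close>

definition spectral_measure :: "('a::{real_inner,complete_space} \<Rightarrow> 'a) \<Rightarrow> 'a \<Rightarrow> real measure" where
  "spectral_measure A w =
     measure_of UNIV UNIV (\<lambda>B. ennreal ((norm (op_fun A (indicator B) w))\<^sup>2))"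

definition eff_dim :: "('a::real_inner \<Rightarrow> 'a) \<Rightarrow> real \<Rightarrow> real" where
  "eff_dim A l = enn2real (op_trace (inv (\<lambda>x. A x + l *\<^sub>R x) \<circ> A))"

definition rho_N :: "('a::real_inner \<Rightarrow> 'a) \<Rightarrow> real \<Rightarrow> real" where
  "rho_N A t = 1 / sqrt (t * eff_dim A t)"

definition Theta_N :: "('a::real_inner \<Rightarrow> 'a) \<Rightarrow> real \<Rightarrow> real" where
  "Theta_N A t = t * rho_N A t"

text \<open>The degenerate Gaussian law (variance \<open>0\<close>) is the point mass at \<open>0\<close>; it occurs for
  \<open>\<xi>(0)\<close>.\<close>

definition centered_gaussian :: "'w measure \<Rightarrow> ('w \<Rightarrow> real) \<Rightarrow> bool" where
  "centered_gaussian M Z \<longleftrightarrow>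
     (\<exists>\<sigma>\<ge>0. if \<sigma> = 0 then Z \<in> borel_measurable M \<and> (AE \<omega> in M. Z \<omega> = 0)
             else distributed M lborel Z (\<lambda>x. ennreal (normal_density 0 \<sigma> x)))"

definition gaussian_white_noise :: "'w measure \<Rightarrow> ('b::real_inner \<Rightarrow> 'w \<Rightarrow> real) \<Rightarrow> bool" where
  "gaussian_white_noise M \<xi> \<longleftrightarrow>
     (\<forall>y. centered_gaussian M (\<xi> y) \<and> integrable M (\<lambda>\<omega>. (\<xi> y \<omega>)\<^sup>2)) \<and>
     (\<forall>y y'. (LINT \<omega>|M. \<xi> y \<omega> * \<xi> y' \<omega>) = inner y y')"

text \<open>A random element is almost surely separably valued. This is automatic if the space is
  separable, and otherwise it is what makes a random element determined, up to null sets, by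
  its scalar products with fixed vectors.\<close>

definition random_element :: "'w measure \<Rightarrow> ('w \<Rightarrow> 'a::metric_space) \<Rightarrow> bool" where
  "random_element M Z \<longleftrightarrow> Z \<in> borel_measurable M \<and>
     (\<exists>D. countable D \<and> (AE \<omega> in M. Z \<omega> \<in> closure D))"

text \<open>\<open>\<zeta> = T\<^sup>*\<xi>\<close> as a random element of the domain of \<open>T\<close>: for each \<open>w\<close>,
  \<open>\<langle>\<zeta>, w\<rangle> = \<xi>(T w)\<close> almost surely.\<close>

definition is_adjoint_noise ::
    "'w measure \<Rightarrow> ('a::real_inner \<Rightarrow> 'b) \<Rightarrow> ('b \<Rightarrow> 'w \<Rightarrow> real) \<Rightarrow> ('w \<Rightarrow> 'a) \<Rightarrow> bool" where
  "is_adjoint_noise M T \<xi> \<zeta> \<longleftrightarrow>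
     random_element M \<zeta> \<and> (\<forall>w. AE \<omega> in M. inner (\<zeta> \<omega>) w = \<xi> (T w) \<omega>)"

text \<open>Piecewise continuity on \<open>(0, \<infinity>)\<close>: on each compact subinterval there are only finitely many
  discontinuities, and the one-sided limits exist at each of them.\<close>

definition piecewise_continuous_pos :: "(real \<Rightarrow> real) \<Rightarrow> bool" where
  "piecewise_continuous_pos f \<longleftrightarrow>
     (\<forall>a b. 0 < a \<and> a < b \<longrightarrow>
        (\<exists>S. finite S \<and> S \<subseteq> {a..b} \<and> continuous_on ({a..b} - S) f \<and>
             (\<forall>s\<in>S. (\<exists>l. (f \<longlongrightarrow> l) (at_left s)) \<and> (\<exists>l. (f \<longlongrightarrow> l) (at_right s)))))"

definition residual :: "(real \<Rightarrow> real \<Rightarrow> real) \<Rightarrow> real \<Rightarrow> real \<Rightarrow> real" where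
  "residual g \<alpha> t = 1 - t * g \<alpha> t"

text \<open>\<open>a\<close> stands for \<open>\<parallel>A\<parallel>\<close>; the values \<open>g \<alpha> t\<close> for \<open>\<alpha> \<le> 0\<close> or \<open>t \<notin> [0, a]\<close> are irrelevant.\<close>

definition regularization :: "real \<Rightarrow> (real \<Rightarrow> real \<Rightarrow> real) \<Rightarrow> bool" where
  "regularization a g \<longleftrightarrow>
     (\<forall>t\<in>{0..a}. piecewise_continuous_pos (\<lambda>\<alpha>. g \<alpha> t)) \<and>
     (\<forall>t\<in>{0<..a}. ((\<lambda>\<alpha>. \<bar>residual g \<alpha> t\<bar>) \<longlongrightarrow> 0) (at_right 0)) \<and>
     (\<exists>\<gamma>\<ge>1. \<forall>\<alpha>>0. \<forall>t\<in>{0..a}. \<alpha> * \<bar>g \<alpha> t\<bar> \<le> \<gamma>) \<and>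
     (\<forall>\<alpha> \<beta>. \<forall>t\<in>{0..a}. 0 < \<alpha> \<and> \<alpha> \<le> \<beta> \<longrightarrow> residual g \<alpha> t \<le> residual g \<beta> t) \<and>
     (\<forall>\<alpha>>0. \<forall>t\<in>{0..a}. 0 \<le> residual g \<alpha> t \<and> residual g \<alpha> t \<le> 1)"

text \<open>The approximation from data \<open>z\<close> and initial guess \<open>x0\<close>; \<open>z\<close> may be noisy or noise-free.\<close>

definition reg_approx ::
    "('a::{real_inner,complete_space} \<Rightarrow> 'a) \<Rightarrow> (real \<Rightarrow> real \<Rightarrow> real) \<Rightarrow> 'a \<Rightarrow> 'a \<Rightarrow> real \<Rightarrow> 'a" where
  "reg_approx A g x0 z \<alpha> = x0 - op_fun A (g \<alpha>) (A x0 - z)"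

definition grid :: "real \<Rightarrow> real \<Rightarrow> real set" where
  "grid q \<alpha>0 = {q ^ k * \<alpha>0 | k::nat. True}"

definition RG_criterion ::
    "('a::{real_inner,complete_space} \<Rightarrow> 'a) \<Rightarrow> (real \<Rightarrow> real \<Rightarrow> real) \<Rightarrow> 'a \<Rightarrow>
     real \<Rightarrow> real \<Rightarrow> real \<Rightarrow> real \<Rightarrow> 'a \<Rightarrow> real \<Rightarrow> bool" where
  "RG_criterion A g x0 \<tau> \<eta> \<kappa> \<delta> z \<alpha> \<longleftrightarrow>
     norm (op_fun A (\<lambda>t. \<alpha> / (t + \<alpha>)) (A (reg_approx A g x0 z \<alpha>) - z))
         \<le> \<tau> * (1 + \<kappa>) * (\<delta> / rho_N A \<alpha>)
     \<or> Theta_N A \<alpha> \<le> \<eta> * (1 + \<kappa>) * \<delta>"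

definition alpha_RG ::
    "('a::{real_inner,complete_space} \<Rightarrow> 'a) \<Rightarrow> (real \<Rightarrow> real \<Rightarrow> real) \<Rightarrow> 'a \<Rightarrow> real \<Rightarrow> real \<Rightarrow>
     real \<Rightarrow> real \<Rightarrow> real \<Rightarrow> real \<Rightarrow> 'a \<Rightarrow> real" where
  "alpha_RG A g x0 q \<alpha>0 \<tau> \<eta> \<kappa> \<delta> z =
     (GREATEST \<alpha>. \<alpha> \<in> grid q \<alpha>0 \<and> RG_criterion A g x0 \<tau> \<eta> \<kappa> \<delta> z \<alpha>)"

end

theory Submission
  imports Defs
begin

text \<open>Let \<open>w = xdag - x0\<close>, \<open>r \<alpha>\<close> the residual function and \<open>s \<alpha> t = \<alpha> / (t + \<alpha>)\<close>. In an orthonormal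
  eigenbasis of \<open>A\<close> the error is \<open>r \<alpha>(A) w - \<delta> g \<alpha>(A) \<zeta>\<close> and the residual in the stopping rule is
  \<open>- s \<alpha>(A) r \<alpha>(A) (A w + \<delta> \<zeta>)\<close>. On the event that \<open>\<parallel>s \<alpha>(A) \<zeta>\<parallel> \<le> (1 + \<kappa>) \<surd>(\<alpha> N(\<alpha>))\<close> for all grid
  points up to the emergency stop, the argument is deterministic: the source condition bounds the bias
  at the chosen parameter by the residual, hence by \<open>(1 + \<kappa>) \<delta> / \<Theta>(\<alpha>)\<close>, and failure of the
  rule one grid point earlier makes this quantity comparable to the infimum, because the bias
  increases and \<open>1 / \<Theta>\<close> decreases in \<open>\<alpha>\<close>. A Chernoff bound for Gaussian quadratic forms gives the
  complementary event a probability of at most \<open>\<delta>^16\<close> per grid point, which outweighs the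
  polynomial growth of the error there.\<close>

section \<open>Hilbert spaces\<close>

text \<open>The factor 8 in \<kappa> makes the Chernoff exponent
  \<open>- 2 * \<kappa>\<^sup>2 * eff_dim A \<alpha>0\<close> equal to
  \<open>16 * ln \<delta>\<close> for \<delta> < 1. It serves all grid points at once because the
  effective dimension only grows as the parameter decreases. Sixteen powers are ample: on the bad
  event the squared error is of order \<delta>^-2 times 1 + |\<zeta>|^2, and at most order
  \<delta>^-2 grid points precede the emergency stop. Remainders of order \<delta> are harmless,
  since every term under the infimum is at least \<delta> / \<Theta>(\<alpha>0). A second obstacle
  shapes the functional analysis: X need not be separable, so an orthonormal basis of the kernel of
  T may be uncountable. Hence sums are unordered, the trace is computed by exchanging sums over
  arbitrary index sets, and the vanishing of all kernel coordinates of \<zeta> on one event of full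
  measure is derived from the separable range of \<zeta>. The other coordinates are countably many
  because the trace is finite, so that Fatou's lemma applies.\<close>

lemma closed_subspace_projection:
  fixes V :: "'a::{real_inner,complete_space} set"
  assumes V: "subspace V" "closed V"
  shows "\<exists>p\<in>V. \<forall>v\<in>V. inner (x - p) v = 0"
proof -
  define S where "S = (\<lambda>v. (norm (x - v))\<^sup>2) ` V"
  define d where "d = Inf S"
  have "0 \<in> V" using V(1) by (rule subspace_0)
  then have ne: "S \<noteq> {}" by (auto simp: S_def)
  have bdd: "bdd_below S" by (auto simp: S_def intro!: bdd_belowI[of _ 0])
  have dle: "d \<le> (norm (x - v))\<^sup>2" if "v \<in> V" for v
    unfolding d_def using that bdd by (intro cInf_lower) (auto simp: S_def)
  have "\<exists>v\<in>V. (norm (x - v))\<^sup>2 < d + inverse (real (Suc n))" for n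
  proof -
    have "Inf S < d + inverse (real (Suc n))" by (simp add: d_def)
    from cInf_lessD[OF ne this] show ?thesis by (auto simp: S_def)
  qed
  then obtain v where v: "\<And>n. v n \<in> V"
    "\<And>n. (norm (x - v n))\<^sup>2 < d + inverse (real (Suc n))" by metis
  \<comment> \<open>Parallelogram law: the midpoint lies in V, so its squared distance to x is at
    least d. This forces minimising sequences to be Cauchy.\<close>
  have par: "(norm (v n - v m))\<^sup>2 \<le> 2 * inverse (real (Suc n)) + 2 * inverse (real (Suc m))" for n m
  proof -
    have "(1/2) *\<^sub>R (v n + v m) \<in> V" using V(1) v(1) by (intro subspace_scale subspace_add) auto
    from dle[OF this] have "4 * d \<le> 4 * (norm (x - (1/2) *\<^sub>R (v n + v m)))\<^sup>2" by simp
    also have "\<dots> = 2 * (norm (x - v n))\<^sup>2 + 2 * (norm (x - v m))\<^sup>2 - (norm (v n - v m))\<^sup>2"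
      by (simp add: power2_norm_eq_inner inner_simps inner_commute algebra_simps)
    finally show ?thesis using v(2)[of n] v(2)[of m] by linarith
  qed
  have "Cauchy v"
  proof (rule metric_CauchyI)
    fix e :: real assume "0 < e"
    then obtain N where N: "inverse (real (Suc N)) < e\<^sup>2 / 4"
      using reals_Archimedean[of "e\<^sup>2/4"] by auto
    show "\<exists>M. \<forall>m\<ge>M. \<forall>n\<ge>M. dist (v m) (v n) < e"
    proof (intro exI[of _ N] allI impI)
      fix m n assume mn: "N \<le> m" "N \<le> n"
      have "inverse (real (Suc m)) \<le> inverse (real (Suc N))"
        "inverse (real (Suc n)) \<le> inverse (real (Suc N))"
        using mn by (auto intro!: le_imp_inverse_le)
      with par[of m n] N have "(norm (v m - v n))\<^sup>2 < e\<^sup>2" by linarith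
      then show "dist (v m) (v n) < e"
        using \<open>0 < e\<close> by (simp add: dist_norm power2_less_imp_less)
    qed
  qed
  then obtain p where p: "v \<longlonglongrightarrow> p" by (auto simp: Cauchy_convergent_iff convergent_def)
  have pV: "p \<in> V" using closed_sequentially[OF V(2) v(1) p] .
  have "(\<lambda>n. d + inverse (real (Suc n))) \<longlonglongrightarrow> d + 0"
    by (intro tendsto_add tendsto_const LIMSEQ_inverse_real_of_nat)
  moreover have "(\<lambda>n. (norm (x - v n))\<^sup>2) \<longlonglongrightarrow> (norm (x - p))\<^sup>2"
    by (intro tendsto_intros p)
  ultimately have pd: "(norm (x - p))\<^sup>2 \<le> d"
    using v(2) by (intro LIMSEQ_le[of _ "(norm (x - p))\<^sup>2" _ d]) (auto intro: less_imp_le)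
  have "inner (x - p) u = 0" if "u \<in> V" for u
  proof (rule ccontr)
    assume nz: "inner (x - p) u \<noteq> 0"
    then have u: "u \<noteq> 0" by auto
    \<comment> \<open>The minimiser of the quadratic in t given by the squared distance from x to
      \<open>p + t *\<^sub>R u\<close>; a nonzero inner product would push it below d.\<close>
    define t where "t = inner (x - p) u / (norm u)\<^sup>2"
    have "p + t *\<^sub>R u \<in> V" using V(1) pV that by (intro subspace_scale subspace_add)
    have "(norm (x - p))\<^sup>2 \<le> (norm (x - (p + t *\<^sub>R u)))\<^sup>2"
      by (rule order_trans[OF pd dle]) fact
    also have "\<dots> = (norm (x - p))\<^sup>2 - 2 * t * inner (x - p) u + t\<^sup>2 * (norm u)\<^sup>2"
      unfolding power2_norm_eq_inner
      by (simp add: inner_simps inner_commute algebra_simps power2_eq_square)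
    also have "\<dots> = (norm (x - p))\<^sup>2 - (inner (x - p) u)\<^sup>2 / (norm u)\<^sup>2"
      using u by (simp add: t_def field_simps power2_eq_square)
    finally have "(inner (x - p) u)\<^sup>2 / (norm u)\<^sup>2 \<le> 0" by simp
    moreover have "0 < (inner (x - p) u)\<^sup>2 / (norm u)\<^sup>2" using nz u by simp
    ultimately show False by simp
  qed
  with pV show ?thesis by blast
qed

text \<open>The kernel of \<phi> has codimension one, so the part n of an outside vector that is
  orthogonal to the kernel spans the complement; the scaling makes both functionals agree on
  n.\<close>

lemma riesz_representation:
  fixes \<phi> :: "'a::{real_inner,complete_space} \<Rightarrow> real"
  assumes "bounded_linear \<phi>"
  shows "\<exists>u. \<forall>x. \<phi> x = inner x u"
proof (cases "\<forall>x. \<phi> x = 0")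
  case True
  then show ?thesis by (intro exI[of _ 0]) simp
next
  case False
  interpret bounded_linear \<phi> by fact
  obtain x where x: "\<phi> x \<noteq> 0" using False by blast
  define V where "V = {x. \<phi> x = 0}"
  have "subspace V" by (auto simp: subspace_def V_def zero add scaleR)
  moreover have "closed V" unfolding V_def
    by (intro closed_Collect_eq continuous_intros) 
       (simp add: linear_continuous_on assms)
  ultimately obtain p where p: "p \<in> V" "\<And>v. v \<in> V \<Longrightarrow> inner (x - p) v = 0"
    using closed_subspace_projection[of V x] by blast
  define n where "n = x - p"
  have phin: "\<phi> n \<noteq> 0" using x p(1) by (simp add: n_def diff V_def)
  then have n: "n \<noteq> 0" by (auto simp: zero)
  have "\<phi> y = inner y ((\<phi> n / (norm n)\<^sup>2) *\<^sub>R n)" for y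
  proof -
    have "y - (\<phi> y / \<phi> n) *\<^sub>R n \<in> V" using phin by (simp add: V_def diff scaleR)
    from p(2)[OF this] have "inner y n = \<phi> y / \<phi> n * (norm n)\<^sup>2"
      by (simp add: n_def[symmetric] inner_simps inner_commute power2_norm_eq_inner)
    then show ?thesis using n phin by simp
  qed
  then show ?thesis by blast
qed

text \<open>\<open>adjoint\<close> is a choice among maps with the defining identity, so it is
  meaningful only once Riesz representation has supplied such a map. The norm bound comes from
  testing the identity with \<open>x = adjoint T y\<close>.\<close>

lemma adjoint_hilbert:
  fixes T :: "'a::{real_inner,complete_space} \<Rightarrow> 'b::real_inner"
  assumes "bounded_linear T"
  shows "inner (T x) y = inner x (adjoint T y)" and "bounded_linear (adjoint T)"
proof -
  interpret T: bounded_linear T by fact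
  have "\<exists>u. \<forall>x. inner (T x) y = inner x u" for y
    by (rule riesz_representation)
       (intro bounded_linear_compose[OF bounded_linear_inner_left assms])
  then have "\<exists>f'. \<forall>x y. inner (T x) y = inner x (f' y)" by metis
  then have "\<forall>x y. inner (T x) y = inner x (adjoint T y)"
    unfolding adjoint_def by (rule someI_ex)
  then have adj: "inner (T x) y = inner x (adjoint T y)" for x y by blast
  then show "inner (T x) y = inner x (adjoint T y)" .
  obtain K where K: "\<And>x. norm (T x) \<le> norm x * K" "0 < K" using T.pos_bounded by blast
  show "bounded_linear (adjoint T)"
  proof (rule bounded_linear_intro)
    show "adjoint T (x + y) = adjoint T x + adjoint T y" for x y
      by (rule vector_eq_ldot[THEN iffD1]) (simp add: inner_simps adj[symmetric])
    show "adjoint T (r *\<^sub>R x) = r *\<^sub>R adjoint T x" for r x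
      by (rule vector_eq_ldot[THEN iffD1]) (simp add: inner_simps adj[symmetric])
    show "norm (adjoint T y) \<le> norm y * K" for y
    proof (cases "norm (adjoint T y) = 0")
      case False
      have "norm (adjoint T y) * norm (adjoint T y) = inner (T (adjoint T y)) y"
        by (simp add: adj power2_norm_eq_inner[symmetric] power2_eq_square)
      also have "\<dots> \<le> norm (T (adjoint T y)) * norm y" by (rule norm_cauchy_schwarz)
      also have "\<dots> \<le> (norm (adjoint T y) * K) * norm y" by (intro mult_right_mono K) auto
      finally show ?thesis using False by (simp add: ac_simps)
    next
      case True
      then show ?thesis using K(2) by simp
    qed
  qed
qed

section \<open>Orthonormal bases of arbitrary cardinality\<close>

lemma orthonormal_basis_inner:
  assumes "orthonormal_basis F" "e \<in> F" "f \<in> F"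
  shows "inner e f = (if e = f then 1 else 0)"
  using assms by (auto simp: orthonormal_basis_def pairwise_def orthogonal_def norm_eq_1)

text \<open>With \<open>a e = inner x e\<close> this yields Bessel's inequality; with the
  coefficients of an approximation from the span it shows that the Fourier coefficients do at least
  as well. \<open>parseval\<close> uses it both ways.\<close>

lemma orthonormal_norm_diff:
  assumes F: "orthonormal_basis F" and G: "finite G" "G \<subseteq> F"
  shows "(norm (x - (\<Sum>e\<in>G. a e *\<^sub>R e)))\<^sup>2
    = (norm x)\<^sup>2 - (\<Sum>e\<in>G. (inner x e)\<^sup>2) + (\<Sum>e\<in>G. (a e - inner x e)\<^sup>2)"
proof -
  have 1: "inner x (\<Sum>e\<in>G. a e *\<^sub>R e) = (\<Sum>e\<in>G. a e * inner x e)"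
    by (simp add: inner_sum_right)
  have 2: "inner e (\<Sum>f\<in>G. a f *\<^sub>R f) = a e" if "e \<in> G" for e
  proof -
    have "inner e (\<Sum>f\<in>G. a f *\<^sub>R f) = (\<Sum>f\<in>G. if e = f then a f else 0)"
      unfolding inner_sum_right
      by (intro sum.cong) (use that G in \<open>auto simp: subset_iff orthonormal_basis_inner[OF F]\<close>)
    then show ?thesis using that G by simp
  qed
  have 3: "inner (\<Sum>e\<in>G. a e *\<^sub>R e) (\<Sum>e\<in>G. a e *\<^sub>R e) = (\<Sum>e\<in>G. (a e)\<^sup>2)"
    by (subst inner_sum_left) (simp add: 2 power2_eq_square)
  have dist_sq: "(norm (x - s))\<^sup>2 = (norm x)\<^sup>2 - 2 * inner x s + inner s s" for s
    by (simp add: power2_norm_eq_inner inner_diff_left inner_diff_right inner_commute)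
  have "(norm (x - (\<Sum>e\<in>G. a e *\<^sub>R e)))\<^sup>2
    = (norm x)\<^sup>2 - 2 * (\<Sum>e\<in>G. a e * inner x e) + (\<Sum>e\<in>G. (a e)\<^sup>2)"
    using dist_sq[of "\<Sum>e\<in>G. a e *\<^sub>R e"] unfolding 1 3 .
  also have "\<dots> = (norm x)\<^sup>2 - (\<Sum>e\<in>G. (inner x e)\<^sup>2) + (\<Sum>e\<in>G. (a e - inner x e)\<^sup>2)"
    by (simp add: power2_diff sum.distrib sum_subtractf sum_distrib_left algebra_simps)
  finally show ?thesis .
qed

lemma has_sum_nonneg_realI:
  fixes f :: "'i \<Rightarrow> real"
  assumes nn: "\<And>i. i \<in> I \<Longrightarrow> 0 \<le> f i"
    and le: "\<And>G. finite G \<Longrightarrow> G \<subseteq> I \<Longrightarrow> sum f G \<le> L"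
    and ge: "\<And>\<epsilon>. 0 < \<epsilon> \<Longrightarrow> \<exists>G. finite G \<and> G \<subseteq> I \<and> L - \<epsilon> \<le> sum f G"
  shows "(f has_sum L) I"
proof -
  have "bdd_above (sum f ` {G. G \<subseteq> I \<and> finite G})"
    using le by (auto intro!: bdd_aboveI[of _ L])
  from nonneg_bdd_above_has_sum[OF nn this]
  have hs: "(f has_sum (SUP G\<in>{G. finite G \<and> G \<subseteq> I}. sum f G)) I"
    by (simp add: conj_commute)
  have "(SUP G\<in>{G. finite G \<and> G \<subseteq> I}. sum f G) = L"
  proof (rule antisym)
    show "(SUP G\<in>{G. finite G \<and> G \<subseteq> I}. sum f G) \<le> L"
      using le by (intro cSUP_least) auto
    show "L \<le> (SUP G\<in>{G. finite G \<and> G \<subseteq> I}. sum f G)"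
    proof (rule field_le_epsilon)
      fix \<epsilon> :: real assume "0 < \<epsilon>"
      from ge[OF this] obtain G where G: "finite G" "G \<subseteq> I" "L - \<epsilon> \<le> sum f G" by blast
      have "sum f G \<le> (SUP G\<in>{G. finite G \<and> G \<subseteq> I}. sum f G)"
        using G le by (intro cSUP_upper) (auto intro!: bdd_aboveI[of _ L])
      with G(3) show "L \<le> (SUP G\<in>{G. finite G \<and> G \<subseteq> I}. sum f G) + \<epsilon>" by simp
    qed
  qed
  with hs show ?thesis by simp
qed

lemma parseval:
  assumes F: "orthonormal_basis F"
  shows "((\<lambda>e. (inner x e)\<^sup>2) has_sum (norm x)\<^sup>2) F"
proof (rule has_sum_nonneg_realI)
  fix G assume G: "finite G" "G \<subseteq> F"
  have "0 \<le> (norm (x - (\<Sum>e\<in>G. inner x e *\<^sub>R e)))\<^sup>2" by simp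
  also have "\<dots> = (norm x)\<^sup>2 - (\<Sum>e\<in>G. (inner x e)\<^sup>2)"
    by (subst orthonormal_norm_diff[OF F G]) simp
  finally show "(\<Sum>e\<in>G. (inner x e)\<^sup>2) \<le> (norm x)\<^sup>2" by simp
next
  fix \<epsilon> :: real assume "0 < \<epsilon>"
  have "x \<in> closure (span F)" using F by (simp add: orthonormal_basis_def)
  then obtain y where y: "y \<in> span F" "dist y x < sqrt \<epsilon>"
    using \<open>0 < \<epsilon>\<close> by (meson closure_approachable real_sqrt_gt_zero)
  obtain G a where G: "finite G" "G \<subseteq> F" "y = (\<Sum>e\<in>G. a e *\<^sub>R e)"
    using y(1) unfolding span_explicit by blast
  have "(norm x)\<^sup>2 - (\<Sum>e\<in>G. (inner x e)\<^sup>2) \<le> (norm (x - y))\<^sup>2"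
    unfolding G(3) orthonormal_norm_diff[OF F G(1,2)] by (simp add: sum_nonneg)
  also have "\<dots> \<le> (sqrt \<epsilon>)\<^sup>2" using y(2) by (intro power_mono) (auto simp: dist_norm norm_minus_commute)
  also have "\<dots> = \<epsilon>" using \<open>0 < \<epsilon>\<close> by simp
  finally show "\<exists>G. finite G \<and> G \<subseteq> F \<and> (norm x)\<^sup>2 - \<epsilon> \<le> (\<Sum>e\<in>G. (inner x e)\<^sup>2)"
    using G by (intro exI[of _ G]) auto
qed simp

lemma parseval_inner:
  assumes F: "orthonormal_basis F"
  shows "((\<lambda>e. inner x e * inner y e) has_sum inner x y) F"
proof -
  have "((\<lambda>e. (1/4) * ((inner (x + y) e)\<^sup>2 + - (inner (x - y) e)\<^sup>2))
      has_sum ((1/4) * ((norm (x + y))\<^sup>2 + - (norm (x - y))\<^sup>2))) F"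
    by (intro has_sum_cmult_right has_sum_add parseval[OF F] has_sum_uminusI)
  moreover have "(1/4) * ((norm (x + y))\<^sup>2 + - (norm (x - y))\<^sup>2) = inner x y"
    by (simp add: power2_norm_eq_inner inner_simps inner_commute)
  moreover have "(1/4) * ((inner (x + y) e)\<^sup>2 + - (inner (x - y) e)\<^sup>2) = inner x e * inner y e" for e
    by (simp add: inner_simps power2_eq_square algebra_simps)
  ultimately show ?thesis by simp
qed

lemma orthonormal_basis_eqI:
  assumes F: "orthonormal_basis F" and eq: "\<And>e. e \<in> F \<Longrightarrow> inner x e = inner y e"
  shows "x = y"
proof -
  have "((\<lambda>e. (inner (x - y) e)\<^sup>2) has_sum 0) F"
    by (rule has_sum_0) (simp add: inner_diff_left eq)
  with parseval[OF F, of "x - y"] have "(norm (x - y))\<^sup>2 = 0" by (rule has_sum_unique)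
  then show ?thesis by simp
qed

text \<open>Squared distances between partial sums are tails of the sum of
  \<open>(c e)\<^sup>2\<close>. Finite sets capturing L up to 1/(n+1) replace an enumeration of F,
  which may be uncountable.\<close>

lemma riesz_fischer:
  fixes F :: "'a::{real_inner,complete_space} set"
  assumes F: "orthonormal_basis F" and c: "(\<lambda>e. (c e)\<^sup>2) summable_on F"
  shows "\<exists>y. \<forall>e\<in>F. inner y e = c e"
proof -
  define L where "L = infsum (\<lambda>e. (c e)\<^sup>2) F"
  have hs: "((\<lambda>e. (c e)\<^sup>2) has_sum L) F" using c by (simp add: L_def)
  have le: "(\<Sum>e\<in>G. (c e)\<^sup>2) \<le> L" if "finite G" "G \<subseteq> F" for G
    using hs that by (rule finite_sum_le_has_sum) simp_all
  have "\<exists>G. finite G \<and> G \<subseteq> F \<and> dist (\<Sum>e\<in>G. (c e)\<^sup>2) L \<le> inverse (real (Suc n))" for n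
    using has_sum_finite_approximation[OF hs, of "inverse (real (Suc n))"] by auto
  then obtain H where H: "\<And>n. finite (H n)" "\<And>n. H n \<subseteq> F"
    "\<And>n. dist (\<Sum>e\<in>H n. (c e)\<^sup>2) L \<le> inverse (real (Suc n))" by metis
  \<comment> \<open>Unions make the sets nested, so that differences of partial sums are sums over
    \<open>G n - G m\<close>.\<close>
  define G where "G n = (\<Union>k\<le>n. H k)" for n
  have G: "finite (G n)" "G n \<subseteq> F" "H n \<subseteq> G n" for n using H by (auto simp: G_def)
  have Gmono: "G m \<subseteq> G n" if "m \<le> n" for m n using that by (force simp: G_def)
  have Gge: "L - inverse (real (Suc n)) \<le> (\<Sum>e\<in>G n. (c e)\<^sup>2)" for n
  proof -
    have "(\<Sum>e\<in>H n. (c e)\<^sup>2) \<le> (\<Sum>e\<in>G n. (c e)\<^sup>2)" by (intro sum_mono2 G) auto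
    with H(3)[of n] show ?thesis by (simp add: dist_real_def)
  qed
  define y where "y n = (\<Sum>e\<in>G n. c e *\<^sub>R e)" for n
  have yin: "inner (y n) e = (if e \<in> G n then c e else 0)" if "e \<in> F" for n e
  proof -
    have "inner (y n) e = (\<Sum>f\<in>G n. if f = e then c f else 0)"
      unfolding y_def inner_sum_left
      by (intro sum.cong) (use that G in \<open>auto simp: subset_iff orthonormal_basis_inner[OF F]\<close>)
    then show ?thesis using G(1) by simp
  qed
  have ydiff: "(norm (y n - y m))\<^sup>2 \<le> inverse (real (Suc m))" if "m \<le> n" for m n
  proof -
    have "(norm (y n - y m))\<^sup>2 = (\<Sum>e\<in>G n - G m. (c e)\<^sup>2)"
    proof (rule has_sum_unique[OF parseval[OF F]])
      show "((\<lambda>e. (inner (y n - y m) e)\<^sup>2) has_sum (\<Sum>e\<in>G n - G m. (c e)\<^sup>2)) F"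
        by (rule has_sum_finite_neutralI[of "G n - G m"])
           (use G Gmono[OF that] in \<open>auto simp: inner_diff_left yin subset_iff intro!: sum.cong\<close>)
    qed
    also have "\<dots> = (\<Sum>e\<in>G n. (c e)\<^sup>2) - (\<Sum>e\<in>G m. (c e)\<^sup>2)"
      using G Gmono[OF that] by (intro sum_diff) auto
    also have "\<dots> \<le> inverse (real (Suc m))" using le[OF G(1,2), of n] Gge[of m] by linarith
    finally show ?thesis .
  qed
  have "Cauchy y"
  proof (rule metric_CauchyI)
    fix \<epsilon> :: real assume "0 < \<epsilon>"
    then obtain N where N: "inverse (real (Suc N)) < \<epsilon>\<^sup>2"
      using reals_Archimedean[of "\<epsilon>\<^sup>2"] by auto
    have main: "dist (y n) (y m) < \<epsilon>" if "N \<le> m" "m \<le> n" for m n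
    proof -
      have "(norm (y n - y m))\<^sup>2 \<le> inverse (real (Suc m))" by (rule ydiff) fact
      also have "\<dots> \<le> inverse (real (Suc N))" using that by (auto intro!: le_imp_inverse_le)
      finally have "(norm (y n - y m))\<^sup>2 < \<epsilon>\<^sup>2" using N by linarith
      then show ?thesis using \<open>0 < \<epsilon>\<close> by (simp add: dist_norm power2_less_imp_less)
    qed
    show "\<exists>M. \<forall>m\<ge>M. \<forall>n\<ge>M. dist (y m) (y n) < \<epsilon>"
      using main by (intro exI[of _ N]) (metis dist_commute nle_le)
  qed
  then obtain z where z: "y \<longlonglongrightarrow> z" by (auto simp: Cauchy_convergent_iff convergent_def)
  have "inner z e = c e" if e: "e \<in> F" for e
  proof -
    have lim: "(\<lambda>n. inner (y n) e) \<longlonglongrightarrow> inner z e" by (intro tendsto_intros z)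
    show ?thesis
    proof (cases "\<exists>m. e \<in> G m")
      case True
      then obtain m where "e \<in> G m" by blast
      then have "\<forall>\<^sub>F n in sequentially. c e = inner (y n) e"
        using Gmono by (auto simp: eventually_sequentially yin[OF e] intro!: exI[of _ m])
      then have "(\<lambda>n. inner (y n) e) \<longlonglongrightarrow> c e"
        using tendsto_eventually[of "\<lambda>n. inner (y n) e" "c e"] by (simp add: eq_commute)
      with lim show ?thesis by (rule LIMSEQ_unique)
    next
      case False
      \<comment> \<open>An e missed by every \<open>G n\<close> must have \<open>c e = 0\<close>:
        adding it to \<open>G n\<close> may not exceed L, and \<open>G n\<close> already captures
        all but 1/(n+1) of L.\<close>
      have "(c e)\<^sup>2 \<le> inverse (real (Suc n))" for n
      proof -
        have "(c e)\<^sup>2 + (\<Sum>e\<in>G n. (c e)\<^sup>2) = (\<Sum>e\<in>insert e (G n). (c e)\<^sup>2)"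
          using False G(1) by simp
        also have "\<dots> \<le> L" using G e by (intro le) auto
        finally show ?thesis using Gge[of n] by linarith
      qed
      then have "(c e)\<^sup>2 \<le> 0"
        by (intro LIMSEQ_le_const[OF LIMSEQ_inverse_real_of_nat]) auto
      then have "c e = 0" by simp
      with False lim show ?thesis by (simp add: yin[OF e] LIMSEQ_const_iff)
    qed
  qed
  then show ?thesis by blast
qed

text \<open>By orthogonality the squared distance from a finite partial sum to y is
  \<open>(norm y)\<^sup>2\<close> minus the partial sum of the squared norms, so convergence of a
  real sum gives convergence of the vectors.\<close>

lemma has_sum_orthogonal:
  fixes v :: "'i \<Rightarrow> 'a::real_inner"
  assumes orth: "\<And>i j. i \<in> I \<Longrightarrow> j \<in> I \<Longrightarrow> i \<noteq> j \<Longrightarrow> inner (v i) (v j) = 0"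
    and y: "\<And>i. i \<in> I \<Longrightarrow> inner y (v i) = (norm (v i))\<^sup>2"
    and hs: "((\<lambda>i. (norm (v i))\<^sup>2) has_sum (norm y)\<^sup>2) I"
  shows "(v has_sum y) I"
proof -
  have key: "(norm (sum v G - y))\<^sup>2 = (norm y)\<^sup>2 - (\<Sum>i\<in>G. (norm (v i))\<^sup>2)"
    if "finite G" "G \<subseteq> I" for G
  proof -
    have 1: "inner y (sum v G) = (\<Sum>i\<in>G. (norm (v i))\<^sup>2)"
      unfolding inner_sum_right using that y by (intro sum.cong) auto
    have "inner (sum v G) (sum v G) = (\<Sum>i\<in>G. \<Sum>j\<in>G. if i = j then (norm (v i))\<^sup>2 else 0)"
      unfolding inner_sum_right inner_sum_left using that orth
      by (intro sum.cong) (auto simp: power2_norm_eq_inner subset_iff)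
    also have "\<dots> = (\<Sum>i\<in>G. (norm (v i))\<^sup>2)" using that by simp
    finally have 2: "inner (sum v G) (sum v G) = (\<Sum>i\<in>G. (norm (v i))\<^sup>2)" .
    have "(norm (sum v G - y))\<^sup>2 = inner (sum v G) (sum v G) - 2 * inner y (sum v G) + (norm y)\<^sup>2"
      by (simp add: power2_norm_eq_inner inner_diff_left inner_diff_right inner_commute)
    then show ?thesis using 1 2 by simp
  qed
  have "((\<lambda>G. (norm y)\<^sup>2 - (\<Sum>i\<in>G. (norm (v i))\<^sup>2)) \<longlongrightarrow> (norm y)\<^sup>2 - (norm y)\<^sup>2)
    (finite_subsets_at_top I)"
    using hs unfolding has_sum_def by (intro tendsto_intros)
  then have "((\<lambda>G. sqrt ((norm y)\<^sup>2 - (\<Sum>i\<in>G. (norm (v i))\<^sup>2))) \<longlongrightarrow> sqrt 0)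
    (finite_subsets_at_top I)" by (intro tendsto_real_sqrt) simp
  moreover have "\<forall>\<^sub>F G in finite_subsets_at_top I.
      sqrt ((norm y)\<^sup>2 - (\<Sum>i\<in>G. (norm (v i))\<^sup>2)) = norm (sum v G - y)"
    by (intro eventually_finite_subsets_at_top_weakI) (simp add: key[symmetric])
  ultimately have "((\<lambda>G. norm (sum v G - y)) \<longlongrightarrow> 0) (finite_subsets_at_top I)"
    by (simp add: tendsto_cong)
  then have "((\<lambda>G. sum v G - y) \<longlongrightarrow> 0) (finite_subsets_at_top I)"
    by (rule tendsto_norm_zero_cancel)
  then show ?thesis unfolding has_sum_def by (simp add: LIM_zero_iff)
qed

section \<open>Diagonalisation of a compact operator\<close>

text \<open>The eigenvalue is the supremum m of \<open>(norm (T x))\<^sup>2\<close> on the unit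
  sphere of V. A maximising sequence is asymptotically an eigenvector, and for m > 0 compactness
  extracts a limit. V is general because the lemma is applied to the orthogonal complement of
  eigenvectors already found.\<close>

lemma compact_operator_eigenvector:
  fixes T :: "'a::{real_inner,complete_space} \<Rightarrow> 'b::{real_inner,complete_space}"
  assumes T: "compact_operator T" and V: "subspace V" "closed V" "V \<noteq> {0}"
    and inv: "\<And>x. x \<in> V \<Longrightarrow> adjoint T (T x) \<in> V"
  shows "\<exists>e\<in>V. norm e = 1 \<and> (\<exists>m\<ge>0. adjoint T (T e) = m *\<^sub>R e)"
proof -
  define A where "A x = adjoint T (T x)" for x
  have bT: "bounded_linear T" using T by (simp add: compact_operator_def)
  note adj = adjoint_hilbert(1)[OF bT]
  interpret T: bounded_linear T by fact
  interpret T': bounded_linear "adjoint T" by (rule adjoint_hilbert(2)[OF bT])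
  have A_inner: "inner (A x) y = inner (T x) (T y)" for x y
    using adj[of y "T x"] by (simp add: A_def inner_commute)
  obtain K where K: "\<And>x. norm (T x) \<le> norm x * K" "0 < K" using T.pos_bounded by blast
  define S where "S = (\<lambda>x. (norm (T x))\<^sup>2) ` {x \<in> V. norm x = 1}"
  define m where "m = Sup S"
  have "0 \<in> V" using V(1) by (rule subspace_0)
  then obtain x0 where x0: "x0 \<in> V" "x0 \<noteq> 0" using V(3) by blast
  then have unit: "(1 / norm x0) *\<^sub>R x0 \<in> V" "norm ((1 / norm x0) *\<^sub>R x0) = 1"
    using V(1) by (auto intro: subspace_scale)
  then have ne: "S \<noteq> {}" by (auto simp: S_def)
  have "(norm (T x))\<^sup>2 \<le> K\<^sup>2" if "norm x = 1" for x
    using K(1)[of x] that by (intro power_mono) auto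
  then have bdd: "bdd_above S" by (auto simp: S_def intro!: bdd_aboveI[of _ "K\<^sup>2"])
  have le1: "(norm (T x))\<^sup>2 \<le> m" if "x \<in> V" "norm x = 1" for x
    unfolding m_def using bdd that by (intro cSup_upper) (auto simp: S_def)
  have m0: "0 \<le> m" using le1[OF unit] by (rule order_trans[rotated]) simp
  have leV: "(norm (T x))\<^sup>2 \<le> m * (norm x)\<^sup>2" if "x \<in> V" for x
  proof (cases "x = 0")
    case False
    have "(norm (T ((1 / norm x) *\<^sub>R x)))\<^sup>2 \<le> m"
      using False that V(1) by (intro le1) (auto intro: subspace_scale)
    then have "(norm (T x))\<^sup>2 / (norm x)\<^sup>2 \<le> m"
      by (simp add: T.scaleR power_divide)
    then show ?thesis using False by (simp add: field_simps)
  qed (simp add: T.zero)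
  \<comment> \<open>Cauchy-Schwarz for \<open>inner (T x) (T (A x))\<close>; since
    \<open>A x\<close> lies in V again, \<open>leV\<close> applies to it too.\<close>
  have leA: "(norm (A x))\<^sup>2 \<le> m\<^sup>2" if "x \<in> V" "norm x = 1" for x
  proof (cases "A x = 0")
    case False
    have "(norm (A x))\<^sup>2 = inner (T x) (T (A x))"
      by (simp add: power2_norm_eq_inner A_inner)
    also have "\<dots> \<le> norm (T x) * norm (T (A x))" by (rule norm_cauchy_schwarz)
    finally have "((norm (A x))\<^sup>2)\<^sup>2 \<le> (norm (T x) * norm (T (A x)))\<^sup>2" by (intro power_mono) auto
    also have "\<dots> = (norm (T x))\<^sup>2 * (norm (T (A x)))\<^sup>2" by (simp add: power_mult_distrib)
    also have "\<dots> \<le> m * (m * (norm (A x))\<^sup>2)"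
      using that inv m0 by (intro mult_mono le1 leV) (auto simp: A_def)
    finally show ?thesis using False by (simp add: power2_eq_square)
  qed simp
  show ?thesis
  proof (cases "m = 0")
    case True
    then have "T ((1 / norm x0) *\<^sub>R x0) = 0" using le1[OF unit] by simp
    with unit show ?thesis by (intro bexI conjI exI[of _ 0]) (auto simp: T'.zero)
  next
    case False
    then have m: "0 < m" using m0 by simp
    have "\<exists>x\<in>V. norm x = 1 \<and> m - inverse (real (Suc n)) < (norm (T x))\<^sup>2" for n
    proof -
      have "m - inverse (real (Suc n)) < Sup S" by (simp add: m_def)
      from less_cSupD[OF ne this] show ?thesis by (auto simp: S_def)
    qed
    then obtain x where x: "\<And>n. x n \<in> V" "\<And>n. norm (x n) = 1"
      "\<And>n. m - inverse (real (Suc n)) < (norm (T (x n)))\<^sup>2" by metis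
    have "compact (closure (T ` {x. norm x \<le> 1}))"
    proof -
      have "bounded {x :: 'a. norm x \<le> 1}" by (auto simp: bounded_iff)
      then show ?thesis using T by (simp add: compact_operator_def)
    qed
    moreover have "T (x n) \<in> closure (T ` {x. norm x \<le> 1})" for n
      using x(2)[of n] closure_subset by fastforce
    ultimately obtain y r where r: "strict_mono r" "((\<lambda>n. T (x n)) \<circ> r) \<longlonglongrightarrow> y"
      unfolding compact_def by metis
    have Ax: "(\<lambda>n. A (x (r n))) \<longlonglongrightarrow> adjoint T y"
      using T'.tendsto[OF r(2)] by (simp add: A_def o_def)
    have sq: "(norm (A (x n) - m *\<^sub>R x n))\<^sup>2 \<le> 2 * m * inverse (real (Suc n))" for n
    proof -
      have "(norm (A (x n) - m *\<^sub>R x n))\<^sup>2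
          = (norm (A (x n)))\<^sup>2 - 2 * m * inner (A (x n)) (x n) + m\<^sup>2 * (norm (x n))\<^sup>2"
        unfolding power2_norm_eq_inner
        by (simp add: inner_simps inner_commute algebra_simps power2_eq_square)
      also have "\<dots> \<le> m\<^sup>2 - 2 * m * (norm (T (x n)))\<^sup>2 + m\<^sup>2"
        using leA[OF x(1,2)] by (simp add: A_inner power2_norm_eq_inner[symmetric] x(2))
      also have "\<dots> \<le> m\<^sup>2 - 2 * m * (m - inverse (real (Suc n))) + m\<^sup>2"
        using x(3)[of n] m by (simp add: less_imp_le)
      also have "\<dots> = 2 * m * inverse (real (Suc n))"
        by (simp add: algebra_simps power2_eq_square)
      finally show ?thesis .
    qed
    have "(\<lambda>n. (norm (A (x n) - m *\<^sub>R x n))\<^sup>2) \<longlonglongrightarrow> 0"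
    proof (rule tendsto_sandwich[of "\<lambda>_. 0"])
      have "(\<lambda>n. 2 * m * inverse (real (Suc n))) \<longlonglongrightarrow> 2 * m * 0"
        by (intro tendsto_intros LIMSEQ_inverse_real_of_nat)
      then show "(\<lambda>n. 2 * m * inverse (real (Suc n))) \<longlonglongrightarrow> 0" by simp
    qed (use sq in auto)
    then have "(\<lambda>n. sqrt ((norm (A (x n) - m *\<^sub>R x n))\<^sup>2)) \<longlonglongrightarrow> sqrt 0"
      by (rule tendsto_real_sqrt)
    then have "(\<lambda>n. A (x n) - m *\<^sub>R x n) \<longlonglongrightarrow> 0" by (simp add: tendsto_norm_zero_iff)
    \<comment> \<open>Compactness only makes \<open>T (x (r n))\<close>, hence
      \<open>A (x (r n))\<close>, converge. As \<open>A x - m *\<^sub>R x\<close> tends to 0 along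
      the sequence and m > 0, the vectors \<open>x (r n)\<close> converge as well.\<close>
    from LIMSEQ_subseq_LIMSEQ[OF this r(1)]
    have "(\<lambda>n. A (x (r n)) - (A (x (r n)) - m *\<^sub>R x (r n))) \<longlonglongrightarrow> adjoint T y - 0"
      by (intro tendsto_diff Ax) (simp add: o_def)
    then have "(\<lambda>n. (1 / m) *\<^sub>R (m *\<^sub>R x (r n))) \<longlonglongrightarrow> (1 / m) *\<^sub>R adjoint T y"
      by (intro tendsto_scaleR tendsto_const) simp
    then have lim: "(\<lambda>n. x (r n)) \<longlonglongrightarrow> (1 / m) *\<^sub>R adjoint T y" using m by simp
    define e where "e = (1 / m) *\<^sub>R adjoint T y"
    have lim: "(\<lambda>n. x (r n)) \<longlonglongrightarrow> e" using lim by (simp add: e_def)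
    have "e \<in> V" using closed_sequentially[OF V(2) _ lim] x(1) by blast
    moreover have "norm e = 1" using tendsto_norm[OF lim] x(2) by (simp add: LIMSEQ_const_iff)
    moreover have "A e = m *\<^sub>R e"
    proof (rule LIMSEQ_unique)
      show "(\<lambda>n. A (x (r n))) \<longlonglongrightarrow> A e"
        unfolding A_def by (intro T'.tendsto T.tendsto lim)
      show "(\<lambda>n. A (x (r n))) \<longlonglongrightarrow> m *\<^sub>R e" using Ax m by (simp add: e_def)
    qed
    ultimately show ?thesis using m by (auto simp: A_def intro!: bexI[of _ e] exI[of _ m])
  qed
qed

lemma subspace_closure_span: "subspace (closure (span S))" for S :: "'a::real_normed_vector set"
proof (rule subspaceI)
  show "0 \<in> closure (span S)" using closure_subset span_zero by blast
next
  fix x y assume "x \<in> closure (span S)" "y \<in> closure (span S)"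
  then obtain f g where "\<And>n. f n \<in> span S" "f \<longlonglongrightarrow> x" "\<And>n. g n \<in> span S" "g \<longlonglongrightarrow> y"
    unfolding closure_sequential by blast
  then show "x + y \<in> closure (span S)" unfolding closure_sequential
    by (intro exI[of _ "\<lambda>n. f n + g n"]) (auto intro: tendsto_add span_add)
next
  fix c x assume "x \<in> closure (span S)"
  then obtain f where "\<And>n. f n \<in> span S" "f \<longlonglongrightarrow> x"
    unfolding closure_sequential by blast
  then show "c *\<^sub>R x \<in> closure (span S)" unfolding closure_sequential
    by (intro exI[of _ "\<lambda>n. c *\<^sub>R f n"]) (auto intro: tendsto_scaleR span_scale)
qed

text \<open>Zorn's lemma handles the kernel of \<open>T\<close>, which need not be separable, together with the
  eigenvectors for the nonzero eigenvalues.\<close>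

lemma eigenbasis_exists:
  fixes T :: "'a::{real_inner,complete_space} \<Rightarrow> 'b::{real_inner,complete_space}"
  assumes T: "compact_operator T"
  shows "\<exists>F. orthonormal_basis F \<and> (\<forall>e\<in>F. \<exists>m\<ge>0. adjoint T (T e) = m *\<^sub>R e)"
proof -
  have bT: "bounded_linear T" using T by (simp add: compact_operator_def)
  note adj = adjoint_hilbert(1)[OF bT]
  have sa: "inner (adjoint T (T x)) y = inner x (adjoint T (T y))" for x y
    using adj[of y "T x"] adj[of x "T y"] by (simp add: inner_commute)
  define \<C> where "\<C> = {F. pairwise orthogonal F \<and> (\<forall>e\<in>F. norm e = 1) \<and>
    (\<forall>e\<in>F. \<exists>m\<ge>0. adjoint T (T e) = m *\<^sub>R e)}"
  have "\<Union>C \<in> \<C>" if C: "subset.chain \<C> C" for C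
  proof -
    have "pairwise orthogonal (\<Union>C)"
    proof (rule pairwiseI)
      fix x y assume "x \<in> \<Union>C" "y \<in> \<Union>C" "x \<noteq> y"
      then obtain X Y where XY: "X \<in> C" "Y \<in> C" "x \<in> X" "y \<in> Y" by blast
      with C have "X \<subseteq> Y \<or> Y \<subseteq> X" by (auto simp: subset_chain_def)
      then obtain Z where "Z \<in> C" "x \<in> Z" "y \<in> Z" using XY by blast
      moreover have "pairwise orthogonal Z" using C \<open>Z \<in> C\<close> by (auto simp: subset_chain_def \<C>_def)
      ultimately show "orthogonal x y" using \<open>x \<noteq> y\<close> by (auto simp: pairwise_def)
    qed
    moreover have "(\<forall>e\<in>\<Union>C. norm e = 1) \<and> (\<forall>e\<in>\<Union>C. \<exists>m\<ge>0. adjoint T (T e) = m *\<^sub>R e)"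
    proof -
      have "X \<in> \<C>" if "X \<in> C" for X using C that by (auto simp: subset_chain_def)
      then show ?thesis by (auto simp: \<C>_def)
    qed
    ultimately show ?thesis by (simp add: \<C>_def)
  qed
  from subset_Zorn'[of \<C>, OF this] obtain F where
    F: "F \<in> \<C>" and max: "\<And>X. X \<in> \<C> \<Longrightarrow> F \<subseteq> X \<Longrightarrow> X = F" by blast
  \<comment> \<open>The orthogonal complement of the maximal family. It is invariant because A is
    self-adjoint, so a nonzero V would contain an eigenvector enlarging F.\<close>
  define V where "V = {x. \<forall>e\<in>F. inner x e = 0}"
  have sub: "subspace V" by (auto simp: V_def subspace_def inner_simps)
  have "V = (\<Inter>e\<in>F. {x. inner x e = 0})" by (auto simp: V_def)
  then have cl: "closed V" by (auto intro!: closed_Collect_eq continuous_intros)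
  have inv: "adjoint T (T x) \<in> V" if "x \<in> V" for x
    unfolding V_def
  proof (intro CollectI ballI)
    fix e assume e: "e \<in> F"
    then obtain m where "adjoint T (T e) = m *\<^sub>R e" using F by (auto simp: \<C>_def)
    then show "inner (adjoint T (T x)) e = 0" using that e by (simp add: sa V_def)
  qed
  have V0: "V = {0}"
  proof (rule ccontr)
    assume "V \<noteq> {0}"
    then obtain e where e: "e \<in> V" "norm e = 1" "\<exists>m\<ge>0. adjoint T (T e) = m *\<^sub>R e"
      using compact_operator_eigenvector[OF T sub cl _ inv] by blast
    have "insert e F \<in> \<C>"
      using F e by (auto simp: \<C>_def V_def pairwise_insert orthogonal_def inner_commute)
    from max[OF this] have "e \<in> F" by blast
    with e(1,2) show False by (auto simp: V_def norm_eq_1)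
  qed
  have "closure (span F) = UNIV"
  proof -
    have "x \<in> closure (span F)" for x
    proof -
      obtain p where p: "p \<in> closure (span F)" "\<And>v. v \<in> closure (span F) \<Longrightarrow> inner (x - p) v = 0"
        using closed_subspace_projection[OF subspace_closure_span closed_closure, of F x] by blast
      have "F \<subseteq> closure (span F)" using closure_subset[of "span F"] span_superset[of F] by blast
      then have "x - p \<in> V" using p(2) by (auto simp: V_def)
      then show ?thesis using p(1) V0 by simp
    qed
    then show ?thesis by blast
  qed
  then show ?thesis using F by (auto simp: \<C>_def orthonormal_basis_def)
qed

section \<open>Functional calculus in an eigenbasis\<close>

lemma infsum_ennreal_has_sum:
  fixes f :: "'i \<Rightarrow> real"
  assumes "(f has_sum L) I" and nn: "\<And>i. i \<in> I \<Longrightarrow> 0 \<le> f i"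
  shows "infsum (\<lambda>i. ennreal (f i)) I = ennreal L"
proof -
  have "ennreal (infsum f I) = (SUP G\<in>{G. finite G \<and> G \<subseteq> I}. ennreal (sum f G))"
    using assms by (intro infsum_nonneg_is_SUPREMUM_ennreal) (auto intro: has_sum_imp_summable)
  also have "\<dots> = (SUP G\<in>{G. finite G \<and> G \<subseteq> I}. sum (\<lambda>i. ennreal (f i)) G)"
    using nn by (intro SUP_cong refl sum_ennreal[symmetric]) (auto simp: subset_iff)
  also have "\<dots> = infsum (\<lambda>i. ennreal (f i)) I" by (intro nonneg_infsum_complete[symmetric]) simp
  finally show ?thesis using assms(1) by (simp add: infsumI)
qed

lemma nn_integral_count_space_has_sum:
  fixes f :: "'i \<Rightarrow> real"
  assumes "(f has_sum L) I" and nn: "\<And>i. i \<in> I \<Longrightarrow> 0 \<le> f i"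
  shows "(\<integral>\<^sup>+i. ennreal (f i) \<partial>count_space I) = ennreal L" "integral\<^sup>L (count_space I) f = L"
proof -
  have "f summable_on I" using assms(1) by (rule has_sum_imp_summable)
  then have "(\<lambda>i. norm (f i)) summable_on I"
    by (subst summable_on_cong[of _ _ f]) (use nn in auto)
  then have abs: "Infinite_Set_Sum.abs_summable_on f I"
    by (simp only: abs_summable_equivalent)
  show "(\<integral>\<^sup>+i. ennreal (f i) \<partial>count_space I) = ennreal L"
    using nn_integral_conv_infsetsum[OF abs nn] infsetsum_infsum[OF abs] infsumI[OF assms(1)] by simp
  show "integral\<^sup>L (count_space I) f = L"
    using infsetsum_infsum[OF abs] infsumI[OF assms(1)] by (simp add: infsetsum_def)
qed

text \<open>Finite outer sums commute with the inner one, and unordered sums are suprema of finite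
  ones. The index sets are arbitrary because the counting measure on an uncountable basis is not
  sigma-finite; exchanging the roles gives equality.\<close>

lemma infsum_ennreal_swap_le:
  fixes h :: "'i \<Rightarrow> 'j \<Rightarrow> ennreal"
  shows "(\<Sum>\<^sub>\<infinity>i\<in>I. \<Sum>\<^sub>\<infinity>j\<in>J. h i j) \<le> (\<Sum>\<^sub>\<infinity>j\<in>J. \<Sum>\<^sub>\<infinity>i\<in>I. h i j)"
proof -
  have "(\<Sum>i\<in>G. \<Sum>\<^sub>\<infinity>j\<in>J. h i j) \<le> (\<Sum>\<^sub>\<infinity>j\<in>J. \<Sum>\<^sub>\<infinity>i\<in>I. h i j)" if G: "finite G" "G \<subseteq> I" for G
  proof -
    have "(\<Sum>i\<in>G. \<Sum>\<^sub>\<infinity>j\<in>J. h i j) = (\<Sum>\<^sub>\<infinity>j\<in>J. \<Sum>i\<in>G. h i j)"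
      using G(1)
    proof induction
      case (insert i G)
      then show ?case using infsum_add[of "h i" J "\<lambda>j. \<Sum>i\<in>G. h i j"]
        by (simp add: nonneg_summable_on_complete)
    qed simp
    also have "\<dots> \<le> (\<Sum>\<^sub>\<infinity>j\<in>J. \<Sum>\<^sub>\<infinity>i\<in>I. h i j)"
    proof (rule infsum_mono)
      fix j assume "j \<in> J"
      have "(\<Sum>i\<in>G. h i j) = (\<Sum>\<^sub>\<infinity>i\<in>G. h i j)" using G(1) by simp
      also have "\<dots> \<le> (\<Sum>\<^sub>\<infinity>i\<in>I. h i j)" using G(2) by (intro infsum_mono_neutral) (auto intro: nonneg_summable_on_complete)
      finally show "(\<Sum>i\<in>G. h i j) \<le> (\<Sum>\<^sub>\<infinity>i\<in>I. h i j)" .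
    qed (auto intro: nonneg_summable_on_complete)
    finally show ?thesis .
  qed
  then show ?thesis
    by (subst nonneg_infsum_complete) (auto intro!: SUP_least)
qed

lemma infsum_ennreal_swap:
  fixes h :: "'i \<Rightarrow> 'j \<Rightarrow> ennreal"
  shows "(\<Sum>\<^sub>\<infinity>i\<in>I. \<Sum>\<^sub>\<infinity>j\<in>J. h i j) = (\<Sum>\<^sub>\<infinity>j\<in>J. \<Sum>\<^sub>\<infinity>i\<in>I. h i j)"
  by (intro antisym infsum_ennreal_swap_le)

text \<open>Eigenvalues are attached to basis vectors through \<open>ev\<close>, which treats
  multiplicities and a kernel of any dimension uniformly and avoids an enumeration.\<close>

locale diagonal_operator =
  fixes A :: "'a::{real_inner,complete_space} \<Rightarrow> 'a" and F :: "'a set" and ev :: "'a \<Rightarrow> real"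
  assumes A_linear: "bounded_linear A"
    and A_selfadjoint: "inner (A x) y = inner x (A y)"
    and onb: "orthonormal_basis F"
    and eig: "e \<in> F \<Longrightarrow> A e = ev e *\<^sub>R e"
    and ev_nonneg: "e \<in> F \<Longrightarrow> 0 \<le> ev e"
begin

definition bounded_symbol :: "(real \<Rightarrow> real) \<Rightarrow> bool" where
  "bounded_symbol f \<longleftrightarrow> (\<exists>K. \<forall>e\<in>F. \<bar>f (ev e)\<bar> \<le> K)"

text \<open>For bounded symbols the choice is determined: Riesz-Fischer gives existence, and a
  vector is fixed by its coefficients.\<close>

definition diag :: "(real \<Rightarrow> real) \<Rightarrow> 'a \<Rightarrow> 'a" where
  "diag f x = (SOME y. \<forall>e\<in>F. inner y e = f (ev e) * inner x e)"

lemma norm_F: "e \<in> F \<Longrightarrow> norm e = 1"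
  using onb by (simp add: orthonormal_basis_def)

lemma ev_le_onorm: "e \<in> F \<Longrightarrow> ev e \<le> onorm A"
  using onorm[OF A_linear, of e] ev_nonneg[of e] by (simp add: eig norm_F)

lemma ev_mem: "e \<in> F \<Longrightarrow> ev e \<in> {0..onorm A}"
  using ev_nonneg ev_le_onorm by simp

lemma A_inner: "e \<in> F \<Longrightarrow> inner (A x) e = ev e * inner x e"
  by (simp add: A_selfadjoint eig)

lemma bounded_symbolI: "(\<And>t. t \<in> {0..onorm A} \<Longrightarrow> \<bar>f t\<bar> \<le> K) \<Longrightarrow> bounded_symbol f"
  unfolding bounded_symbol_def using ev_mem by blast

lemma bounded_symbol_id: "bounded_symbol (\<lambda>t. t)"
  by (rule bounded_symbolI[of _ "onorm A"]) auto

lemma bounded_symbol_mult: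
  assumes "bounded_symbol f" "bounded_symbol g"
  shows "bounded_symbol (\<lambda>t. f t * g t)"
proof -
  obtain K L where KL: "\<And>e. e \<in> F \<Longrightarrow> \<bar>f (ev e)\<bar> \<le> K" "\<And>e. e \<in> F \<Longrightarrow> \<bar>g (ev e)\<bar> \<le> L"
    using assms unfolding bounded_symbol_def by blast
  have "\<bar>f (ev e) * g (ev e)\<bar> \<le> \<bar>K\<bar> * \<bar>L\<bar>" if "e \<in> F" for e
    unfolding abs_mult using KL[OF that] by (intro mult_mono) auto
  then show ?thesis unfolding bounded_symbol_def by blast
qed

lemma bounded_symbol_indicator: "bounded_symbol (indicator B)"
  by (rule bounded_symbolI[of _ 1]) (auto simp: indicator_def)

lemma diag_inner:
  assumes "bounded_symbol f" "e \<in> F"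
  shows "inner (diag f x) e = f (ev e) * inner x e"
proof -
  obtain K where K: "\<And>e. e \<in> F \<Longrightarrow> \<bar>f (ev e)\<bar> \<le> K"
    using assms(1) unfolding bounded_symbol_def by blast
  have "(\<lambda>e. (f (ev e) * inner x e)\<^sup>2) summable_on F"
  proof (rule summable_on_comparison_test)
    show "(\<lambda>e. K\<^sup>2 * (inner x e)\<^sup>2) summable_on F"
      using parseval[OF onb] by (intro summable_on_cmult_right has_sum_imp_summable)
    show "(f (ev e) * inner x e)\<^sup>2 \<le> K\<^sup>2 * (inner x e)\<^sup>2" if "e \<in> F" for e
    proof -
      have "\<bar>f (ev e)\<bar>\<^sup>2 \<le> K\<^sup>2" using K[OF that] by (intro power_mono) auto
      then show ?thesis by (simp add: power_mult_distrib mult_right_mono)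
    qed
  qed auto
  from riesz_fischer[OF onb this]
  have "\<forall>e\<in>F. inner (diag f x) e = f (ev e) * inner x e"
    unfolding diag_def by (rule someI_ex)
  with assms(2) show ?thesis by blast
qed

lemma eqI: "(\<And>e. e \<in> F \<Longrightarrow> inner x e = inner y e) \<Longrightarrow> x = y"
  by (rule orthonormal_basis_eqI[OF onb])

lemma diag_norm:
  assumes "bounded_symbol f"
  shows "((\<lambda>e. (f (ev e))\<^sup>2 * (inner x e)\<^sup>2) has_sum (norm (diag f x))\<^sup>2) F"
  using parseval[OF onb, of "diag f x"]
  by (subst has_sum_cong[of _ _ "\<lambda>e. (inner (diag f x) e)\<^sup>2"])
     (auto simp: diag_inner[OF assms] power_mult_distrib)

text \<open>Parseval reduces an operator estimate to a pointwise comparison at the eigenvalues; the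
  later bounds on bias, residual and propagated noise are instances.\<close>

lemma diag_norm_le:
  assumes f: "bounded_symbol f" and g: "bounded_symbol g" and c: "0 \<le> c"
    and le: "\<And>e. e \<in> F \<Longrightarrow> \<bar>f (ev e)\<bar> \<le> c * \<bar>g (ev e)\<bar>"
  shows "norm (diag f x) \<le> c * norm (diag g x)"
proof -
  have "(norm (diag f x))\<^sup>2 \<le> c\<^sup>2 * (norm (diag g x))\<^sup>2"
  proof (rule has_sum_mono[OF diag_norm[OF f] has_sum_cmult_right[OF diag_norm[OF g]]])
    fix e assume "e \<in> F"
    have "\<bar>f (ev e)\<bar>\<^sup>2 \<le> (c * \<bar>g (ev e)\<bar>)\<^sup>2" using le[OF \<open>e \<in> F\<close>] by (intro power_mono) auto
    then have "(f (ev e))\<^sup>2 * (inner x e)\<^sup>2 \<le> (c * \<bar>g (ev e)\<bar>)\<^sup>2 * (inner x e)\<^sup>2"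
      by (intro mult_right_mono) auto
    then show "(f (ev e))\<^sup>2 * (inner x e)\<^sup>2 \<le> c\<^sup>2 * ((g (ev e))\<^sup>2 * (inner x e)\<^sup>2)"
      by (simp add: power_mult_distrib mult.assoc)
  qed
  then have "(norm (diag f x))\<^sup>2 \<le> (c * norm (diag g x))\<^sup>2" by (simp add: power_mult_distrib)
  then show ?thesis using c by (auto intro: power2_le_imp_le)
qed

lemma bounded_symbol_const: "bounded_symbol (\<lambda>_. c)"
  by (rule bounded_symbolI[of _ "\<bar>c\<bar>"]) auto

lemma diag_one: "diag (\<lambda>_. 1) x = x"
  by (rule eqI) (simp add: diag_inner bounded_symbol_const)

lemma diag_norm_le_id:
  assumes f: "bounded_symbol f" and c: "0 \<le> c" and le: "\<And>e. e \<in> F \<Longrightarrow> \<bar>f (ev e)\<bar> \<le> c"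
  shows "norm (diag f x) \<le> c * norm x"
  using diag_norm_le[OF f bounded_symbol_const[of 1] c, of x] le by (simp add: diag_one)

lemma A_eq_diag: "A x = diag (\<lambda>t. t) x"
  by (rule eqI) (simp add: diag_inner bounded_symbol_id A_inner)

lemma diag_diag:
  assumes "bounded_symbol f" "bounded_symbol g"
  shows "diag f (diag g x) = diag (\<lambda>t. f t * g t) x"
  by (rule eqI) (simp add: diag_inner bounded_symbol_mult assms)

lemma bounded_linear_diag:
  assumes f: "bounded_symbol f"
  shows "bounded_linear (diag f)"
proof -
  obtain K where K: "\<And>e. e \<in> F \<Longrightarrow> \<bar>f (ev e)\<bar> \<le> K"
    using f unfolding bounded_symbol_def by blast
  then have K: "\<And>e. e \<in> F \<Longrightarrow> \<bar>f (ev e)\<bar> \<le> \<bar>K\<bar>" by fastforce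
  show ?thesis
  proof (rule bounded_linear_intro)
    show "norm (diag f x) \<le> norm x * \<bar>K\<bar>" for x
      using diag_norm_le_id[OF f _ K, of x] by (simp add: mult.commute)
  qed (auto intro!: eqI simp: diag_inner[OF f] inner_simps algebra_simps)
qed

lemma eigenspace_iff: "x \<in> eigenspace A l \<longleftrightarrow> (\<forall>e\<in>F. ev e \<noteq> l \<longrightarrow> inner x e = 0)"
proof
  assume "x \<in> eigenspace A l"
  then have "A x = l *\<^sub>R x" by (simp add: eigenspace_def)
  then have "ev e * inner x e = l * inner x e" if "e \<in> F" for e
    using A_inner[OF that, of x] by (simp only: inner_scaleR_left)
  then show "\<forall>e\<in>F. ev e \<noteq> l \<longrightarrow> inner x e = 0" by (metis mult_right_cancel)
next
  assume R: "\<forall>e\<in>F. ev e \<noteq> l \<longrightarrow> inner x e = 0"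
  have "A x = l *\<^sub>R x"
  proof (rule eqI)
    fix e assume "e \<in> F"
    then show "inner (A x) e = inner (l *\<^sub>R x) e"
      using R by (cases "ev e = l") (auto simp: A_inner)
  qed
  then show "x \<in> eigenspace A l" by (simp add: eigenspace_def)
qed

lemma eigenvalues_eq: "eigenvalues A = ev ` F"
proof (intro equalityI subsetI)
  fix l assume "l \<in> eigenvalues A"
  moreover have "0 \<in> eigenspace A l" by (simp add: eigenspace_iff)
  ultimately obtain x where x: "x \<in> eigenspace A l" "x \<noteq> 0" by (auto simp: eigenvalues_def)
  then obtain e where "e \<in> F" "inner x e \<noteq> 0" using eqI[of x 0] by auto
  with x(1) show "l \<in> ev ` F" by (auto simp: eigenspace_iff)
next
  fix l assume "l \<in> ev ` F"
  then obtain e where e: "e \<in> F" "l = ev e" by blast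
  then have "e \<in> eigenspace A l" by (simp add: eigenspace_def eig)
  moreover have "e \<noteq> 0" using norm_F[OF e(1)] by auto
  ultimately show "l \<in> eigenvalues A" by (auto simp: eigenvalues_def)
qed

lemma orth_proj_eigenspace: "orth_proj (eigenspace A l) w = diag (indicator {l}) w"
  unfolding orth_proj_def
proof (rule the_equality)
  let ?p = "diag (indicator {l}) w"
  note ip = diag_inner[OF bounded_symbol_indicator]
  have "inner (w - ?p) v = 0" if "v \<in> eigenspace A l" for v
  proof (rule has_sum_unique[OF parseval_inner[OF onb]])
    show "((\<lambda>e. inner (w - ?p) e * inner v e) has_sum 0) F"
      using that by (intro has_sum_0) (auto simp: eigenspace_iff inner_diff_left ip indicator_def)
  qed
  moreover show "?p \<in> eigenspace A l \<and> (\<forall>v\<in>eigenspace A l. inner (w - ?p) v = 0)"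
    using calculation by (auto simp: eigenspace_iff ip)
  ultimately show "p = ?p" if p: "p \<in> eigenspace A l \<and> (\<forall>v\<in>eigenspace A l. inner (w - p) v = 0)" for p
  proof (intro eqI)
    fix e assume e: "e \<in> F"
    show "inner p e = inner ?p e"
    proof (cases "ev e = l")
      case True
      then have "e \<in> eigenspace A l" using e by (simp add: eigenspace_def eig)
      then have "inner (w - p) e = 0" using p by blast
      then show ?thesis using True e by (simp add: ip inner_diff_left)
    qed (use p e in \<open>auto simp: eigenspace_iff ip\<close>)
  qed
qed

text \<open>\<open>op_fun\<close> sums over distinct eigenvalues while \<open>diag\<close> acts on
  basis vectors. The eigenspace components are mutually orthogonal, so
  \<open>has_sum_orthogonal\<close> applies, and the squared norms match after grouping F by the
  value of \<open>ev\<close>.\<close>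

lemma op_fun_eq_diag:
  assumes f: "bounded_symbol f"
  shows "op_fun A f w = diag f w"
proof -
  let ?v = "\<lambda>l. f l *\<^sub>R diag (indicator {l}) w"
  note ip = diag_inner[OF bounded_symbol_indicator]
  have vin: "inner (?v l) e = (if ev e = l then f (ev e) * inner w e else 0)" if "e \<in> F" for l e
    using that by (simp add: ip)
  have vnorm: "((\<lambda>e. (inner (?v l) e)\<^sup>2) has_sum (norm (?v l))\<^sup>2) F" for l
    by (rule parseval[OF onb])
  have bij: "bij_betw (\<lambda>e. (ev e, e)) F (Sigma (ev ` F) (\<lambda>l. {e\<in>F. ev e = l}))"
    by (rule bij_betwI[of _ _ _ snd]) auto
  have "(?v has_sum diag f w) (ev ` F)"
  proof (rule has_sum_orthogonal)
    fix l l' :: real assume "l \<noteq> l'"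
    show "inner (?v l) (?v l') = 0"
      by (rule has_sum_unique[OF parseval_inner[OF onb]])
         (intro has_sum_0, use \<open>l \<noteq> l'\<close> vin in auto)
  next
    fix l
    show "inner (diag f w) (?v l) = (norm (?v l))\<^sup>2"
      by (rule has_sum_unique[OF parseval_inner[OF onb]])
         (rule has_sum_cong[THEN iffD1, OF _ vnorm], use vin f in \<open>auto simp: diag_inner power2_eq_square\<close>)
  next
    show "((\<lambda>l. (norm (?v l))\<^sup>2) has_sum (norm (diag f w))\<^sup>2) (ev ` F)"
    proof (rule has_sum_SigmaD)
      show "((\<lambda>(l,e). (inner (diag f w) e)\<^sup>2) has_sum (norm (diag f w))\<^sup>2)
        (Sigma (ev ` F) (\<lambda>l. {e\<in>F. ev e = l}))"
        unfolding has_sum_reindex_bij_betw[OF bij, symmetric] using parseval[OF onb] by simp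
      show "((\<lambda>e. case (l, e) of (l, e) \<Rightarrow> (inner (diag f w) e)\<^sup>2) has_sum (norm (?v l))\<^sup>2)
          {e \<in> F. ev e = l}" for l
        using vnorm[of l]
        by (subst has_sum_cong_neutral[where T = F and g = "\<lambda>e. (inner (?v l) e)\<^sup>2"])
           (use vin f in \<open>auto simp: diag_inner\<close>)
    qed
  qed
  then show ?thesis
    unfolding op_fun_def eigenvalues_eq orth_proj_eigenspace by (rule infsumI)
qed

text \<open>\<open>op_trace\<close> is evaluated in an unknown basis S. Expanding each diagonal
  entry in F, exchanging the sums of nonnegative terms and applying Parseval with respect to S moves
  the trace to F.\<close>

lemma op_trace_diag:
  assumes f: "bounded_symbol f" and nn: "\<And>e. e \<in> F \<Longrightarrow> 0 \<le> f (ev e)"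
  shows "op_trace (diag f) = (\<Sum>\<^sub>\<infinity>e\<in>F. ennreal (f (ev e)))"
proof -
  define S where "S = (SOME S::'a set. orthonormal_basis S)"
  have S: "orthonormal_basis S" unfolding S_def by (rule someI[of _ F]) (rule onb)
  have "op_trace (diag f) = (\<Sum>\<^sub>\<infinity>s\<in>S. ennreal (inner (diag f s) s))"
    by (simp add: op_trace_def S_def)
  also have "\<dots> = (\<Sum>\<^sub>\<infinity>s\<in>S. \<Sum>\<^sub>\<infinity>e\<in>F. ennreal (f (ev e) * (inner e s)\<^sup>2))"
  proof (rule infsum_cong)
    fix s
    have "((\<lambda>e. inner (diag f s) e * inner s e) has_sum inner (diag f s) s) F"
      by (rule parseval_inner[OF onb])
    then have "((\<lambda>e. f (ev e) * (inner e s)\<^sup>2) has_sum inner (diag f s) s) F"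
      by (rule has_sum_cong[THEN iffD1, rotated])
         (simp add: diag_inner[OF f] power2_eq_square inner_commute[of s])
    from infsum_ennreal_has_sum[OF this]
    show "ennreal (inner (diag f s) s) = (\<Sum>\<^sub>\<infinity>e\<in>F. ennreal (f (ev e) * (inner e s)\<^sup>2))"
      using nn by simp
  qed
  also have "\<dots> = (\<Sum>\<^sub>\<infinity>e\<in>F. \<Sum>\<^sub>\<infinity>s\<in>S. ennreal (f (ev e) * (inner e s)\<^sup>2))"
    by (rule infsum_ennreal_swap)
  also have "\<dots> = (\<Sum>\<^sub>\<infinity>e\<in>F. ennreal (f (ev e)))"
  proof (rule infsum_cong)
    fix e assume e: "e \<in> F"
    have "((\<lambda>s. f (ev e) * (inner e s)\<^sup>2) has_sum f (ev e) * (norm e)\<^sup>2) S"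
      by (intro has_sum_cmult_right parseval[OF S])
    from infsum_ennreal_has_sum[OF this]
    show "(\<Sum>\<^sub>\<infinity>s\<in>S. ennreal (f (ev e) * (inner e s)\<^sup>2)) = ennreal (f (ev e))"
      using nn[OF e] by (simp add: norm_F[OF e])
  qed
  finally show ?thesis .
qed

text \<open>\<open>measure_of\<close> falls back to the zero measure unless its set function is
  countably additive. Recognising that function as the push-forward of a weighted counting measure
  on F supplies the additivity.\<close>

lemma spectral_measure_eq:
  "spectral_measure A w =
    distr (density (count_space F) (\<lambda>e. ennreal ((inner w e)\<^sup>2))) (count_space UNIV) ev"
    (is "_ = ?\<mu>")
proof -
  have "ennreal ((norm (op_fun A (indicator B) w))\<^sup>2) = emeasure ?\<mu> B" for B
  proof -
    have "emeasure ?\<mu> B = (\<integral>\<^sup>+e. ennreal ((inner w e)\<^sup>2) * indicator (ev -` B \<inter> F) e \<partial>count_space F)"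
      by (simp add: emeasure_distr emeasure_density)
    also have "\<dots> = (\<integral>\<^sup>+e. ennreal ((indicator B (ev e))\<^sup>2 * (inner w e)\<^sup>2) \<partial>count_space F)"
      by (intro nn_integral_cong) (auto simp: indicator_def)
    also have "\<dots> = ennreal ((norm (diag (indicator B) w))\<^sup>2)"
      by (rule nn_integral_count_space_has_sum(1)[OF diag_norm[OF bounded_symbol_indicator]]) auto
    finally show ?thesis by (simp add: op_fun_eq_diag bounded_symbol_indicator)
  qed
  then have "spectral_measure A w = measure_of (space ?\<mu>) (sets ?\<mu>) (emeasure ?\<mu>)"
    by (simp add: spectral_measure_def)
  then show ?thesis by (simp only: measure_of_of_measure)
qed

text \<open>Translates both sides of the source condition into norms: the constant symbol 1 for the
  low frequencies, the residual function for the high ones.\<close>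

lemma set_integral_spectral_measure:
  assumes f: "bounded_symbol f"
  shows "(LINT t:B|spectral_measure A w. (f t)\<^sup>2) = (norm (diag (\<lambda>t. indicator B t * f t) w))\<^sup>2"
proof -
  have b: "bounded_symbol (\<lambda>t. indicator B t * f t)"
    by (intro bounded_symbol_mult bounded_symbol_indicator f)
  have "(LINT t:B|spectral_measure A w. (f t)\<^sup>2)
      = (LINT e|count_space F. (inner w e)\<^sup>2 *\<^sub>R (indicator B (ev e) *\<^sub>R (f (ev e))\<^sup>2))"
    unfolding spectral_measure_eq set_lebesgue_integral_def
    by (subst integral_distr, simp, simp, subst integral_density, auto)
  also have "\<dots> = (LINT e|count_space F. (indicator B (ev e) * f (ev e))\<^sup>2 * (inner w e)\<^sup>2)"
    by (intro Bochner_Integration.integral_cong refl) (auto simp: indicator_def)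
  also have "\<dots> = (norm (diag (\<lambda>t. indicator B t * f t) w))\<^sup>2"
    by (rule nn_integral_count_space_has_sum(2)[OF diag_norm[OF b]]) auto
  finally show ?thesis .
qed

text \<open>\<open>inv\<close> is evaluated only at vectors \<open>A x\<close>, each exhibited as an
  image under A + l; injectivity then determines its value there.\<close>

lemma eff_dim_operator:
  assumes l: "0 < l"
  shows "inv (\<lambda>x. A x + l *\<^sub>R x) \<circ> A = diag (\<lambda>t. t / (t + l))"
proof
  fix x
  have b: "bounded_symbol (\<lambda>t. t / (t + l))"
    using l by (intro bounded_symbolI[of _ 1]) (auto simp: abs_if field_simps)
  have inj: "inj (\<lambda>x. A x + l *\<^sub>R x)"
  proof (rule injI, rule eqI)
    fix x y e assume eq: "A x + l *\<^sub>R x = A y + l *\<^sub>R y" and e: "e \<in> F"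
    have "(ev e + l) * inner x e = (ev e + l) * inner y e"
      using arg_cong[OF eq, of "\<lambda>z. inner z e"] by (simp add: inner_add_left A_inner[OF e] distrib_right)
    then show "inner x e = inner y e" using ev_nonneg[OF e] l by simp
  qed
  have "A x = A (diag (\<lambda>t. t / (t + l)) x) + l *\<^sub>R diag (\<lambda>t. t / (t + l)) x"
  proof (rule eqI)
    fix e assume e: "e \<in> F"
    have "ev e + l \<noteq> 0" using ev_nonneg[OF e] l by simp
    then have "ev e * inner x e = (ev e + l) * (ev e / (ev e + l) * inner x e)" by simp
    then show "inner (A x) e = inner (A (diag (\<lambda>t. t / (t + l)) x) + l *\<^sub>R diag (\<lambda>t. t / (t + l)) x) e"
      by (simp add: inner_add_left A_inner[OF e] diag_inner[OF b e] distrib_right add_divide_distrib)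
  qed
  then show "(inv (\<lambda>x. A x + l *\<^sub>R x) \<circ> A) x = diag (\<lambda>t. t / (t + l)) x"
    using inv_f_f[OF inj] by simp
qed

end

section \<open>Exponential moments of Gaussian quadratic forms\<close>

text \<open>Completing the square: the exponential weight shifts the mean of the density to
  \<open>c * s\<^sup>2\<close>.\<close>

lemma nn_integral_normal_exp:
  assumes s: "0 < s"
  shows "(\<integral>\<^sup>+x. ennreal (normal_density 0 s x) * ennreal (exp (c * x)) \<partial>lborel)
    = ennreal (exp (c\<^sup>2 * s\<^sup>2 / 2))"
proof -
  have eq: "normal_density 0 s x * exp (c * x) = exp (c\<^sup>2 * s\<^sup>2 / 2) * normal_density (c * s\<^sup>2) s x" for x
  proof -
    have "- x\<^sup>2 / (2 * s\<^sup>2) + c * x = c\<^sup>2 * s\<^sup>2 / 2 + - (x - c * s\<^sup>2)\<^sup>2 / (2 * s\<^sup>2)"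
      using s by (simp add: field_simps power2_eq_square)
    then have "exp (- x\<^sup>2 / (2 * s\<^sup>2)) * exp (c * x)
        = exp (c\<^sup>2 * s\<^sup>2 / 2) * exp (- (x - c * s\<^sup>2)\<^sup>2 / (2 * s\<^sup>2))"
      by (simp only: exp_add[symmetric])
    then show ?thesis by (simp add: normal_density_def)
  qed
  have "(\<integral>\<^sup>+x. ennreal (normal_density 0 s x) * ennreal (exp (c * x)) \<partial>lborel)
    = (\<integral>\<^sup>+x. ennreal (exp (c\<^sup>2 * s\<^sup>2 / 2)) * ennreal (normal_density (c * s\<^sup>2) s x) \<partial>lborel)"
    by (intro nn_integral_cong) (simp add: ennreal_mult[symmetric] eq)
  also have "\<dots> = ennreal (exp (c\<^sup>2 * s\<^sup>2 / 2))"
    using s by (subst nn_integral_cmult) (auto simp: nn_integral_eq_integral)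
  finally show ?thesis .
qed

text \<open>The weight turns the standard density into a centred one of variance 1 / (1 - u), up to
  the normalising factor s.\<close>

lemma nn_integral_normal_exp_square:
  assumes u: "u < 1"
  shows "(\<integral>\<^sup>+x. ennreal (normal_density 0 1 x) * ennreal (exp (u * x\<^sup>2 / 2)) \<partial>lborel)
    = ennreal (1 / sqrt (1 - u))"
proof -
  define s where "s = 1 / sqrt (1 - u)"
  have s: "0 < s" and s2: "s\<^sup>2 = 1 / (1 - u)" using u by (auto simp: s_def power_divide)
  have eq: "normal_density 0 1 x * exp (u * x\<^sup>2 / 2) = s * normal_density 0 s x" for x
  proof -
    have "- x\<^sup>2 / 2 + u * x\<^sup>2 / 2 = - x\<^sup>2 / (2 * s\<^sup>2)"
      using u by (simp add: s2 field_simps)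
    then have "exp (- x\<^sup>2 / 2) * exp (u * x\<^sup>2 / 2) = exp (- x\<^sup>2 / (2 * s\<^sup>2))"
      by (simp only: exp_add[symmetric])
    moreover have "sqrt (2 * pi * s\<^sup>2) = sqrt (2 * pi) * s"
      using s by (simp add: real_sqrt_mult)
    ultimately show ?thesis using s by (simp add: normal_density_def)
  qed
  have "(\<integral>\<^sup>+x. ennreal (normal_density 0 1 x) * ennreal (exp (u * x\<^sup>2 / 2)) \<partial>lborel)
    = (\<integral>\<^sup>+x. ennreal s * ennreal (normal_density 0 s x) \<partial>lborel)"
    using s by (intro nn_integral_cong) (simp add: ennreal_mult[symmetric] eq)
  also have "\<dots> = ennreal s"
    using s by (subst nn_integral_cmult) (auto simp: nn_integral_eq_integral)
  finally show ?thesis by (simp add: s_def)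
qed

lemma (in prob_space) centered_gaussian_exp:
  assumes g: "centered_gaussian M Z" and v: "expectation (\<lambda>\<omega>. (Z \<omega>)\<^sup>2) = v"
  shows "Z \<in> borel_measurable M" "(\<integral>\<^sup>+\<omega>. ennreal (exp (Z \<omega>)) \<partial>M) = ennreal (exp (v / 2))"
proof -
  obtain s where s: "0 \<le> s" and
    Z: "if s = 0 then Z \<in> borel_measurable M \<and> (AE \<omega> in M. Z \<omega> = 0)
             else distributed M lborel Z (\<lambda>x. ennreal (normal_density 0 s x))"
    using g by (auto simp: centered_gaussian_def)
  have "Z \<in> borel_measurable M \<and> (\<integral>\<^sup>+\<omega>. ennreal (exp (Z \<omega>)) \<partial>M) = ennreal (exp (v / 2))"
  proof (cases "s = 0")
    case True
    then have m: "Z \<in> borel_measurable M" and 0: "AE \<omega> in M. Z \<omega> = 0" using Z by auto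
    have "v = expectation (\<lambda>\<omega>. 0)"
      unfolding v[symmetric] using m 0 by (intro integral_cong_AE) auto
    moreover have "(\<integral>\<^sup>+\<omega>. ennreal (exp (Z \<omega>)) \<partial>M) = (\<integral>\<^sup>+\<omega>. 1 \<partial>M)"
      using 0 by (intro nn_integral_cong_AE) auto
    ultimately show ?thesis using m by (simp add: emeasure_space_1)
  next
    case False
    then have s: "0 < s" and d: "distributed M lborel Z (\<lambda>x. ennreal (normal_density 0 s x))"
      using s Z by auto
    have m: "Z \<in> borel_measurable M" using distributed_measurable[OF d] by simp
    have "v = s\<^sup>2"
      using normal_distributed_variance[OF s d] normal_distributed_expectation[OF s d] v by simp
    moreover have "(\<integral>\<^sup>+\<omega>. ennreal (exp (Z \<omega>)) \<partial>M)
        = (\<integral>\<^sup>+x. ennreal (normal_density 0 s x) * ennreal (exp x) \<partial>lborel)"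
      by (rule distributed_nn_integral[OF d, symmetric]) simp
    ultimately show ?thesis using m nn_integral_normal_exp[OF s, of 1] by simp
  qed
  then show "Z \<in> borel_measurable M" "(\<integral>\<^sup>+\<omega>. ennreal (exp (Z \<omega>)) \<partial>M) = ennreal (exp (v / 2))"
    by auto
qed

text \<open>The squares are linearised one at a time by \<open>exp (b z\<^sup>2 / 2) = \<integral> exp (\<surd>b \<cdot> y z) d\<gamma>(y)\<close> with
  \<open>\<gamma>\<close> the standard normal law, so that only the exponential moments of linear combinations of the
  \<open>Z i\<close> enter and their independence need not be established.\<close>

lemma (in prob_space) nn_integral_exp_gaussian_squares:
  fixes Z :: "'i \<Rightarrow> 'a \<Rightarrow> real"
  assumes fin: "finite I" and meas: "\<And>i. i \<in> I \<Longrightarrow> Z i \<in> borel_measurable M"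
    and lin: "\<And>c. (\<integral>\<^sup>+\<omega>. ennreal (exp (\<Sum>i\<in>I. c i * Z i \<omega>)) \<partial>M)
      = ennreal (exp ((\<Sum>i\<in>I. (c i)\<^sup>2 * v i) / 2))"
    and b: "\<And>i. i \<in> I \<Longrightarrow> 0 \<le> b i" "\<And>i. i \<in> I \<Longrightarrow> b i * v i < 1"
  shows "(\<integral>\<^sup>+\<omega>. ennreal (exp ((\<Sum>i\<in>I. b i * (Z i \<omega>)\<^sup>2) / 2)) \<partial>M)
    = ennreal (\<Prod>i\<in>I. 1 / sqrt (1 - b i * v i))"
proof -
  \<comment> \<open>H holds the indices that enter as squares; the others still enter linearly. The
    coefficients c must stay arbitrary, since linearising the square of index i puts
    \<open>sqrt (b i) * y\<close> into position i.\<close>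
  have "(\<integral>\<^sup>+\<omega>. ennreal (exp ((\<Sum>i\<in>H. b i * (Z i \<omega>)\<^sup>2) / 2 + (\<Sum>i\<in>I - H. c i * Z i \<omega>))) \<partial>M)
    = ennreal ((\<Prod>i\<in>H. 1 / sqrt (1 - b i * v i)) * exp ((\<Sum>i\<in>I - H. (c i)\<^sup>2 * v i) / 2))"
    if "H \<subseteq> I" for H c
    using finite_subset[OF that fin] that
  proof (induction arbitrary: c)
    case empty
    then show ?case using lin[of c] by simp
  next
    case (insert i H)
    define J where "J = I - insert i H"
    have i: "i \<in> I" "i \<notin> H" and H: "H \<subseteq> I" using insert by auto
    have IH: "I - H = insert i J" and J: "finite J" "i \<notin> J" "J \<subseteq> I" using i fin by (auto simp: J_def)
    note [measurable] = meas[OF i(1)]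
    have mS: "(\<lambda>\<omega>. (\<Sum>i\<in>H. b i * (Z i \<omega>)\<^sup>2) / 2 + (\<Sum>i\<in>J. c i * Z i \<omega>)) \<in> borel_measurable M"
      (is "?S \<in> _")
      using H J meas by (intro borel_measurable_add borel_measurable_divide borel_measurable_sum
        borel_measurable_times borel_measurable_power borel_measurable_const) auto
    note [measurable] = mS
    let ?P = "\<Prod>i\<in>H. 1 / sqrt (1 - b i * v i)"
    have P: "0 \<le> ?P" using b H by (intro prod_nonneg) (auto simp: less_imp_le)
    interpret pair_sigma_finite lborel M
      by (intro pair_sigma_finite.intro) (auto intro: sigma_finite_lborel prob_space_imp_sigma_finite prob_space_axioms)
    have "(\<integral>\<^sup>+\<omega>. ennreal (exp ((\<Sum>i\<in>insert i H. b i * (Z i \<omega>)\<^sup>2) / 2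
          + (\<Sum>i\<in>I - insert i H. c i * Z i \<omega>))) \<partial>M)
      = (\<integral>\<^sup>+\<omega>. ennreal (exp ((sqrt (b i) * Z i \<omega>)\<^sup>2 * 1\<^sup>2 / 2)) * ennreal (exp (?S \<omega>)) \<partial>M)"
      using insert(1,2) b(1)[OF i(1)]
      by (intro nn_integral_cong)
         (simp add: J_def ennreal_mult[symmetric] exp_add[symmetric] power_mult_distrib add_divide_distrib)
    also have "\<dots> = (\<integral>\<^sup>+\<omega>. \<integral>\<^sup>+y. ennreal (normal_density 0 1 y) * ennreal (exp (sqrt (b i) * Z i \<omega> * y))
          * ennreal (exp (?S \<omega>)) \<partial>lborel \<partial>M)"
      by (subst nn_integral_multc) (auto simp: nn_integral_normal_exp)
    also have "\<dots> = (\<integral>\<^sup>+y. \<integral>\<^sup>+\<omega>. ennreal (normal_density 0 1 y) * ennreal (exp (sqrt (b i) * Z i \<omega> * y))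
          * ennreal (exp (?S \<omega>)) \<partial>M \<partial>lborel)"
      by (rule Fubini') measurable
    also have "\<dots> = (\<integral>\<^sup>+y. ennreal (normal_density 0 1 y) *
        (\<integral>\<^sup>+\<omega>. ennreal (exp ((\<Sum>i\<in>H. b i * (Z i \<omega>)\<^sup>2) / 2
          + (\<Sum>j\<in>I - H. (c(i := sqrt (b i) * y)) j * Z j \<omega>))) \<partial>M) \<partial>lborel)"
    proof (rule nn_integral_cong)
      fix y :: real
      have "(\<Sum>j\<in>J. (c(i := sqrt (b i) * y)) j * Z j \<omega>) = (\<Sum>j\<in>J. c j * Z j \<omega>)" for \<omega>
        using J by (intro sum.cong) auto
      then have "(\<integral>\<^sup>+\<omega>. ennreal (normal_density 0 1 y) * ennreal (exp (sqrt (b i) * Z i \<omega> * y))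
            * ennreal (exp (?S \<omega>)) \<partial>M)
        = (\<integral>\<^sup>+\<omega>. ennreal (normal_density 0 1 y) * ennreal (exp ((\<Sum>i\<in>H. b i * (Z i \<omega>)\<^sup>2) / 2
          + (\<Sum>j\<in>I - H. (c(i := sqrt (b i) * y)) j * Z j \<omega>))) \<partial>M)"
        using J unfolding IH
        by (intro nn_integral_cong)
           (simp add: mult.assoc ennreal_mult[symmetric] exp_add[symmetric] algebra_simps)
      also have "\<dots> = ennreal (normal_density 0 1 y) *
        (\<integral>\<^sup>+\<omega>. ennreal (exp ((\<Sum>i\<in>H. b i * (Z i \<omega>)\<^sup>2) / 2
          + (\<Sum>j\<in>I - H. (c(i := sqrt (b i) * y)) j * Z j \<omega>))) \<partial>M)"
        using H meas by (intro nn_integral_cmult measurable_compose[OF _ measurable_ennreal]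
          measurable_compose[OF _ borel_measurable_exp] borel_measurable_add borel_measurable_divide borel_measurable_sum
        borel_measurable_times borel_measurable_power borel_measurable_const) auto
      finally show "(\<integral>\<^sup>+\<omega>. ennreal (normal_density 0 1 y) * ennreal (exp (sqrt (b i) * Z i \<omega> * y))
            * ennreal (exp (?S \<omega>)) \<partial>M) = \<dots>" .
    qed
    also have "\<dots> = (\<integral>\<^sup>+y. ennreal (?P * exp ((\<Sum>j\<in>J. (c j)\<^sup>2 * v j) / 2)) *
        (ennreal (normal_density 0 1 y) * ennreal (exp (b i * v i * y\<^sup>2 / 2))) \<partial>lborel)"
    proof (rule nn_integral_cong)
      fix y :: real
      have "(\<Sum>j\<in>J. ((c(i := sqrt (b i) * y)) j)\<^sup>2 * v j) = (\<Sum>j\<in>J. (c j)\<^sup>2 * v j)"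
        using J by (intro sum.cong) auto
      then have "(\<Sum>j\<in>I - H. ((c(i := sqrt (b i) * y)) j)\<^sup>2 * v j)
          = b i * v i * y\<^sup>2 + (\<Sum>j\<in>J. (c j)\<^sup>2 * v j)"
        using J b(1)[OF i(1)] unfolding IH by (simp add: power_mult_distrib)
      then show "ennreal (normal_density 0 1 y) *
        (\<integral>\<^sup>+\<omega>. ennreal (exp ((\<Sum>i\<in>H. b i * (Z i \<omega>)\<^sup>2) / 2
          + (\<Sum>j\<in>I - H. (c(i := sqrt (b i) * y)) j * Z j \<omega>))) \<partial>M)
        = ennreal (?P * exp ((\<Sum>j\<in>J. (c j)\<^sup>2 * v j) / 2)) *
        (ennreal (normal_density 0 1 y) * ennreal (exp (b i * v i * y\<^sup>2 / 2)))"
        unfolding insert.IH[OF H]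
        using P by (simp add: ennreal_mult[symmetric] add_divide_distrib exp_add)
    qed
    also have "\<dots> = ennreal (?P * exp ((\<Sum>j\<in>J. (c j)\<^sup>2 * v j) / 2)) * ennreal (1 / sqrt (1 - b i * v i))"
      by (subst nn_integral_cmult) (use nn_integral_normal_exp_square[OF b(2)[OF i(1)]] in auto)
    also have "\<dots> = ennreal ((\<Prod>i\<in>insert i H. 1 / sqrt (1 - b i * v i))
        * exp ((\<Sum>i\<in>I - insert i H. (c i)\<^sup>2 * v i) / 2))"
      using P b(2)[OF i(1)] insert(1,2) by (simp add: ennreal_mult[symmetric] J_def mult_ac)
    finally show ?case .
  qed
  from this[of I "\<lambda>_. 0"] show ?thesis by simp
qed

text \<open>Replaces each factor of the Gaussian product by an exponential, so that the product
  depends only on the sum of the u. The price is the factor 1 / (1 - \<beta>) in the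
  exponent.\<close>

lemma inverse_sqrt_le_exp:
  fixes u \<beta> :: real
  assumes "0 \<le> u" "u \<le> \<beta>" "\<beta> < 1"
  shows "1 / sqrt (1 - u) \<le> exp (u / (2 * (1 - \<beta>)))"
proof -
  have "1 / (1 - u) = 1 + u / (1 - u)" using assms by (simp add: field_simps)
  also have "\<dots> \<le> 1 + u / (1 - \<beta>)" using assms by (simp add: divide_left_mono)
  also have "\<dots> \<le> exp (u / (1 - \<beta>))" by (rule exp_ge_add_one_self)
  also have "\<dots> = (exp (u / (2 * (1 - \<beta>))))\<^sup>2"
    using assms by (simp add: exp_double[symmetric] divide_simps)
  finally have "sqrt (1 / (1 - u)) \<le> sqrt ((exp (u / (2 * (1 - \<beta>))))\<^sup>2)"
    by (rule real_sqrt_le_mono)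
  then show ?thesis by (simp add: real_sqrt_divide)
qed

section \<open>Effective dimension\<close>

locale trace_class_operator = diagonal_operator +
  assumes trace: "op_trace A < \<infinity>" and ev_pos: "\<exists>e\<in>F. 0 < ev e"
begin

lemma A_eq: "A = diag (\<lambda>t. t)"
  using A_eq_diag by blast

lemma ev_summable: "ev summable_on F"
proof (rule nonneg_bdd_above_summable_on)
  have tr: "(\<Sum>\<^sub>\<infinity>e\<in>F. ennreal (ev e)) < \<infinity>"
    using op_trace_diag[OF bounded_symbol_id] ev_nonneg trace by (simp add: A_eq[symmetric])
  show "bdd_above (sum ev ` {G. G \<subseteq> F \<and> finite G})"
  proof (rule bdd_aboveI2)
    fix G assume G: "G \<in> {G. G \<subseteq> F \<and> finite G}"
    have "ennreal (sum ev G) = (\<Sum>e\<in>G. ennreal (ev e))"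
      using G ev_nonneg by (intro sum_ennreal[symmetric]) auto
    also have "\<dots> \<le> (\<Sum>\<^sub>\<infinity>e\<in>F. ennreal (ev e))"
      using G by (subst nonneg_infsum_complete) (auto intro!: SUP_upper)
    finally have "enn2real (ennreal (sum ev G)) \<le> enn2real (\<Sum>\<^sub>\<infinity>e\<in>F. ennreal (ev e))"
      using tr by (intro enn2real_mono) auto
    moreover have "0 \<le> sum ev G" using G ev_nonneg by (intro sum_nonneg) auto
    ultimately show "sum ev G \<le> enn2real (\<Sum>\<^sub>\<infinity>e\<in>F. ennreal (ev e))" by simp
  qed
qed (rule ev_nonneg)

lemma eff_dim_has_sum:
  assumes l: "0 < l"
  shows "((\<lambda>e. ev e / (ev e + l)) has_sum eff_dim A l) F"
proof -
  have b: "bounded_symbol (\<lambda>t. t / (t + l))"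
    using l by (intro bounded_symbolI[of _ 1]) (auto simp: abs_if field_simps)
  have nn: "0 \<le> ev e / (ev e + l)" if "e \<in> F" for e using ev_nonneg[OF that] l by simp
  have "(\<lambda>e. ev e / (ev e + l)) summable_on F"
  proof (rule summable_on_comparison_test)
    show "(\<lambda>e. inverse l * ev e) summable_on F" by (intro summable_on_cmult_right ev_summable)
    show "ev e / (ev e + l) \<le> inverse l * ev e" if "e \<in> F" for e
    proof -
      have "ev e / (ev e + l) \<le> ev e / l"
        using ev_nonneg[OF that] l by (intro divide_left_mono) auto
      then show ?thesis by (simp add: divide_inverse mult.commute)
    qed
  qed (rule nn)
  then have hs: "((\<lambda>e. ev e / (ev e + l)) has_sum (\<Sum>\<^sub>\<infinity>e\<in>F. ev e / (ev e + l))) F" by simp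
  have "eff_dim A l = enn2real (\<Sum>\<^sub>\<infinity>e\<in>F. ennreal (ev e / (ev e + l)))"
    unfolding eff_dim_def eff_dim_operator[OF l] using op_trace_diag[OF b nn] by simp
  also have "\<dots> = (\<Sum>\<^sub>\<infinity>e\<in>F. ev e / (ev e + l))"
    using infsum_ennreal_has_sum[OF hs] nn by (simp add: infsum_nonneg)
  finally show ?thesis using hs by simp
qed

lemma eff_dim_pos:
  assumes l: "0 < l"
  shows "0 < eff_dim A l"
proof -
  obtain e where e: "e \<in> F" "0 < ev e" using ev_pos by blast
  have "(\<Sum>e\<in>{e}. ev e / (ev e + l)) \<le> eff_dim A l"
    using e l ev_nonneg by (intro finite_sum_le_has_sum[OF eff_dim_has_sum[OF l]]) auto
  moreover have "0 < ev e / (ev e + l)" using e l by simp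
  ultimately show ?thesis by simp
qed

lemma eff_dim_antimono:
  assumes "0 < l" "l \<le> m"
  shows "eff_dim A m \<le> eff_dim A l"
proof (rule has_sum_mono)
  show "ev e / (ev e + m) \<le> ev e / (ev e + l)" if "e \<in> F" for e
    using assms ev_nonneg[OF that] by (intro divide_left_mono) auto
qed (use eff_dim_has_sum assms in auto)

text \<open>In other words, \<open>l * eff_dim A l\<close> is nondecreasing. Shrinking l by q raises
  the effective dimension at most by 1 / q, which bounds the loss in \<open>Theta_N\<close> over one
  grid step.\<close>

lemma eff_dim_scale:
  assumes "0 < l" "0 < q" "q \<le> 1"
  shows "q * eff_dim A (q * l) \<le> eff_dim A l"
proof (rule has_sum_mono)
  show "((\<lambda>e. q * (ev e / (ev e + q * l))) has_sum (q * eff_dim A (q * l))) F"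
    using assms by (intro has_sum_cmult_right eff_dim_has_sum) simp
  show "((\<lambda>e. ev e / (ev e + l)) has_sum eff_dim A l) F" using assms by (intro eff_dim_has_sum)
  show "q * (ev e / (ev e + q * l)) \<le> ev e / (ev e + l)" if "e \<in> F" for e
  proof -
    have "q * ev e \<le> ev e" using assms ev_nonneg[OF that] by (simp add: mult_left_le_one_le)
    then have "q * (ev e + l) \<le> ev e + q * l" by (simp add: distrib_left)
    then have "ev e * (q * (ev e + l)) \<le> ev e * (ev e + q * l)"
      using ev_nonneg[OF that] by (intro mult_left_mono)
    moreover have "0 < ev e + q * l" "0 < ev e + l" using assms ev_nonneg[OF that] by (simp_all add: add_nonneg_pos)
    ultimately show ?thesis by (simp add: divide_le_eq le_divide_eq mult_ac)
  qed
qed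

lemma rho_N_inverse: "0 < l \<Longrightarrow> \<delta> / rho_N A l = \<delta> * sqrt (l * eff_dim A l)"
  by (simp add: rho_N_def)

lemma Theta_N_eq: "0 < l \<Longrightarrow> Theta_N A l = sqrt (l / eff_dim A l)"
  using eff_dim_pos[of l]
  by (simp add: Theta_N_def rho_N_def real_sqrt_mult real_sqrt_divide divide_simps)

lemma Theta_N_pos: "0 < l \<Longrightarrow> 0 < Theta_N A l"
  using eff_dim_pos[of l] by (simp add: Theta_N_eq)

text \<open>Relates the noise scale \<open>1 / rho_N\<close> of the stopping rule to the risk scale
  \<open>1 / Theta_N\<close>: they differ by the factor l.\<close>

lemma sqrt_eff_dim: "0 < l \<Longrightarrow> sqrt (l * eff_dim A l) = l / Theta_N A l"
  using eff_dim_pos[of l]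
  by (simp add: Theta_N_eq real_sqrt_mult real_sqrt_divide divide_simps)

lemma Theta_N_mono:
  assumes "0 < l" "l \<le> m"
  shows "Theta_N A l \<le> Theta_N A m"
  using assms eff_dim_antimono[OF assms] eff_dim_pos[of m]
  by (simp add: Theta_N_eq frac_le)

lemma Theta_N_scale:
  assumes "0 < l" "0 < q" "q \<le> 1"
  shows "q * Theta_N A l \<le> Theta_N A (q * l)"
proof -
  have ql: "0 < q * l" using assms by simp
  have "q\<^sup>2 * (l / eff_dim A l) \<le> q\<^sup>2 * (l / (q * eff_dim A (q * l)))"
    using eff_dim_scale[OF assms] eff_dim_pos[OF ql] assms
    by (intro mult_left_mono divide_left_mono mult_pos_pos eff_dim_pos) auto
  also have "\<dots> = q * l / eff_dim A (q * l)"
    using assms by (simp add: power2_eq_square)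
  finally have "sqrt (q\<^sup>2 * (l / eff_dim A l)) \<le> sqrt (q * l / eff_dim A (q * l))"
    by (rule real_sqrt_le_mono)
  moreover have "sqrt (q\<^sup>2 * (l / eff_dim A l)) = q * sqrt (l / eff_dim A l)"
    unfolding real_sqrt_mult using assms by simp
  ultimately show ?thesis using assms ql by (simp only: Theta_N_eq)
qed

end

section \<open>Concentration of the noise\<close>

text \<open>Turns a limit over all finite subsets of a countable set into the limit of a sequence,
  as Fatou's lemma requires.\<close>

lemma filterlim_finite_initial_segments:
  assumes "countable I"
  shows "filterlim (\<lambda>n. {i \<in> I. to_nat_on I i < n}) (finite_subsets_at_top I) sequentially"
    and "finite {i \<in> I. to_nat_on I i < n}"
proof -
  have "inj_on (to_nat_on I) {i \<in> I. to_nat_on I i < n}" for n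
    using inj_on_to_nat_on[OF assms] by (rule inj_on_subset) auto
  then have fin: "finite {i \<in> I. to_nat_on I i < n}" for n
    by (rule inj_on_finite[of _ _ "{..<n}"]) auto
  then show "finite {i \<in> I. to_nat_on I i < n}" .
  show "filterlim (\<lambda>n. {i \<in> I. to_nat_on I i < n}) (finite_subsets_at_top I) sequentially"
    unfolding filterlim_finite_subsets_at_top
  proof (intro allI impI)
    fix X assume X: "finite X \<and> X \<subseteq> I"
    have "\<forall>\<^sub>F n in sequentially. \<forall>x\<in>X. to_nat_on I x < n"
      using X by (intro eventually_ball_finite) (auto intro: eventually_gt_at_top)
    then show "\<forall>\<^sub>F n in sequentially. finite {i \<in> I. to_nat_on I i < n} \<and>
        X \<subseteq> {i \<in> I. to_nat_on I i < n} \<and> {i \<in> I. to_nat_on I i < n} \<subseteq> I"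
      by eventually_elim (use X fin in auto)
  qed
qed

lemma (in diagonal_operator) bounded_symbol_s: "0 < \<alpha> \<Longrightarrow> bounded_symbol (\<lambda>t. \<alpha> / (t + \<alpha>))"
  by (rule bounded_symbolI[of _ 1]) (auto simp: abs_if field_simps)

text \<open>The law of \<zeta> enters through the exponential moments of its scalar products. The
  kernel assumption has its quantifier inside AE: the kernel may contain uncountably many basis
  vectors, for which individual almost sure statements do not combine.\<close>

locale gaussian_noise = trace_class_operator A F ev + prob_space M
  for A :: "'a::{real_inner,complete_space} \<Rightarrow> 'a" and F ev and M :: "'w measure" +
  fixes \<zeta> :: "'w \<Rightarrow> 'a"
  assumes zeta_measurable [measurable]: "\<zeta> \<in> borel_measurable M"
    and zeta_exp: "(\<integral>\<^sup>+\<omega>. ennreal (exp (inner (\<zeta> \<omega>) u)) \<partial>M) = ennreal (exp (inner (A u) u / 2))"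
    and zeta_kernel: "AE \<omega> in M. \<forall>e\<in>F. ev e = 0 \<longrightarrow> inner (\<zeta> \<omega>) e = 0"
begin

lemma zeta_inner_measurable [measurable]: "(\<lambda>\<omega>. inner (\<zeta> \<omega>) u) \<in> borel_measurable M"
  by (rule borel_measurable_continuous_on[OF _ zeta_measurable]) (intro continuous_intros)

lemma diag_zeta_measurable:
  assumes "bounded_symbol f"
  shows "(\<lambda>\<omega>. diag f (\<zeta> \<omega>)) \<in> borel_measurable M"
  using linear_continuous_on[OF bounded_linear_diag[OF assms], of UNIV]
  by (rule borel_measurable_continuous_on) measurable

lemma exp_finite_le:
  assumes \<beta>: "\<beta> < 1" and f: "\<And>e. e \<in> F \<Longrightarrow> (f (ev e))\<^sup>2 * ev e \<le> \<beta>"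
    and G: "finite G" "G \<subseteq> F"
  shows "(\<integral>\<^sup>+\<omega>. ennreal (exp ((\<Sum>e\<in>G. (f (ev e))\<^sup>2 * (inner (\<zeta> \<omega>) e)\<^sup>2) / 2)) \<partial>M)
    \<le> ennreal (exp ((\<Sum>e\<in>G. (f (ev e))\<^sup>2 * ev e) / (2 * (1 - \<beta>))))"
proof -
  have "(\<integral>\<^sup>+\<omega>. ennreal (exp ((\<Sum>e\<in>G. (f (ev e))\<^sup>2 * (inner (\<zeta> \<omega>) e)\<^sup>2) / 2)) \<partial>M)
    = ennreal (\<Prod>e\<in>G. 1 / sqrt (1 - (f (ev e))\<^sup>2 * ev e))"
  proof (rule nn_integral_exp_gaussian_squares[OF G(1)])
    show "(\<lambda>\<omega>. inner (\<zeta> \<omega>) e) \<in> borel_measurable M" for e by measurable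
    show "(f (ev e))\<^sup>2 * ev e < 1" if "e \<in> G" for e using f[of e] that G \<beta> by fastforce
    fix c :: "'a \<Rightarrow> real"
    \<comment> \<open>A linear combination of coordinates is one scalar product with u, so
      \<open>zeta_exp\<close> gives its exponential moment; as F diagonalises A, no cross terms
      appear.\<close>
    define u where "u = (\<Sum>e\<in>G. c e *\<^sub>R e)"
    have ue: "inner u e = c e" if "e \<in> G" for e
    proof -
      have "inner u e = (\<Sum>f\<in>G. if f = e then c f else 0)"
        unfolding u_def inner_sum_left
        by (intro sum.cong) (use that G in \<open>auto simp: subset_iff orthonormal_basis_inner[OF onb]\<close>)
      then show ?thesis using that G(1) by simp
    qed
    have "inner (A u) u = (\<Sum>e\<in>G. c e * inner (A u) e)"
      by (subst (2) u_def) (simp add: inner_sum_right)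
    also have "\<dots> = (\<Sum>e\<in>G. (c e)\<^sup>2 * ev e)"
    proof (rule sum.cong)
      fix e assume "e \<in> G"
      then have "inner (A u) e = ev e * c e" using G(2) by (simp add: A_inner subset_iff ue)
      then show "c e * inner (A u) e = (c e)\<^sup>2 * ev e" by (simp add: power2_eq_square)
    qed simp
    finally have "inner (A u) u = (\<Sum>e\<in>G. (c e)\<^sup>2 * ev e)" .
    moreover have "inner (\<zeta> \<omega>) u = (\<Sum>e\<in>G. c e * inner (\<zeta> \<omega>) e)" for \<omega>
      by (simp add: u_def inner_sum_right)
    ultimately show "(\<integral>\<^sup>+\<omega>. ennreal (exp (\<Sum>e\<in>G. c e * inner (\<zeta> \<omega>) e)) \<partial>M)
        = ennreal (exp ((\<Sum>e\<in>G. (c e)\<^sup>2 * ev e) / 2))"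
      using zeta_exp[of u] by simp
  qed simp
  also have "\<dots> \<le> ennreal (\<Prod>e\<in>G. exp ((f (ev e))\<^sup>2 * ev e / (2 * (1 - \<beta>))))"
  proof (intro ennreal_leI prod_mono conjI)
    fix e assume e: "e \<in> G"
    then have le: "(f (ev e))\<^sup>2 * ev e \<le> \<beta>" using f G by auto
    then show "0 \<le> 1 / sqrt (1 - (f (ev e))\<^sup>2 * ev e)" using \<beta> by simp
    have "0 \<le> (f (ev e))\<^sup>2 * ev e" using e G ev_nonneg by (intro mult_nonneg_nonneg) auto
    from inverse_sqrt_le_exp[OF this le \<beta>]
    show "1 / sqrt (1 - (f (ev e))\<^sup>2 * ev e) \<le> exp ((f (ev e))\<^sup>2 * ev e / (2 * (1 - \<beta>)))" .
  qed
  also have "(\<Prod>e\<in>G. exp ((f (ev e))\<^sup>2 * ev e / (2 * (1 - \<beta>))))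
      = exp ((\<Sum>e\<in>G. (f (ev e))\<^sup>2 * ev e) / (2 * (1 - \<beta>)))"
    by (simp add: exp_sum[OF G(1)] sum_divide_distrib)
  finally show ?thesis .
qed

text \<open>Fatou's lemma extends the finite estimate. Kernel coordinates vanish almost surely, and
  the others are countably many because \<open>ev\<close> is summable.\<close>

lemma exp_norm_diag_le:
  assumes \<beta>: "\<beta> < 1" and b: "bounded_symbol f"
    and f: "\<And>e. e \<in> F \<Longrightarrow> (f (ev e))\<^sup>2 * ev e \<le> \<beta>"
    and S: "((\<lambda>e. (f (ev e))\<^sup>2 * ev e) has_sum S) F"
  shows "(\<integral>\<^sup>+\<omega>. ennreal (exp ((norm (diag f (\<zeta> \<omega>)))\<^sup>2 / 2)) \<partial>M) \<le> ennreal (exp (S / (2 * (1 - \<beta>))))"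
proof -
  define F' where "F' = {e \<in> F. ev e \<noteq> 0}"
  have F': "countable F'" unfolding F'_def by (rule summable_countable_real[OF ev_summable])
  define G where "G n = {e \<in> F'. to_nat_on F' e < n}" for n
  have G: "finite (G n)" "G n \<subseteq> F" for n
    using filterlim_finite_initial_segments(2)[OF F'] by (auto simp: G_def F'_def)
  let ?u = "\<lambda>n \<omega>. ennreal (exp ((\<Sum>e\<in>G n. (f (ev e))\<^sup>2 * (inner (\<zeta> \<omega>) e)\<^sup>2) / 2))"
  have "AE \<omega> in M. ennreal (exp ((norm (diag f (\<zeta> \<omega>)))\<^sup>2 / 2)) = liminf (\<lambda>n. ?u n \<omega>)"
    using zeta_kernel
  proof eventually_elim
    case (elim \<omega>)
    have "((\<lambda>e. (f (ev e))\<^sup>2 * (inner (\<zeta> \<omega>) e)\<^sup>2) has_sum (norm (diag f (\<zeta> \<omega>)))\<^sup>2) F'"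
      using diag_norm[OF b, of "\<zeta> \<omega>"] elim
      by (subst has_sum_cong_neutral[where T = F and g = "\<lambda>e. (f (ev e))\<^sup>2 * (inner (\<zeta> \<omega>) e)\<^sup>2"])
         (auto simp: F'_def)
    then have "(\<lambda>n. (\<Sum>e\<in>G n. (f (ev e))\<^sup>2 * (inner (\<zeta> \<omega>) e)\<^sup>2)) \<longlonglongrightarrow> (norm (diag f (\<zeta> \<omega>)))\<^sup>2"
      unfolding has_sum_def G_def
      by (rule filterlim_compose[OF _ filterlim_finite_initial_segments(1)[OF F']])
    then have "(\<lambda>n. ?u n \<omega>) \<longlonglongrightarrow> ennreal (exp ((norm (diag f (\<zeta> \<omega>)))\<^sup>2 / 2))"
      by (intro tendsto_ennrealI tendsto_exp tendsto_divide tendsto_const) auto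
    then show ?case by (intro lim_imp_Liminf[symmetric]) auto
  qed
  then have "(\<integral>\<^sup>+\<omega>. ennreal (exp ((norm (diag f (\<zeta> \<omega>)))\<^sup>2 / 2)) \<partial>M) = (\<integral>\<^sup>+\<omega>. liminf (\<lambda>n. ?u n \<omega>) \<partial>M)"
    by (rule nn_integral_cong_AE)
  also have "\<dots> \<le> liminf (\<lambda>n. \<integral>\<^sup>+\<omega>. ?u n \<omega> \<partial>M)"
    by (rule nn_integral_liminf) measurable
  also have "\<dots> \<le> liminf (\<lambda>n. ennreal (exp (S / (2 * (1 - \<beta>)))))"
  proof (intro Liminf_mono always_eventually allI)
    fix n
    have "(\<Sum>e\<in>G n. (f (ev e))\<^sup>2 * ev e) \<le> S"
      by (rule finite_sum_le_has_sum[OF S G]) (simp add: ev_nonneg)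
    then have "exp ((\<Sum>e\<in>G n. (f (ev e))\<^sup>2 * ev e) / (2 * (1 - \<beta>))) \<le> exp (S / (2 * (1 - \<beta>)))"
      using \<beta> by (simp add: divide_right_mono)
    then show "(\<integral>\<^sup>+\<omega>. ?u n \<omega> \<partial>M) \<le> ennreal (exp (S / (2 * (1 - \<beta>))))"
      by (intro order_trans[OF exp_finite_le[OF \<beta> f G]] ennreal_leI)
  qed
  also have "\<dots> = ennreal (exp (S / (2 * (1 - \<beta>))))" by (simp add: Liminf_const)
  finally show ?thesis .
qed

text \<open>A Chernoff bound; the parameter \<open>\<beta> = \<kappa> / (1 + \<kappa>)\<close> optimises the exponent.\<close>

lemma noise_concentration:
  assumes \<alpha>: "0 < \<alpha>" and \<kappa>: "0 \<le> \<kappa>"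
  shows "prob {\<omega> \<in> space M. (1 + \<kappa>) * sqrt (\<alpha> * eff_dim A \<alpha>) < norm (diag (\<lambda>t. \<alpha> / (t + \<alpha>)) (\<zeta> \<omega>))}
    \<le> exp (- 2 * \<kappa>\<^sup>2 * eff_dim A \<alpha>)" (is "prob ?B \<le> _")
proof (cases "\<kappa> = 0")
  case True
  then show ?thesis by simp
next
  case False
  then have \<kappa>: "0 < \<kappa>" using \<kappa> by simp
  define N where "N = eff_dim A \<alpha>"
  have N: "0 < N" using eff_dim_pos[OF \<alpha>] by (simp add: N_def)
  define \<beta> where "\<beta> = \<kappa> / (1 + \<kappa>)"
  have \<beta>: "0 < \<beta>" "\<beta> < 1" "1 / (1 - \<beta>) = 1 + \<kappa>" using \<kappa> by (auto simp: \<beta>_def field_simps)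
  define s where "s t = \<alpha> / (t + \<alpha>)" for t
  \<comment> \<open>By the bound \<alpha> / 4 below, this scaling makes every
    \<open>(c * s (ev e))\<^sup>2 * ev e\<close> at most \<beta>, as \<open>exp_norm_diag_le\<close>
    demands.\<close>
  define c where "c = sqrt (4 * \<beta> / \<alpha>)"
  have c2: "c\<^sup>2 = 4 * \<beta> / \<alpha>" using \<alpha> \<beta> by (simp add: c_def)
  have bs: "bounded_symbol s" unfolding s_def[abs_def] by (rule bounded_symbol_s[OF \<alpha>])
  have bf: "bounded_symbol (\<lambda>t. c * s t)"
    by (intro bounded_symbol_mult bounded_symbol_const bs)
  \<comment> \<open>The first bound is summed over e and produces the effective dimension; the
    second, from the arithmetic-geometric mean inequality, controls single terms.\<close>
  have s_ev: "(s (ev e))\<^sup>2 * ev e \<le> \<alpha> * (ev e / (ev e + \<alpha>))"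
    "(s (ev e))\<^sup>2 * ev e \<le> \<alpha> / 4" if "e \<in> F" for e
  proof -
    have p: "0 < ev e + \<alpha>" "0 \<le> ev e" using ev_nonneg[OF that] \<alpha> by auto
    have "s (ev e) \<le> 1" "0 \<le> s (ev e)" using p \<alpha> by (auto simp: s_def)
    then have "s (ev e) * (s (ev e) * ev e) \<le> 1 * (s (ev e) * ev e)"
      using p by (intro mult_right_mono) auto
    then show "(s (ev e))\<^sup>2 * ev e \<le> \<alpha> * (ev e / (ev e + \<alpha>))"
      by (simp add: power2_eq_square s_def mult.assoc)
    have "0 \<le> (ev e - \<alpha>)\<^sup>2" by simp
    then have "4 * (\<alpha> * ev e) \<le> (ev e + \<alpha>)\<^sup>2" by (simp add: power2_eq_square algebra_simps)
    then have "\<alpha> * (4 * (\<alpha> * ev e)) \<le> \<alpha> * (ev e + \<alpha>)\<^sup>2" using \<alpha> by (intro mult_left_mono) auto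
    then show "(s (ev e))\<^sup>2 * ev e \<le> \<alpha> / 4"
      using p by (simp add: s_def power_divide divide_simps power2_eq_square[of \<alpha>] mult_ac)
  qed
  have summ: "(\<lambda>e. (s (ev e))\<^sup>2 * ev e) summable_on F"
  proof (rule summable_on_comparison_test)
    show "(\<lambda>e. \<alpha> * (ev e / (ev e + \<alpha>))) summable_on F"
      using eff_dim_has_sum[OF \<alpha>] by (intro summable_on_cmult_right has_sum_imp_summable)
  qed (use s_ev ev_nonneg in auto)
  define S where "S = (\<Sum>\<^sub>\<infinity>e\<in>F. (s (ev e))\<^sup>2 * ev e)"
  have S: "((\<lambda>e. (s (ev e))\<^sup>2 * ev e) has_sum S) F" using summ by (simp add: S_def)
  have S_le: "S \<le> \<alpha> * N" unfolding N_def
    by (rule has_sum_mono[OF S has_sum_cmult_right[OF eff_dim_has_sum[OF \<alpha>]]]) (rule s_ev)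
  let ?X = "\<lambda>\<omega>. (norm (diag (\<lambda>t. c * s t) (\<zeta> \<omega>)))\<^sup>2 / 2"
  have int: "(\<integral>\<^sup>+\<omega>. ennreal (exp (?X \<omega>)) \<partial>M) \<le> ennreal (exp (c\<^sup>2 * S / (2 * (1 - \<beta>))))"
  proof (rule exp_norm_diag_le[OF \<beta>(2) bf])
    show "((\<lambda>e. (c * s (ev e))\<^sup>2 * ev e) has_sum c\<^sup>2 * S) F"
      using has_sum_cmult_right[OF S, of "c\<^sup>2"] by (simp add: power_mult_distrib mult.assoc)
    show "(c * s (ev e))\<^sup>2 * ev e \<le> \<beta>" if "e \<in> F" for e
    proof -
      have "(c * s (ev e))\<^sup>2 * ev e = c\<^sup>2 * ((s (ev e))\<^sup>2 * ev e)"
        by (simp add: power_mult_distrib mult.assoc)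
      also have "\<dots> \<le> c\<^sup>2 * (\<alpha> / 4)" by (intro mult_left_mono s_ev[OF that]) auto
      also have "\<dots> = \<beta>" using \<alpha> by (simp add: c2)
      finally show ?thesis .
    qed
  qed
  \<comment> \<open>The value of \<open>?X\<close> when the norm of
    \<open>diag s (\<zeta> \<omega>)\<close> equals the threshold
    \<open>(1 + \<kappa>) * sqrt (\<alpha> * N)\<close>.\<close>
  define t where "t = 2 * \<beta> * (1 + \<kappa>)\<^sup>2 * N"
  have X_eq: "?X \<omega> = 2 * \<beta> / \<alpha> * (norm (diag s (\<zeta> \<omega>)))\<^sup>2" for \<omega>
  proof -
    have "diag (\<lambda>t. c * s t) (\<zeta> \<omega>) = c *\<^sub>R diag s (\<zeta> \<omega>)"
      by (rule eqI) (simp add: diag_inner bf bs)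
    then show ?thesis by (simp add: power_mult_distrib c2)
  qed
  have sub: "?B \<subseteq> {\<omega> \<in> space M. 1 \<le> ennreal (exp (- t)) * ennreal (exp (?X \<omega>))}"
  proof (intro subsetI CollectI conjI)
    fix \<omega> assume \<omega>: "\<omega> \<in> ?B"
    then show "\<omega> \<in> space M" by simp
    have "((1 + \<kappa>) * sqrt (\<alpha> * N))\<^sup>2 \<le> (norm (diag s (\<zeta> \<omega>)))\<^sup>2"
      using \<omega> \<kappa> N \<alpha> by (intro power_mono) (auto simp: N_def s_def[abs_def])
    then have "(1 + \<kappa>)\<^sup>2 * (\<alpha> * N) \<le> (norm (diag s (\<zeta> \<omega>)))\<^sup>2"
      using \<alpha> N by (simp add: power_mult_distrib)
    then have "2 * \<beta> / \<alpha> * ((1 + \<kappa>)\<^sup>2 * (\<alpha> * N)) \<le> ?X \<omega>"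
      unfolding X_eq using \<alpha> \<beta> by (intro mult_left_mono) auto
    also have "2 * \<beta> / \<alpha> * ((1 + \<kappa>)\<^sup>2 * (\<alpha> * N)) = t" using \<alpha> by (simp add: t_def)
    finally have "1 \<le> exp (- t) * exp (?X \<omega>)" by (simp add: exp_add[symmetric])
    then have "ennreal 1 \<le> ennreal (exp (- t) * exp (?X \<omega>))" by (rule ennreal_leI)
    then show "1 \<le> ennreal (exp (- t)) * ennreal (exp (?X \<omega>))" by (simp add: ennreal_mult)
  qed
  note [measurable] = diag_zeta_measurable[OF bf]
  have "emeasure M ?B \<le> emeasure M {\<omega> \<in> space M. 1 \<le> ennreal (exp (- t)) * ennreal (exp (?X \<omega>))}"
    by (rule emeasure_mono[OF sub]) measurable
  also have "\<dots> \<le> ennreal (exp (- t)) * (\<integral>\<^sup>+\<omega>. ennreal (exp (?X \<omega>)) * indicator (space M) \<omega> \<partial>M)"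
    by (rule nn_integral_Markov_inequality) measurable
  also have "(\<integral>\<^sup>+\<omega>. ennreal (exp (?X \<omega>)) * indicator (space M) \<omega> \<partial>M) = (\<integral>\<^sup>+\<omega>. ennreal (exp (?X \<omega>)) \<partial>M)"
    by (intro nn_integral_cong) simp
  also have "ennreal (exp (- t)) * \<dots> \<le> ennreal (exp (- t)) * ennreal (exp (c\<^sup>2 * S / (2 * (1 - \<beta>))))"
    by (intro mult_left_mono int) simp
  also have "\<dots> = ennreal (exp (- t + c\<^sup>2 * S / (2 * (1 - \<beta>))))"
    by (simp add: ennreal_mult[symmetric] mult_exp_exp)
  also have "\<dots> \<le> ennreal (exp (- 2 * \<kappa>\<^sup>2 * N))"
  proof (intro ennreal_leI, subst exp_le_cancel_iff)
    \<comment> \<open>The threshold contributes \<open>- 2 * \<kappa> * (1 + \<kappa>) * N\<close>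
      and the moment at most \<open>2 * \<kappa> * N\<close>, so the terms linear in \<kappa>
      cancel.\<close>
    have \<beta>\<kappa>: "\<beta> * (1 + \<kappa>) = \<kappa>" using \<kappa> by (simp add: \<beta>_def)
    have "c\<^sup>2 * S / (2 * (1 - \<beta>)) = 2 * \<beta> / \<alpha> * (1 + \<kappa>) * S"
      unfolding \<beta>(3)[symmetric] using \<alpha> \<beta>(2) by (simp add: c2 divide_simps)
    also have "\<dots> \<le> 2 * \<beta> / \<alpha> * (1 + \<kappa>) * (\<alpha> * N)"
      using \<alpha> \<beta> \<kappa> by (intro mult_left_mono S_le) auto
    also have "\<dots> = 2 * (\<beta> * (1 + \<kappa>)) * N" using \<alpha> by simp
    also note \<beta>\<kappa>
    finally have "c\<^sup>2 * S / (2 * (1 - \<beta>)) \<le> 2 * \<kappa> * N" .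
    moreover have "t = 2 * (\<beta> * (1 + \<kappa>)) * (1 + \<kappa>) * N"
      by (simp add: t_def power2_eq_square)
    then have "t = 2 * \<kappa> * N + 2 * \<kappa>\<^sup>2 * N"
      unfolding \<beta>\<kappa> by (simp add: power2_eq_square distrib_left distrib_right)
    ultimately show "- t + c\<^sup>2 * S / (2 * (1 - \<beta>)) \<le> - 2 * \<kappa>\<^sup>2 * N" by simp
  qed
  finally show ?thesis unfolding N_def by (simp add: emeasure_eq_measure)
qed

text \<open>On the bad event the squared error, which involves |\<zeta>|^2, is traded against a
  small probability; this takes a fourth moment. It follows from an exponential moment with a
  constant symbol.\<close>

lemma integrable_norm_zeta_power4: "integrable M (\<lambda>\<omega>. (norm (\<zeta> \<omega>)) ^ 4)"
proof (rule integrableI_bounded)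
  \<comment> \<open>Chosen so that \<open>c\<^sup>2 * ev e \<le> 1 / 2\<close> for all e, which
    allows \<beta> = 1/2 in \<open>exp_norm_diag_le\<close>.\<close>
  define c where "c = 1 / sqrt (2 * (onorm A + 1))"
  have o: "0 \<le> onorm A" by (rule onorm_pos_le[OF A_linear])
  have c2: "c\<^sup>2 = 1 / (2 * (onorm A + 1))" using o by (simp add: c_def power_divide)
  have c0: "0 < c" using o by (simp add: c_def)
  have "ev e / (2 * (onorm A + 1)) \<le> 1 / 2" if "e \<in> F" for e
    using ev_le_onorm[OF that] o by (simp add: divide_simps)
  then have le: "c\<^sup>2 * ev e \<le> 1 / 2" if "e \<in> F" for e using that by (simp add: c2)
  have S: "((\<lambda>e. c\<^sup>2 * ev e) has_sum c\<^sup>2 * infsum ev F) F"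
    using ev_summable by (intro has_sum_cmult_right) simp
  have "(\<integral>\<^sup>+\<omega>. ennreal (exp ((norm (diag (\<lambda>_. c) (\<zeta> \<omega>)))\<^sup>2 / 2)) \<partial>M)
      \<le> ennreal (exp (c\<^sup>2 * infsum ev F / (2 * (1 - 1 / 2))))"
    by (rule exp_norm_diag_le[OF _ bounded_symbol_const le S]) auto
  moreover have "diag (\<lambda>_. c) x = c *\<^sub>R x" for x
    by (rule eqI) (simp add: diag_inner bounded_symbol_const)
  ultimately have fin: "(\<integral>\<^sup>+\<omega>. ennreal (exp (c\<^sup>2 * (norm (\<zeta> \<omega>))\<^sup>2 / 2)) \<partial>M) < \<infinity>"
    by (auto simp: power_mult_distrib intro: le_less_trans)
  have pt: "norm (norm (\<zeta> \<omega>) ^ 4) \<le> 8 / c ^ 4 * exp (c\<^sup>2 * (norm (\<zeta> \<omega>))\<^sup>2 / 2)" for \<omega>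
  proof -
    define y where "y = c\<^sup>2 * (norm (\<zeta> \<omega>))\<^sup>2 / 2"
    have "0 \<le> y" by (simp add: y_def)
    then have "y\<^sup>2 / 2 \<le> exp y" using exp_lower_Taylor_quadratic[of y] by linarith
    moreover have "y\<^sup>2 / 2 = c ^ 4 / 8 * norm (\<zeta> \<omega>) ^ 4"
      by (simp add: y_def power2_eq_square power4_eq_xxxx)
    ultimately show ?thesis using c0 by (simp add: y_def[symmetric] field_simps)
  qed
  have "(\<integral>\<^sup>+\<omega>. ennreal (norm (norm (\<zeta> \<omega>) ^ 4)) \<partial>M)
      \<le> (\<integral>\<^sup>+\<omega>. ennreal (8 / c ^ 4) * ennreal (exp (c\<^sup>2 * (norm (\<zeta> \<omega>))\<^sup>2 / 2)) \<partial>M)"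
    using pt c0 by (intro nn_integral_mono) (simp add: ennreal_mult[symmetric] ennreal_leI)
  also have "\<dots> = ennreal (8 / c ^ 4) * (\<integral>\<^sup>+\<omega>. ennreal (exp (c\<^sup>2 * (norm (\<zeta> \<omega>))\<^sup>2 / 2)) \<partial>M)"
    by (rule nn_integral_cmult) measurable
  also have "\<dots> < \<infinity>" using fin by (simp add: ennreal_mult_less_top)
  finally show "(\<integral>\<^sup>+\<omega>. ennreal (norm (norm (\<zeta> \<omega>) ^ 4)) \<partial>M) < \<infinity>" .
qed measurable

lemma integrable_norm_zeta_power2: "integrable M (\<lambda>\<omega>. (norm (\<zeta> \<omega>))\<^sup>2)"
proof (rule Bochner_Integration.integrable_bound)
  show "integrable M (\<lambda>\<omega>. 1 + (norm (\<zeta> \<omega>)) ^ 4)"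
    using integrable_norm_zeta_power4 by simp
  have "y \<le> 1 + y\<^sup>2" for y :: real
    using zero_le_power2[of "y - 1/2"] by (simp add: power2_eq_square algebra_simps)
  from this[of "(norm (\<zeta> \<omega>))\<^sup>2" for \<omega>]
  show "AE \<omega> in M. norm ((norm (\<zeta> \<omega>))\<^sup>2) \<le> norm (1 + norm (\<zeta> \<omega>) ^ 4)"
    by (simp flip: power_mult)
qed measurable

end

section \<open>The error on the good event\<close>

locale regularized_problem = trace_class_operator A F ev
  for A :: "'a::{real_inner,complete_space} \<Rightarrow> 'a" and F and ev +
  fixes g :: "real \<Rightarrow> real \<Rightarrow> real" and xdag x0 :: 'a
    and c1 c2 t0 \<alpha>0 q \<tau> \<eta> \<gamma> :: real
  assumes gamma: "1 \<le> \<gamma>" "\<And>\<alpha> t. 0 < \<alpha> \<Longrightarrow> t \<in> {0..onorm A} \<Longrightarrow> \<alpha> * \<bar>g \<alpha> t\<bar> \<le> \<gamma>"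
    and residual_mono: "\<And>\<alpha> \<beta> t. t \<in> {0..onorm A} \<Longrightarrow> 0 < \<alpha> \<Longrightarrow> \<alpha> \<le> \<beta> \<Longrightarrow>
      residual g \<alpha> t \<le> residual g \<beta> t"
    and residual_range: "\<And>\<alpha> t. 0 < \<alpha> \<Longrightarrow> t \<in> {0..onorm A} \<Longrightarrow> 0 \<le> residual g \<alpha> t"
      "\<And>\<alpha> t. 0 < \<alpha> \<Longrightarrow> t \<in> {0..onorm A} \<Longrightarrow> residual g \<alpha> t \<le> 1"
    and c1: "1 < c1" and c2: "0 < c2" "c2 < 1" and t0: "0 < t0"
    and source: "\<And>\<alpha>. 0 < \<alpha> \<Longrightarrow> \<alpha> \<le> t0 \<Longrightarrow>
          (LINT t:{0..<\<alpha>}|spectral_measure A (xdag - x0). 1)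
            \<le> c1\<^sup>2 * (LINT t:{c2 * \<alpha>..}|spectral_measure A (xdag - x0). (residual g \<alpha> t)\<^sup>2)"
    and \<alpha>0: "0 < \<alpha>0" and q: "0 < q" "q < 1" and \<tau>: "1 < \<tau>" and \<eta>: "0 < \<eta>"
begin

abbreviation "w \<equiv> xdag - x0"

abbreviation (input) "s \<equiv> \<lambda>\<alpha> t. \<alpha> / (t + \<alpha>)"

abbreviation "r \<equiv> residual g"

lemma bounded_symbol_r: "0 < \<alpha> \<Longrightarrow> bounded_symbol (r \<alpha>)"
  using residual_range[of \<alpha>] by (intro bounded_symbolI[of _ 1]) auto

lemma bounded_symbol_g: "0 < \<alpha> \<Longrightarrow> bounded_symbol (g \<alpha>)"
  using gamma(2)[of \<alpha>] by (intro bounded_symbolI[of _ "\<gamma> / \<alpha>"]) (auto simp: field_simps)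

text \<open>Bias minus propagated noise. The perturbation v is arbitrary:
  \<open>\<delta> *\<^sub>R \<zeta> \<omega>\<close> for noisy data, 0 for the approximation under
  the infimum.\<close>

lemma approx_error:
  assumes \<alpha>: "0 < \<alpha>"
  shows "xdag - reg_approx A g x0 (A xdag + v) \<alpha> = diag (r \<alpha>) w - diag (g \<alpha>) v"
  unfolding reg_approx_def op_fun_eq_diag[OF bounded_symbol_g[OF \<alpha>]]
  by (rule eqI) (simp add: diag_inner bounded_symbol_r bounded_symbol_g \<alpha> A_inner
      inner_diff_left inner_add_left residual_def algebra_simps)

lemma bounded_symbol_sr: "0 < \<alpha> \<Longrightarrow> bounded_symbol (\<lambda>t. s \<alpha> t * r \<alpha> t)"
  by (intro bounded_symbol_mult bounded_symbol_s bounded_symbol_r)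

text \<open>Since \<open>t * g \<alpha> t - 1 = - r \<alpha> t\<close>, signal and noise in the data
  residual are damped by the same filter.\<close>

lemma criterion_residual:
  assumes \<alpha>: "0 < \<alpha>"
  shows "norm (op_fun A (\<lambda>t. \<alpha> / (t + \<alpha>)) (A (reg_approx A g x0 (A xdag + v) \<alpha>) - (A xdag + v)))
    = norm (diag (\<lambda>t. s \<alpha> t * r \<alpha> t) (A w + v))"
proof -
  define x where "x = reg_approx A g x0 (A xdag + v) \<alpha>"
  have x: "inner x e = inner xdag e - r \<alpha> (ev e) * inner w e + g \<alpha> (ev e) * inner v e" if "e \<in> F" for e
  proof -
    have "inner (xdag - x) e = r \<alpha> (ev e) * inner w e - g \<alpha> (ev e) * inner v e"
      unfolding x_def approx_error[OF \<alpha>] using that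
      by (simp only: inner_diff_left diag_inner bounded_symbol_r bounded_symbol_g \<alpha>)
    then show ?thesis by (simp add: inner_diff_left algebra_simps)
  qed
  have "diag (s \<alpha>) (A x - (A xdag + v)) = - diag (\<lambda>t. s \<alpha> t * r \<alpha> t) (A w + v)"
  proof (rule eqI)
    fix e assume e: "e \<in> F"
    have "inner (A x - (A xdag + v)) e
        = ev e * (inner xdag e - r \<alpha> (ev e) * inner w e + g \<alpha> (ev e) * inner v e) - ev e * inner xdag e - inner v e"
      by (simp only: inner_diff_left[of "A x"] inner_add_left A_inner[OF e] x[OF e])
    also have "\<dots> = - r \<alpha> (ev e) * (ev e * inner w e + inner v e)"
      by (simp add: residual_def algebra_simps)
    finally have "inner (A x - (A xdag + v)) e = - r \<alpha> (ev e) * inner (A w + v) e"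
      by (simp only: inner_add_left A_inner[OF e])
    then show "inner (diag (s \<alpha>) (A x - (A xdag + v))) e
        = inner (- diag (\<lambda>t. s \<alpha> t * r \<alpha> t) (A w + v)) e"
      using e by (simp only: diag_inner bounded_symbol_s bounded_symbol_sr \<alpha> inner_minus_left)
  qed
  then show ?thesis unfolding op_fun_eq_diag[OF bounded_symbol_s[OF \<alpha>]] x_def by simp
qed

lemma bias_mono:
  assumes "0 < \<alpha>" "\<alpha> \<le> \<beta>"
  shows "norm (diag (r \<alpha>) w) \<le> norm (diag (r \<beta>) w)"
proof -
  have "norm (diag (r \<alpha>) w) \<le> 1 * norm (diag (r \<beta>) w)"
    by (rule diag_norm_le)
       (use assms residual_mono[OF ev_mem] residual_range[OF _ ev_mem] in \<open>auto intro!: bounded_symbol_r\<close>)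
  then show ?thesis by simp
qed

lemma bias_le: "0 < \<alpha> \<Longrightarrow> norm (diag (r \<alpha>) w) \<le> norm w"
  using diag_norm_le_id[of "r \<alpha>" 1 w] residual_range[OF _ ev_mem, of \<alpha>]
  by (simp add: bounded_symbol_r)

lemma bounded_symbol_srt: "0 < \<alpha> \<Longrightarrow> bounded_symbol (\<lambda>t. s \<alpha> t * r \<alpha> t * t)"
  by (intro bounded_symbol_mult bounded_symbol_sr bounded_symbol_id)

text \<open>For \<open>\<alpha> > t0\<close> the source condition is used at \<open>t0\<close>, together with the monotonicity of the
  residual functions in \<open>\<alpha>\<close>.\<close>

lemma source_bound:
  "\<exists>C\<ge>0. \<forall>\<alpha>. 0 < \<alpha> \<and> \<alpha> \<le> \<alpha>0 \<longrightarrow>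
    \<alpha> * norm (diag (r \<alpha>) w) \<le> C * norm (diag (\<lambda>t. s \<alpha> t * r \<alpha> t * t) w)"
proof -
  \<comment> \<open>A lower bound for t / (t + \<alpha>) on the high frequencies t \<ge> c2 *
    \<beta>: the first entry serves \<alpha> \<le> t0, the second t0 < \<alpha> \<le>
    \<alpha>0.\<close>
  define c3 where "c3 = min (c2 / (1 + c2)) (c2 * t0 / (c2 * t0 + \<alpha>0))"
  have c3: "0 < c3" using c2 t0 \<alpha>0 by (simp add: c3_def add_pos_pos)
  define C where "C = sqrt (c1\<^sup>2 + 1) / c3"
  have "\<alpha> * norm (diag (r \<alpha>) w) \<le> C * norm (diag (\<lambda>t. s \<alpha> t * r \<alpha> t * t) w)"
    if \<alpha>: "0 < \<alpha>" "\<alpha> \<le> \<alpha>0" for \<alpha>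
  proof -
    define \<beta> where "\<beta> = min \<alpha> t0"
    have \<beta>: "0 < \<beta>" "\<beta> \<le> \<alpha>" "\<beta> \<le> t0" using \<alpha> t0 by (auto simp: \<beta>_def)
    define hi where "hi a t = indicator {c2 * \<beta>..} t * r a t" for a t :: real
    have bhi: "bounded_symbol (hi a)" if "0 < a" for a
      unfolding hi_def[abs_def] by (intro bounded_symbol_mult bounded_symbol_indicator bounded_symbol_r that)
    have low: "(norm (diag (indicator {0..<\<beta>}) w))\<^sup>2 \<le> c1\<^sup>2 * (norm (diag (hi \<beta>) w))\<^sup>2"
      using source[OF \<beta>(1,3)] set_integral_spectral_measure[OF bounded_symbol_const[of 1], where B = "{0..<\<beta>}" and w = w]
        set_integral_spectral_measure[OF bounded_symbol_r[OF \<beta>(1)], where B = "{c2 * \<beta>..}" and w = w]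
      by (simp add: hi_def[abs_def])
    have "norm (diag (hi \<beta>) w) \<le> 1 * norm (diag (hi \<alpha>) w)"
      by (rule diag_norm_le)
         (use \<alpha> \<beta> residual_mono[OF ev_mem] residual_range[OF _ ev_mem] bhi in
          \<open>auto simp: hi_def indicator_def\<close>)
    then have "(norm (diag (hi \<beta>) w))\<^sup>2 \<le> (norm (diag (hi \<alpha>) w))\<^sup>2" by (intro power_mono) auto
    then have low: "(norm (diag (indicator {0..<\<beta>}) w))\<^sup>2 \<le> c1\<^sup>2 * (norm (diag (hi \<alpha>) w))\<^sup>2"
      by (intro order_trans[OF low] mult_left_mono) auto
    \<comment> \<open>As c2 < 1, the ranges t < \<beta> and t \<ge> c2 * \<beta> cover the spectrum.
      On the first the residual function is bounded by 1, and the source condition controls what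
      remains.\<close>
    have "(norm (diag (r \<alpha>) w))\<^sup>2 \<le> (norm (diag (indicator {0..<\<beta>}) w))\<^sup>2 + (norm (diag (hi \<alpha>) w))\<^sup>2"
    proof (rule has_sum_mono[OF diag_norm[OF bounded_symbol_r[OF \<alpha>(1)]]
          has_sum_add[OF diag_norm[OF bounded_symbol_indicator] diag_norm[OF bhi[OF \<alpha>(1)]]]])
      fix e assume e: "e \<in> F"
      have r1: "(r \<alpha> (ev e))\<^sup>2 \<le> 1"
        using residual_range[OF \<alpha>(1) ev_mem[OF e]] by (simp add: power_le_one)
      have "c2 * \<beta> \<le> \<beta>" using c2 \<beta> by simp
      then have "(r \<alpha> (ev e))\<^sup>2 \<le> (indicator {0..<\<beta>} (ev e))\<^sup>2 + (hi \<alpha> (ev e))\<^sup>2"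
        using r1 ev_nonneg[OF e] by (auto simp: hi_def indicator_def)
      from mult_right_mono[OF this, of "(inner w e)\<^sup>2"]
      show "(r \<alpha> (ev e))\<^sup>2 * (inner w e)\<^sup>2 \<le>
        (indicator {0..<\<beta>} (ev e))\<^sup>2 * (inner w e)\<^sup>2 + (hi \<alpha> (ev e))\<^sup>2 * (inner w e)\<^sup>2"
        by (simp add: distrib_right)
    qed
    with low have "(norm (diag (r \<alpha>) w))\<^sup>2 \<le> (c1\<^sup>2 + 1) * (norm (diag (hi \<alpha>) w))\<^sup>2"
      by (simp add: distrib_right)
    from real_sqrt_le_mono[OF this]
    have 1: "norm (diag (r \<alpha>) w) \<le> sqrt (c1\<^sup>2 + 1) * norm (diag (hi \<alpha>) w)"
      by (simp add: real_sqrt_mult)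
    \<comment> \<open>At high frequencies
      \<open>s \<alpha> t * t = \<alpha> * t / (t + \<alpha>)\<close> is at least
      \<open>\<alpha> * c3\<close>, so this factor can be inserted.\<close>
    have "norm (diag (hi \<alpha>) w) \<le> (1 / (\<alpha> * c3)) * norm (diag (\<lambda>t. s \<alpha> t * r \<alpha> t * t) w)"
    proof (rule diag_norm_le[OF bhi[OF \<alpha>(1)] bounded_symbol_srt[OF \<alpha>(1)]])
      show "0 \<le> 1 / (\<alpha> * c3)" using \<alpha> c3 by simp
      fix e assume e: "e \<in> F"
      show "\<bar>hi \<alpha> (ev e)\<bar> \<le> 1 / (\<alpha> * c3) * \<bar>\<alpha> / (ev e + \<alpha>) * r \<alpha> (ev e) * ev e\<bar>"
      proof (cases "c2 * \<beta> \<le> ev e")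
        case True
        have "c3 \<le> c2 * \<beta> / (c2 * \<beta> + \<alpha>)"
        proof (cases "\<alpha> \<le> t0")
          case True
          then have "\<beta> = \<alpha>" by (simp add: \<beta>_def)
          then have "c2 * \<beta> / (c2 * \<beta> + \<alpha>) = c2 * \<alpha> / ((c2 + 1) * \<alpha>)" by (simp add: distrib_right)
          also have "\<dots> = c2 / (1 + c2)" using \<alpha> by simp
          finally show ?thesis by (simp add: c3_def)
        next
          case False
          then have "\<beta> = t0" by (simp add: \<beta>_def)
          moreover have "c2 * t0 / (c2 * t0 + \<alpha>0) \<le> c2 * t0 / (c2 * t0 + \<alpha>)"
            using c2 t0 \<alpha> by (intro divide_left_mono mult_pos_pos add_pos_pos) auto
          ultimately show ?thesis by (simp add: c3_def)
        qed
        also have "\<dots> = 1 - \<alpha> / (c2 * \<beta> + \<alpha>)"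
        proof -
          have "0 < c2 * \<beta> + \<alpha>" using c2 \<beta> \<alpha> by (simp add: add_pos_pos)
          then show ?thesis by (simp add: field_simps)
        qed
        also have "\<dots> \<le> 1 - \<alpha> / (ev e + \<alpha>)"
          using True c2 \<beta> \<alpha> ev_nonneg[OF e]
          by (intro diff_left_mono divide_left_mono mult_pos_pos add_pos_pos add_nonneg_pos) auto
        also have "\<dots> = ev e / (ev e + \<alpha>)"
          using ev_nonneg[OF e] \<alpha> by (simp add: field_simps)
        finally have le: "c3 \<le> ev e / (ev e + \<alpha>)" .
        have r0: "0 \<le> r \<alpha> (ev e)" using residual_range[OF \<alpha>(1) ev_mem[OF e]] by simp
        have "c3 * r \<alpha> (ev e) \<le> ev e / (ev e + \<alpha>) * r \<alpha> (ev e)"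
          by (intro mult_right_mono le r0)
        then have "1 / c3 * (c3 * r \<alpha> (ev e)) \<le> 1 / c3 * (ev e / (ev e + \<alpha>) * r \<alpha> (ev e))"
          using c3 by (intro mult_left_mono) auto
        then have "r \<alpha> (ev e) \<le> 1 / c3 * (ev e / (ev e + \<alpha>) * r \<alpha> (ev e))"
          using c3 by simp
        also have "\<dots> = 1 / (\<alpha> * c3) * (\<alpha> / (ev e + \<alpha>) * r \<alpha> (ev e) * ev e)"
          using \<alpha> by simp
        finally show ?thesis
          using True r0 ev_nonneg[OF e] \<alpha> by (simp add: hi_def)
      next
        case False
        then show ?thesis using \<alpha> c3 by (simp add: hi_def)
      qed
    qed
    then have "sqrt (c1\<^sup>2 + 1) * norm (diag (hi \<alpha>) w)
      \<le> sqrt (c1\<^sup>2 + 1) * ((1 / (\<alpha> * c3)) * norm (diag (\<lambda>t. s \<alpha> t * r \<alpha> t * t) w))"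
      by (intro mult_left_mono) auto
    with 1 have "norm (diag (r \<alpha>) w) \<le> sqrt (c1\<^sup>2 + 1) * ((1 / (\<alpha> * c3)) * norm (diag (\<lambda>t. s \<alpha> t * r \<alpha> t * t) w))"
      by linarith
    from mult_left_mono[OF this, of \<alpha>] show ?thesis using \<alpha> by (simp add: C_def)
  qed
  moreover have "0 \<le> C" using c3 by (simp add: C_def)
  ultimately show ?thesis by blast
qed

section \<open>Deterministic analysis of the selected grid point\<close>

definition step :: "nat \<Rightarrow> real" where "step k = q ^ k * \<alpha>0"

lemma step_pos: "0 < step k" using q \<alpha>0 by (simp add: step_def)

lemma step_antimono: "j \<le> k \<Longrightarrow> step k \<le> step j"
  using q \<alpha>0 by (simp add: step_def power_decreasing)

lemma step_le: "step k \<le> \<alpha>0"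
  using step_antimono[of 0 k] by (simp add: step_def)

text \<open>The grid decreases in k, so the greatest admissible point has the least admissible
  index; the admissible K guarantees that both exist.\<close>

lemma alpha_RG_eq:
  assumes "RG_criterion A g x0 \<tau> \<eta> \<kappa> \<delta> z (step K)"
  shows "alpha_RG A g x0 q \<alpha>0 \<tau> \<eta> \<kappa> \<delta> z = step (LEAST k. RG_criterion A g x0 \<tau> \<eta> \<kappa> \<delta> z (step k))"
  unfolding alpha_RG_def
proof (rule Greatest_equality)
  let ?k = "LEAST k. RG_criterion A g x0 \<tau> \<eta> \<kappa> \<delta> z (step k)"
  show "step ?k \<in> grid q \<alpha>0 \<and> RG_criterion A g x0 \<tau> \<eta> \<kappa> \<delta> z (step ?k)"
    using LeastI[of "\<lambda>k. RG_criterion A g x0 \<tau> \<eta> \<kappa> \<delta> z (step k)", OF assms]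
    by (auto simp: grid_def step_def)
  fix y assume "y \<in> grid q \<alpha>0 \<and> RG_criterion A g x0 \<tau> \<eta> \<kappa> \<delta> z y"
  then obtain k where "y = step k" "RG_criterion A g x0 \<tau> \<eta> \<kappa> \<delta> z (step k)"
    by (auto simp: grid_def step_def)
  then show "y \<le> step ?k" by (auto intro!: step_antimono Least_le)
qed

lemma diag_sr_le:
  assumes "0 < \<alpha>"
  shows "norm (diag (\<lambda>t. s \<alpha> t * r \<alpha> t) v) \<le> norm (diag (s \<alpha>) v)"
proof -
  have "norm (diag (\<lambda>t. s \<alpha> t * r \<alpha> t) v) \<le> 1 * norm (diag (s \<alpha>) v)"
    by (rule diag_norm_le)
       (use assms residual_range[OF _ ev_mem] ev_nonneg in
        \<open>auto intro!: bounded_symbol_s bounded_symbol_sr mult_left_le simp: abs_mult simp del: times_divide_eq_left\<close>)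
  then show ?thesis by simp
qed

lemma diag_srt_le:
  assumes \<alpha>: "0 < \<alpha>"
  shows "norm (diag (\<lambda>t. s \<alpha> t * r \<alpha> t * t) v) \<le> \<alpha> * norm (diag (r \<alpha>) v)"
proof (rule diag_norm_le[OF bounded_symbol_srt[OF \<alpha>] bounded_symbol_r[OF \<alpha>]])
  fix e assume e: "e \<in> F"
  have p: "0 \<le> ev e" "0 < ev e + \<alpha>" using ev_nonneg[OF e] \<alpha> by auto
  have "\<alpha> / (ev e + \<alpha>) * r \<alpha> (ev e) * ev e = \<alpha> * r \<alpha> (ev e) * (ev e / (ev e + \<alpha>))" by simp
  also have "\<bar>\<dots>\<bar> \<le> \<bar>\<alpha> * r \<alpha> (ev e)\<bar> * 1"
    unfolding abs_mult[of "\<alpha> * r \<alpha> (ev e)"] using p \<alpha> by (intro mult_left_mono) auto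
  finally show "\<bar>\<alpha> / (ev e + \<alpha>) * r \<alpha> (ev e) * ev e\<bar> \<le> \<alpha> * \<bar>r \<alpha> (ev e)\<bar>"
    using \<alpha> by (simp add: abs_mult)
qed (use \<alpha> in simp)

text \<open>Adding t |g| \<le> 1, from 0 \<le> r \<le> 1, to \<alpha> |g| \<le> \<gamma> gives |g|
  \<le> (\<gamma> + 1) / (t + \<alpha>). The propagated noise is thus controlled by the very
  quantity that the good event bounds.\<close>

lemma diag_g_le:
  assumes \<alpha>: "0 < \<alpha>"
  shows "norm (diag (g \<alpha>) v) \<le> (\<gamma> + 1) / \<alpha> * norm (diag (s \<alpha>) v)"
proof (rule diag_norm_le[OF bounded_symbol_g[OF \<alpha>] bounded_symbol_s[OF \<alpha>]])
  show "0 \<le> (\<gamma> + 1) / \<alpha>" using gamma(1) \<alpha> by simp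
  fix e assume e: "e \<in> F"
  have p: "0 \<le> ev e" "0 < ev e + \<alpha>" using ev_nonneg[OF e] \<alpha> by auto
  have "ev e * \<bar>g \<alpha> (ev e)\<bar> = \<bar>1 - r \<alpha> (ev e)\<bar>" using p by (simp add: residual_def abs_mult)
  also have "\<dots> \<le> 1" using residual_range[OF \<alpha> ev_mem[OF e]] by simp
  finally have "(ev e + \<alpha>) * \<bar>g \<alpha> (ev e)\<bar> \<le> \<gamma> + 1"
    using gamma(2)[OF \<alpha> ev_mem[OF e]] by (simp add: distrib_right)
  then have "\<bar>g \<alpha> (ev e)\<bar> \<le> (\<gamma> + 1) / (ev e + \<alpha>)"
    using p by (simp add: pos_le_divide_eq mult.commute)
  also have "\<dots> = (\<gamma> + 1) / \<alpha> * \<bar>\<alpha> / (ev e + \<alpha>)\<bar>" using p \<alpha> by simp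
  finally show "\<bar>g \<alpha> (ev e)\<bar> \<le> (\<gamma> + 1) / \<alpha> * \<bar>\<alpha> / (ev e + \<alpha>)\<bar>" .
qed

lemma diag_g_le_norm:
  assumes \<alpha>: "0 < \<alpha>"
  shows "norm (diag (g \<alpha>) v) \<le> \<gamma> / \<alpha> * norm v"
proof (rule diag_norm_le_id[OF bounded_symbol_g[OF \<alpha>]])
  show "0 \<le> \<gamma> / \<alpha>" using gamma(1) \<alpha> by simp
  show "\<bar>g \<alpha> (ev e)\<bar> \<le> \<gamma> / \<alpha>" if "e \<in> F" for e
    using gamma(2)[OF \<alpha> ev_mem[OF that]] \<alpha> by (simp add: pos_le_divide_eq mult.commute)
qed

text \<open>If the rule rejects a, the residual exceeds \<tau> noise levels. Noise accounts for at
  most one of them and the signal for at most a times the bias, so the margin \<tau> - 1 falls to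
  the bias.\<close>

lemma bias_lower_bound:
  assumes a: "0 < a" and \<delta>: "0 < \<delta>" and \<kappa>: "0 \<le> \<kappa>"
    and good: "norm (diag (s a) v) \<le> (1 + \<kappa>) * sqrt (a * eff_dim A a)"
    and crit: "\<not> RG_criterion A g x0 \<tau> \<eta> \<kappa> \<delta> (A xdag + \<delta> *\<^sub>R v) a"
  shows "(\<tau> - 1) * ((1 + \<kappa>) * \<delta> / Theta_N A a) \<le> norm (diag (r a) w)"
proof -
  note lin = bounded_linear_diag[OF bounded_symbol_sr[OF a]]
  define n where "n = (1 + \<kappa>) * \<delta> * sqrt (a * eff_dim A a)"
  have "\<tau> * n < norm (diag (\<lambda>t. s a t * r a t) (A w + \<delta> *\<^sub>R v))"
    using crit unfolding RG_criterion_def criterion_residual[OF a] rho_N_inverse[OF a]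
    by (simp add: n_def mult_ac)
  also have "\<dots> = norm (diag (\<lambda>t. s a t * r a t * t) w + \<delta> *\<^sub>R diag (\<lambda>t. s a t * r a t) v)"
    by (simp add: linear_add[OF bounded_linear.linear[OF lin]] linear_cmul[OF bounded_linear.linear[OF lin]]
      A_eq_diag diag_diag bounded_symbol_sr bounded_symbol_id a del: times_divide_eq_left)
  also have "\<dots> \<le> norm (diag (\<lambda>t. s a t * r a t * t) w) + \<delta> * norm (diag (\<lambda>t. s a t * r a t) v)"
    using \<delta> by (intro order_trans[OF norm_triangle_ineq]) simp
  also have "\<dots> \<le> a * norm (diag (r a) w) + \<delta> * ((1 + \<kappa>) * sqrt (a * eff_dim A a))"
    using \<delta> by (intro add_mono diag_srt_le[OF a] mult_left_mono order_trans[OF diag_sr_le[OF a] good]) auto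
  also have "\<delta> * ((1 + \<kappa>) * sqrt (a * eff_dim A a)) = n" by (simp add: n_def)
  finally have "(\<tau> - 1) * n \<le> a * norm (diag (r a) w)" by (simp add: algebra_simps)
  moreover have "n = a * ((1 + \<kappa>) * \<delta> / Theta_N A a)"
    by (simp add: n_def sqrt_eff_dim[OF a])
  ultimately have "a * ((\<tau> - 1) * ((1 + \<kappa>) * \<delta> / Theta_N A a)) \<le> a * norm (diag (r a) w)"
    by (simp only: mult.left_commute)
  then show ?thesis using a by (simp only: mult_le_cancel_left_pos)
qed

text \<open>A small residual bounds its signal part once the noise is removed, and the hypothesis on
  C leads from there to the bias. At the emergency stop the right-hand scale is at least 1 / \<eta>,
  so the trivial bound \<open>norm w\<close> suffices.\<close>

lemma bias_upper_bound:
  assumes C: "0 \<le> C" "a * norm (diag (r a) w) \<le> C * norm (diag (\<lambda>t. s a t * r a t * t) w)"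
    and a: "0 < a" and \<delta>: "0 < \<delta>" and \<kappa>: "0 \<le> \<kappa>"
    and good: "norm (diag (s a) v) \<le> (1 + \<kappa>) * sqrt (a * eff_dim A a)"
    and crit: "RG_criterion A g x0 \<tau> \<eta> \<kappa> \<delta> (A xdag + \<delta> *\<^sub>R v) a"
  shows "norm (diag (r a) w) \<le> (C * (\<tau> + 1) + norm w * \<eta>) * ((1 + \<kappa>) * \<delta> / Theta_N A a)"
proof -
  note lin = bounded_linear_diag[OF bounded_symbol_sr[OF a]]
  define n where "n = (1 + \<kappa>) * \<delta> * sqrt (a * eff_dim A a)"
  define Q where "Q = (1 + \<kappa>) * \<delta> / Theta_N A a"
  have n: "n = a * Q" by (simp add: n_def Q_def sqrt_eff_dim[OF a])
  have Q: "0 \<le> Q" using \<kappa> \<delta> Theta_N_pos[OF a] by (simp add: Q_def)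
  have "norm (diag (\<lambda>t. s a t * r a t) (A w + \<delta> *\<^sub>R v)) \<le> \<tau> * n
      \<or> Theta_N A a \<le> \<eta> * (1 + \<kappa>) * \<delta>"
    using crit unfolding RG_criterion_def criterion_residual[OF a] rho_N_inverse[OF a]
    by (simp add: n_def mult_ac)
  then show ?thesis
  proof
    assume le: "norm (diag (\<lambda>t. s a t * r a t) (A w + \<delta> *\<^sub>R v)) \<le> \<tau> * n"
    have "diag (\<lambda>t. s a t * r a t * t) w
        = diag (\<lambda>t. s a t * r a t) (A w + \<delta> *\<^sub>R v) - \<delta> *\<^sub>R diag (\<lambda>t. s a t * r a t) v"
      by (simp add: linear_add[OF bounded_linear.linear[OF lin]] linear_cmul[OF bounded_linear.linear[OF lin]]
        A_eq_diag diag_diag bounded_symbol_sr bounded_symbol_id a del: times_divide_eq_left)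
    then have "norm (diag (\<lambda>t. s a t * r a t * t) w)
        \<le> norm (diag (\<lambda>t. s a t * r a t) (A w + \<delta> *\<^sub>R v)) + \<delta> * norm (diag (\<lambda>t. s a t * r a t) v)"
      using \<delta> norm_triangle_ineq4[of "diag (\<lambda>t. s a t * r a t) (A w + \<delta> *\<^sub>R v)"
        "\<delta> *\<^sub>R diag (\<lambda>t. s a t * r a t) v"] by simp
    also have "\<dots> \<le> \<tau> * n + \<delta> * ((1 + \<kappa>) * sqrt (a * eff_dim A a))"
      using \<delta> by (intro add_mono le mult_left_mono order_trans[OF diag_sr_le[OF a] good]) auto
    also have "\<dots> = (\<tau> + 1) * n" by (simp add: n_def algebra_simps)
    finally have "C * norm (diag (\<lambda>t. s a t * r a t * t) w) \<le> C * ((\<tau> + 1) * n)"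
      using C(1) by (intro mult_left_mono)
    with C(2) have "a * norm (diag (r a) w) \<le> C * ((\<tau> + 1) * n)" by (rule order_trans)
    also have "\<dots> = a * (C * (\<tau> + 1) * Q)" by (simp add: n)
    finally have "norm (diag (r a) w) \<le> C * (\<tau> + 1) * Q" using a by (simp only: mult_le_cancel_left_pos)
    also have "\<dots> \<le> (C * (\<tau> + 1) + norm w * \<eta>) * Q" using Q \<eta> by (intro mult_right_mono) auto
    finally show ?thesis by (simp add: Q_def)
  next
    assume "Theta_N A a \<le> \<eta> * (1 + \<kappa>) * \<delta>"
    then have "1 \<le> \<eta> * Q" using Theta_N_pos[OF a] by (simp add: Q_def pos_le_divide_eq mult_ac)
    then have "norm w * 1 \<le> norm w * (\<eta> * Q)" by (intro mult_left_mono) auto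
    then have "norm (diag (r a) w) \<le> norm w * \<eta> * Q" using bias_le[OF a] by (simp add: mult_ac)
    also have "\<dots> \<le> (C * (\<tau> + 1) + norm w * \<eta>) * Q" using Q C(1) \<tau> by (intro mult_right_mono) auto
    finally show ?thesis by (simp add: Q_def)
  qed
qed

text \<open>Purely deterministic: v is a fixed vector and K any index meeting the emergency
  condition. The competitor \<alpha> ranges over the whole interval, not only over the grid.\<close>

lemma error_on_good_event:
  "\<exists>C\<ge>0. \<forall>\<delta> \<kappa> K v \<alpha>. 0 < \<delta> \<longrightarrow> 0 \<le> \<kappa> \<longrightarrow> Theta_N A (step K) \<le> \<eta> * (1 + \<kappa>) * \<delta> \<longrightarrow>
    (\<forall>k\<le>K. norm (diag (s (step k)) v) \<le> (1 + \<kappa>) * sqrt (step k * eff_dim A (step k))) \<longrightarrow>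
    0 < \<alpha> \<longrightarrow> \<alpha> \<le> \<alpha>0 \<longrightarrow>
    norm (xdag - reg_approx A g x0 (A xdag + \<delta> *\<^sub>R v)
      (step (LEAST k. RG_criterion A g x0 \<tau> \<eta> \<kappa> \<delta> (A xdag + \<delta> *\<^sub>R v) (step k))))
    \<le> C * (norm (diag (r \<alpha>) w) + (1 + \<kappa>) * \<delta> / Theta_N A \<alpha>)"
proof -
  obtain C0 where C0: "0 \<le> C0" "\<And>\<alpha>. 0 < \<alpha> \<Longrightarrow> \<alpha> \<le> \<alpha>0 \<Longrightarrow>
    \<alpha> * norm (diag (r \<alpha>) w) \<le> C0 * norm (diag (\<lambda>t. s \<alpha> t * r \<alpha> t * t) w)"
    using source_bound by blast
  define D where "D = C0 * (\<tau> + 1) + norm w * \<eta> + (\<gamma> + 1)"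
  \<comment> \<open>Serves both comparisons below: \<tau> - 1 where the bias dominates, 1 where
    \<open>Theta_N\<close> does.\<close>
  define m where "m = min (\<tau> - 1) 1"
  have m: "0 < m" "m \<le> 1" "m \<le> \<tau> - 1" using \<tau> by (auto simp: m_def)
  have D: "0 \<le> D" using C0 \<tau> \<eta> gamma(1) by (simp add: D_def)
  have "norm (xdag - reg_approx A g x0 (A xdag + \<delta> *\<^sub>R v)
      (step (LEAST k. RG_criterion A g x0 \<tau> \<eta> \<kappa> \<delta> (A xdag + \<delta> *\<^sub>R v) (step k))))
    \<le> D / (q * m) * (norm (diag (r \<alpha>) w) + (1 + \<kappa>) * \<delta> / Theta_N A \<alpha>)"
    if \<delta>: "0 < \<delta>" and \<kappa>: "0 \<le> \<kappa>" and K: "Theta_N A (step K) \<le> \<eta> * (1 + \<kappa>) * \<delta>"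
      and good: "\<And>k. k \<le> K \<Longrightarrow> norm (diag (s (step k)) v) \<le> (1 + \<kappa>) * sqrt (step k * eff_dim A (step k))"
      and \<alpha>: "0 < \<alpha>" "\<alpha> \<le> \<alpha>0" for \<delta> \<kappa> K v \<alpha>
  proof -
    let ?crit = "\<lambda>k. RG_criterion A g x0 \<tau> \<eta> \<kappa> \<delta> (A xdag + \<delta> *\<^sub>R v) (step k)"
    define k where "k = (LEAST k. ?crit k)"
    have "?crit K" using K by (simp add: RG_criterion_def)
    then have k: "?crit k" "k \<le> K" unfolding k_def by (rule LeastI, rule Least_le)
    define a where "a = step k"
    have a: "0 < a" "a \<le> \<alpha>0" using step_pos step_le by (auto simp: a_def)
    define d where "d = (1 + \<kappa>) * \<delta>"
    have d: "0 < d" using \<delta> \<kappa> by (simp add: d_def)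
    define Q where "Q = d / Theta_N A a"
    have Q: "0 \<le> Q" using d Theta_N_pos[OF a(1)] by (simp add: Q_def)
    have bias: "norm (diag (r a) w) \<le> (C0 * (\<tau> + 1) + norm w * \<eta>) * Q"
      unfolding Q_def d_def
      by (rule bias_upper_bound[OF C0(1) C0(2)[OF a] a(1) \<delta> \<kappa>])
         (use good[OF k(2)] k(1) in \<open>auto simp: a_def\<close>)
    have "\<delta> * norm (diag (g a) v) \<le> \<delta> * ((\<gamma> + 1) / a * ((1 + \<kappa>) * sqrt (a * eff_dim A a)))"
      using \<delta> gamma(1) a good[OF k(2)]
      by (intro mult_left_mono order_trans[OF diag_g_le[OF a(1)]]) (auto simp: a_def)
    also have "\<dots> = (\<gamma> + 1) * Q"
      using a by (simp add: Q_def d_def sqrt_eff_dim)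
    finally have noise: "\<delta> * norm (diag (g a) v) \<le> (\<gamma> + 1) * Q" .
    have "xdag - reg_approx A g x0 (A xdag + \<delta> *\<^sub>R v) a = diag (r a) w - \<delta> *\<^sub>R diag (g a) v"
      by (simp add: approx_error[OF a(1)]
        linear_cmul[OF bounded_linear.linear[OF bounded_linear_diag[OF bounded_symbol_g[OF a(1)]]]])
    then have "norm (xdag - reg_approx A g x0 (A xdag + \<delta> *\<^sub>R v) a)
        \<le> norm (diag (r a) w) + \<delta> * norm (diag (g a) v)"
      using norm_triangle_ineq4[of "diag (r a) w" "\<delta> *\<^sub>R diag (g a) v"] \<delta> by simp
    also have "\<dots> \<le> D * Q" using bias noise by (simp add: D_def distrib_right)
    also have "\<dots> \<le> D * (1 / (q * m) * (norm (diag (r \<alpha>) w) + d / Theta_N A \<alpha>))"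
    proof (intro mult_left_mono D)
      have T\<alpha>: "0 < Theta_N A \<alpha>" using Theta_N_pos[OF \<alpha>(1)] .
      \<comment> \<open>For k = 0 the selected point is \<alpha>0, where \<open>Theta_N\<close> is
        largest. Otherwise the preceding point b was rejected, so \<open>bias_lower_bound\<close>
        holds there; passing from a to b costs the factor q.\<close>
      have "q * m * Q \<le> norm (diag (r \<alpha>) w) + d / Theta_N A \<alpha>"
      proof (cases k)
        case 0
        then have "a = \<alpha>0" by (simp add: a_def step_def)
        then have "Q \<le> d / Theta_N A \<alpha>"
          unfolding Q_def using Theta_N_mono[OF \<alpha>] T\<alpha> d by (intro divide_left_mono) auto
        moreover have "q * m * Q \<le> 1 * Q" using q m Q by (intro mult_right_mono mult_le_one) auto
        ultimately show ?thesis using norm_ge_zero[of "diag (r \<alpha>) w"] by linarith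
      next
        case (Suc j)
        define b where "b = step j"
        have b: "0 < b" "b \<le> \<alpha>0" "a = q * b"
          using step_pos step_le by (auto simp: b_def a_def Suc step_def)
        have "\<not> ?crit j" using not_less_Least[of j ?crit] Suc by (simp add: k_def[symmetric])
        then have low: "(\<tau> - 1) * (d / Theta_N A b) \<le> norm (diag (r b) w)"
          unfolding d_def b_def using good[of j] k(2) Suc step_pos
          by (intro bias_lower_bound \<delta> \<kappa>) auto
        have Tb: "0 < Theta_N A b" using Theta_N_pos[OF b(1)] .
        have "q * Theta_N A b \<le> Theta_N A a" unfolding b(3) using b q by (intro Theta_N_scale) auto
        then have "Q \<le> d / (q * Theta_N A b)"
          unfolding Q_def using d q Tb Theta_N_pos[OF a(1)] by (intro divide_left_mono) auto
        then have "q * m * Q \<le> q * m * (d / (q * Theta_N A b))"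
          using q m by (intro mult_left_mono) auto
        also have "\<dots> = m * (d / Theta_N A b)" using q by simp
        \<comment> \<open>If \<alpha> lies above b the bias has only grown; if below, 1 /
          \<open>Theta_N\<close> has. One of the two terms at \<alpha> therefore dominates.\<close>
        also have "\<dots> \<le> norm (diag (r \<alpha>) w) + d / Theta_N A \<alpha>"
        proof (cases "b \<le> \<alpha>")
          case True
          have "m * (d / Theta_N A b) \<le> (\<tau> - 1) * (d / Theta_N A b)"
            using m d Tb by (intro mult_right_mono) auto
          also note low
          also have "norm (diag (r b) w) \<le> norm (diag (r \<alpha>) w)" by (rule bias_mono[OF b(1) True])
          finally show ?thesis using d T\<alpha> by (simp add: add_increasing2)
        next
          case False
          have "m * (d / Theta_N A b) \<le> 1 * (d / Theta_N A b)"
            using m d Tb by (intro mult_right_mono) auto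
          also have "\<dots> \<le> d / Theta_N A \<alpha>"
            using d T\<alpha> Tb False Theta_N_mono[OF \<alpha>(1), of b] by (simp add: divide_left_mono)
          finally show ?thesis by (simp add: add_increasing)
        qed
        finally show ?thesis .
      qed
      then show "Q \<le> 1 / (q * m) * (norm (diag (r \<alpha>) w) + d / Theta_N A \<alpha>)"
        using q m by (simp add: pos_le_divide_eq mult_ac)
    qed
    finally show ?thesis by (simp add: a_def k_def d_def)
  qed
  moreover have "0 \<le> D / (q * m)" using D q m by simp
  ultimately show ?thesis by blast
qed

end

section \<open>The risk bound\<close>

locale statistical_problem =
  regularized_problem A F ev g xdag x0 c1 c2 t0 \<alpha>0 q \<tau> \<eta> \<gamma> + gaussian_noise A F ev M \<zeta>
  for A :: "'a::{real_inner,complete_space} \<Rightarrow> 'a" and F and ev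
    and g :: "real \<Rightarrow> real \<Rightarrow> real" and xdag x0 :: 'a
    and c1 c2 t0 \<alpha>0 q \<tau> \<eta> \<gamma> :: real and M :: "'w measure" and \<zeta> :: "'w \<Rightarrow> 'a"
begin

text \<open>The second alternative of the rule does not involve the data, so this is a deterministic
  bound for the selected index; d stands for \<open>(1 + \<kappa>) * \<delta>\<close>.\<close>

definition stop :: "real \<Rightarrow> nat" where
  "stop d = (LEAST k. Theta_N A (step k) \<le> \<eta> * d)"

lemma Theta_N_le: "0 < l \<Longrightarrow> l \<le> \<alpha>0 \<Longrightarrow> Theta_N A l \<le> sqrt (l / eff_dim A \<alpha>0)"
  using eff_dim_antimono[of l \<alpha>0] eff_dim_pos[OF \<alpha>0]
  by (simp add: Theta_N_eq divide_left_mono)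

lemma Theta_N_stop:
  assumes d: "0 < d"
  shows "Theta_N A (step (stop d)) \<le> \<eta> * d"
proof -
  define N where "N = eff_dim A \<alpha>0"
  have N: "0 < N" using eff_dim_pos[OF \<alpha>0] by (simp add: N_def)
  have "0 < (\<eta> * d)\<^sup>2 * N / \<alpha>0" using d \<eta> N \<alpha>0 by simp
  from real_arch_pow_inv[OF this q(2)] obtain k where "q ^ k < (\<eta> * d)\<^sup>2 * N / \<alpha>0" by blast
  then have "step k / N \<le> (\<eta> * d)\<^sup>2" using \<alpha>0 N by (simp add: step_def field_simps)
  then have "sqrt (step k / N) \<le> sqrt ((\<eta> * d)\<^sup>2)" by (rule real_sqrt_le_mono)
  then have "Theta_N A (step k) \<le> \<eta> * d"
    using Theta_N_le[OF step_pos step_le, of k] d \<eta> by (simp add: N_def)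
  then show ?thesis unfolding stop_def by (rule LeastI)
qed

text \<open>Unless the rule stops at \<alpha>0, the preceding point violates the emergency
  condition; by \<open>Theta_N_le\<close> it is at least
  \<open>eff_dim A \<alpha>0 * (\<eta> * d)\<^sup>2\<close>, and one step costs q. The minima merge
  both cases.\<close>

lemma step_stop_lower:
  assumes d: "0 < d"
  shows "min \<alpha>0 (q * eff_dim A \<alpha>0 * \<eta>\<^sup>2) * min 1 (d\<^sup>2) \<le> step (stop d)"
proof (cases "stop d")
  case 0
  have "min \<alpha>0 (q * eff_dim A \<alpha>0 * \<eta>\<^sup>2) * min 1 (d\<^sup>2) \<le> \<alpha>0 * 1"
    using \<alpha>0 by (intro mult_mono) auto
  then show ?thesis using 0 by (simp add: step_def)
next
  case (Suc j)
  define N where "N = eff_dim A \<alpha>0"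
  have N: "0 < N" using eff_dim_pos[OF \<alpha>0] by (simp add: N_def)
  have "\<not> Theta_N A (step j) \<le> \<eta> * d"
    using not_less_Least[of j "\<lambda>k. Theta_N A (step k) \<le> \<eta> * d"] Suc by (simp add: stop_def[symmetric])
  then have "\<eta> * d \<le> sqrt (step j / N)"
    using Theta_N_le[OF step_pos step_le, of j] by (simp add: N_def)
  then have "(\<eta> * d)\<^sup>2 \<le> (sqrt (step j / N))\<^sup>2" using d \<eta> by (intro power_mono) auto
  also have "\<dots> = step j / N" using N step_pos[of j] by simp
  finally have "q * (N * (\<eta> * d)\<^sup>2) \<le> q * step j" using q N by (intro mult_left_mono) (auto simp: field_simps)
  then have le: "q * N * \<eta>\<^sup>2 * d\<^sup>2 \<le> step (stop d)"
    by (simp add: Suc step_def power_mult_distrib mult.assoc)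
  have "min \<alpha>0 (q * N * \<eta>\<^sup>2) * min 1 (d\<^sup>2) \<le> q * N * \<eta>\<^sup>2 * d\<^sup>2"
    using q N \<alpha>0 by (intro mult_mono) auto
  with le show ?thesis by (simp add: N_def)
qed

section \<open>The selected index and the error as random variables\<close>

definition data :: "real \<Rightarrow> 'w \<Rightarrow> 'a" where "data \<delta> \<omega> = A xdag + \<delta> *\<^sub>R \<zeta> \<omega>"

definition index :: "real \<Rightarrow> real \<Rightarrow> 'w \<Rightarrow> nat" where
  "index \<kappa> \<delta> \<omega> = (LEAST k. RG_criterion A g x0 \<tau> \<eta> \<kappa> \<delta> (data \<delta> \<omega>) (step k))"

definition err :: "real \<Rightarrow> real \<Rightarrow> 'w \<Rightarrow> real" where
  "err \<kappa> \<delta> \<omega> = norm (xdag - reg_approx A g x0 (data \<delta> \<omega>) (step (index \<kappa> \<delta> \<omega>)))"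

lemma RG_criterion_stop:
  "0 < \<delta> \<Longrightarrow> 0 \<le> \<kappa> \<Longrightarrow> RG_criterion A g x0 \<tau> \<eta> \<kappa> \<delta> z (step (stop ((1 + \<kappa>) * \<delta>)))"
  using Theta_N_stop[of "(1 + \<kappa>) * \<delta>"] by (simp add: RG_criterion_def mult.assoc)

lemma index_le_stop: "0 < \<delta> \<Longrightarrow> 0 \<le> \<kappa> \<Longrightarrow> index \<kappa> \<delta> \<omega> \<le> stop ((1 + \<kappa>) * \<delta>)"
  unfolding index_def by (intro Least_le RG_criterion_stop)

lemma err_eq:
  assumes "0 < \<delta>" "0 \<le> \<kappa>"
  shows "norm (xdag - reg_approx A g x0 (data \<delta> \<omega>) (alpha_RG A g x0 q \<alpha>0 \<tau> \<eta> \<kappa> \<delta> (data \<delta> \<omega>))) = err \<kappa> \<delta> \<omega>"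
  unfolding err_def index_def by (simp add: alpha_RG_eq[OF RG_criterion_stop[OF assms]])

text \<open>Valid on the whole probability space, because the selected point is never below the
  deterministic stop.\<close>

lemma err_le:
  assumes "0 < \<delta>" "0 \<le> \<kappa>"
  shows "err \<kappa> \<delta> \<omega> \<le> norm w + \<gamma> * \<delta> / step (stop ((1 + \<kappa>) * \<delta>)) * norm (\<zeta> \<omega>)"
proof -
  define a where "a = step (index \<kappa> \<delta> \<omega>)"
  have a: "0 < a" by (simp add: a_def step_pos)
  have "err \<kappa> \<delta> \<omega> = norm (diag (r a) w - diag (g a) (\<delta> *\<^sub>R \<zeta> \<omega>))"
    by (simp add: err_def data_def a_def[symmetric] approx_error[OF a])
  also have "\<dots> \<le> norm (diag (r a) w) + norm (diag (g a) (\<delta> *\<^sub>R \<zeta> \<omega>))" by (rule norm_triangle_ineq4)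
  also have "\<dots> \<le> norm w + \<gamma> / a * norm (\<delta> *\<^sub>R \<zeta> \<omega>)"
    by (intro add_mono bias_le diag_g_le_norm a)
  also have "\<gamma> / a * norm (\<delta> *\<^sub>R \<zeta> \<omega>) = \<gamma> * \<delta> / a * norm (\<zeta> \<omega>)" using assms by simp
  also have "\<dots> \<le> \<gamma> * \<delta> / step (stop ((1 + \<kappa>) * \<delta>)) * norm (\<zeta> \<omega>)"
    using gamma(1) assms a step_pos step_antimono[OF index_le_stop[OF assms]]
    by (intro mult_right_mono divide_left_mono) (auto simp: a_def)
  finally show ?thesis by simp
qed

text \<open>The index takes countably many values, and for each fixed index the error and the
  criterion are built from continuous functions of \<zeta>.\<close>

lemma err_measurable [measurable]: "err \<kappa> \<delta> \<in> borel_measurable M"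
proof -
  have diag_m: "(\<lambda>\<omega>. norm (x + diag f (y + \<delta> *\<^sub>R \<zeta> \<omega>))) \<in> borel_measurable M"
    if "bounded_symbol f" for f x y
  proof (rule borel_measurable_continuous_on[OF _ zeta_measurable])
    show "continuous_on UNIV (\<lambda>z. norm (x + diag f (y + \<delta> *\<^sub>R z)))"
      by (intro continuous_intros bounded_linear.continuous_on[OF bounded_linear_diag[OF that]])
  qed
  have crit: "Measurable.pred M (\<lambda>\<omega>. RG_criterion A g x0 \<tau> \<eta> \<kappa> \<delta> (data \<delta> \<omega>) (step k))" for k
  proof -
    have [measurable]: "(\<lambda>\<omega>. norm (diag (\<lambda>t. s (step k) t * r (step k) t) (A w + \<delta> *\<^sub>R \<zeta> \<omega>)))
        \<in> borel_measurable M"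
      using diag_m[OF bounded_symbol_sr[OF step_pos], of 0] by simp
    show ?thesis unfolding RG_criterion_def data_def criterion_residual[OF step_pos] by measurable
  qed
  have "(\<lambda>\<omega>. norm (xdag - reg_approx A g x0 (data \<delta> \<omega>) (step k))) \<in> borel_measurable M" for k
  proof -
    have "xdag - reg_approx A g x0 (data \<delta> \<omega>) (step k)
        = - (- diag (r (step k)) w + diag (g (step k)) (0 + \<delta> *\<^sub>R \<zeta> \<omega>))" for \<omega>
      by (simp add: data_def approx_error[OF step_pos])
    then show ?thesis
      using diag_m[OF bounded_symbol_g[OF step_pos], of "- diag (r (step k)) w" k 0]
      by (simp only: norm_minus_cancel)
  qed
  moreover have "index \<kappa> \<delta> \<in> measurable M (count_space UNIV)"
    unfolding index_def[abs_def] by (rule measurable_Least) (rule crit)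
  ultimately show ?thesis
    unfolding err_def[abs_def] by (rule measurable_compose_countable)
qed

lemma err_power2_le:
  assumes "0 < \<delta>" "0 \<le> \<kappa>"
  shows "(err \<kappa> \<delta> \<omega>)\<^sup>2 \<le> 2 * (norm w)\<^sup>2
    + 2 * (\<gamma> * \<delta> / step (stop ((1 + \<kappa>) * \<delta>)))\<^sup>2 * (norm (\<zeta> \<omega>))\<^sup>2"
proof -
  have sq: "(x + y)\<^sup>2 \<le> 2 * x\<^sup>2 + 2 * y\<^sup>2" for x y :: real
    using zero_le_power2[of "x - y"] by (simp add: power2_eq_square algebra_simps)
  have "(err \<kappa> \<delta> \<omega>)\<^sup>2 \<le> (norm w + \<gamma> * \<delta> / step (stop ((1 + \<kappa>) * \<delta>)) * norm (\<zeta> \<omega>))\<^sup>2"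
    by (intro power_mono err_le assms) (simp add: err_def)
  also note sq
  finally show ?thesis
    unfolding power_mult_distrib[of "\<gamma> * \<delta> / step (stop ((1 + \<kappa>) * \<delta>))"] mult.assoc .
qed

lemma integrable_err:
  assumes "0 < \<delta>" "0 \<le> \<kappa>"
  shows "integrable M (\<lambda>\<omega>. (err \<kappa> \<delta> \<omega>)\<^sup>2)"
proof (rule Bochner_Integration.integrable_bound)
  show "integrable M (\<lambda>\<omega>. 2 * (norm w)\<^sup>2
    + 2 * (\<gamma> * \<delta> / step (stop ((1 + \<kappa>) * \<delta>)))\<^sup>2 * (norm (\<zeta> \<omega>))\<^sup>2)"
    using integrable_norm_zeta_power2 by simp
  show "AE \<omega> in M. norm ((err \<kappa> \<delta> \<omega>)\<^sup>2) \<le> norm (2 * (norm w)\<^sup>2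
    + 2 * (\<gamma> * \<delta> / step (stop ((1 + \<kappa>) * \<delta>)))\<^sup>2 * (norm (\<zeta> \<omega>))\<^sup>2)"
    using err_power2_le[OF assms] by (intro always_eventually allI) simp
qed measurable

text \<open>For noise levels bounded away from \<open>0\<close> the a priori bound \<open>step (stop d) \<ge> const\<close> suffices. The
  probability estimate on the bad event is useless there, since \<open>\<kappa> = 0\<close> at \<open>\<delta> = 1\<close>.\<close>

lemma risk_large_noise:
  "\<exists>X\<ge>0. \<forall>\<delta> \<kappa>. 1 \<le> \<delta> \<longrightarrow> 0 \<le> \<kappa> \<longrightarrow> (LINT \<omega>|M. (err \<kappa> \<delta> \<omega>)\<^sup>2) \<le> X * \<delta>\<^sup>2"
proof -
  define c where "c = min \<alpha>0 (q * eff_dim A \<alpha>0 * \<eta>\<^sup>2)"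
  have c: "0 < c" using \<alpha>0 q \<eta> eff_dim_pos[OF \<alpha>0] by (simp add: c_def)
  define m2 where "m2 = (LINT \<omega>|M. (norm (\<zeta> \<omega>))\<^sup>2)"
  define X where "X = 2 * (norm w)\<^sup>2 + 2 * (\<gamma> / c)\<^sup>2 * m2"
  have m2: "0 \<le> m2" by (simp add: m2_def)
  have "(LINT \<omega>|M. (err \<kappa> \<delta> \<omega>)\<^sup>2) \<le> X * \<delta>\<^sup>2" if \<delta>: "1 \<le> \<delta>" and \<kappa>: "0 \<le> \<kappa>" for \<delta> \<kappa>
  proof -
    define d where "d = (1 + \<kappa>) * \<delta>"
    have "1 * 1 \<le> d" unfolding d_def using \<delta> \<kappa> by (intro mult_mono) auto
    then have "1 \<le> d" "min 1 (d\<^sup>2) = 1" by auto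
    then have low: "c \<le> step (stop d)" using step_stop_lower[of d] by (simp add: c_def)
    have "(LINT \<omega>|M. (err \<kappa> \<delta> \<omega>)\<^sup>2)
        \<le> (LINT \<omega>|M. 2 * (norm w)\<^sup>2 + 2 * (\<gamma> * \<delta> / step (stop d))\<^sup>2 * (norm (\<zeta> \<omega>))\<^sup>2)"
      using \<delta> \<kappa> integrable_norm_zeta_power2 unfolding d_def
      by (intro integral_mono integrable_err err_power2_le) auto
    also have "\<dots> = 2 * (norm w)\<^sup>2 + 2 * (\<gamma> * \<delta> / step (stop d))\<^sup>2 * m2"
      using integrable_norm_zeta_power2 by (simp add: m2_def prob_space)
    also have "\<dots> \<le> 2 * (norm w)\<^sup>2 * \<delta>\<^sup>2 + 2 * (\<gamma> * \<delta> / c)\<^sup>2 * m2"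
    proof (intro add_mono mult_right_mono mult_left_mono m2)
      have "(norm w)\<^sup>2 * 1 \<le> (norm w)\<^sup>2 * \<delta>\<^sup>2" using \<delta> by (intro mult_left_mono) auto
      then show "2 * (norm w)\<^sup>2 \<le> 2 * (norm w)\<^sup>2 * \<delta>\<^sup>2" by simp
      show "(\<gamma> * \<delta> / step (stop d))\<^sup>2 \<le> (\<gamma> * \<delta> / c)\<^sup>2"
        using gamma(1) \<delta> c low step_pos by (intro power_mono divide_left_mono) auto
    qed auto
    also have "\<dots> = X * \<delta>\<^sup>2"
      by (simp add: X_def power_mult_distrib power_divide distrib_right)
    finally show ?thesis .
  qed
  moreover have "0 \<le> X" using m2 by (simp add: X_def)
  ultimately show ?thesis by blast
qed

definition bad :: "real \<Rightarrow> real \<Rightarrow> 'w set" where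
  "bad \<kappa> \<delta> = (\<Union>k\<le>stop ((1 + \<kappa>) * \<delta>). {\<omega> \<in> space M.
    (1 + \<kappa>) * sqrt (step k * eff_dim A (step k)) < norm (diag (s (step k)) (\<zeta> \<omega>))})"

lemma bad_sets [measurable]: "bad \<kappa> \<delta> \<in> sets M"
proof -
  note [measurable] = diag_zeta_measurable[OF bounded_symbol_s[OF step_pos]]
  show ?thesis unfolding bad_def by measurable
qed

lemma prob_bad_le:
  assumes \<kappa>: "0 \<le> \<kappa>"
  shows "prob (bad \<kappa> \<delta>) \<le> (real (stop ((1 + \<kappa>) * \<delta>)) + 1) * exp (- 2 * \<kappa>\<^sup>2 * eff_dim A \<alpha>0)"
proof -
  note [measurable] = diag_zeta_measurable[OF bounded_symbol_s[OF step_pos]]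
  let ?K = "stop ((1 + \<kappa>) * \<delta>)"
  have "prob (bad \<kappa> \<delta>) \<le> (\<Sum>k\<le>?K. prob {\<omega> \<in> space M.
      (1 + \<kappa>) * sqrt (step k * eff_dim A (step k)) < norm (diag (s (step k)) (\<zeta> \<omega>))})"
    unfolding bad_def by (intro finite_measure_subadditive_finite) auto
  also have "\<dots> \<le> (\<Sum>k\<le>?K. exp (- 2 * \<kappa>\<^sup>2 * eff_dim A \<alpha>0))"
  proof (rule sum_mono)
    fix k
    have "\<kappa>\<^sup>2 * eff_dim A \<alpha>0 \<le> \<kappa>\<^sup>2 * eff_dim A (step k)"
      by (intro mult_left_mono eff_dim_antimono step_pos step_le) simp
    then have "exp (- 2 * \<kappa>\<^sup>2 * eff_dim A (step k)) \<le> exp (- 2 * \<kappa>\<^sup>2 * eff_dim A \<alpha>0)" by simp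
    with noise_concentration[OF step_pos \<kappa>, of k]
    show "prob {\<omega> \<in> space M. (1 + \<kappa>) * sqrt (step k * eff_dim A (step k))
        < norm (diag (s (step k)) (\<zeta> \<omega>))} \<le> exp (- 2 * \<kappa>\<^sup>2 * eff_dim A \<alpha>0)"
      by (rule order_trans)
  qed
  finally show ?thesis by (simp add: add.commute)
qed

text \<open>The last grid point is at least a multiple of \<delta>^2, so the true count is
  logarithmic. Bernoulli's inequality yields a weaker power bound directly, and the probability
  \<delta>^16 absorbs it.\<close>

lemma stop_le:
  "\<exists>C\<ge>0. \<forall>\<delta> \<kappa>. 0 < \<delta> \<longrightarrow> \<delta> < 1 \<longrightarrow> 0 \<le> \<kappa> \<longrightarrow> real (stop ((1 + \<kappa>) * \<delta>)) + 1 \<le> C / \<delta>\<^sup>2"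
proof -
  define c where "c = min \<alpha>0 (q * eff_dim A \<alpha>0 * \<eta>\<^sup>2)"
  have c: "0 < c" using \<alpha>0 q \<eta> eff_dim_pos[OF \<alpha>0] by (simp add: c_def)
  have p: "0 < 1 / q - 1" using q by (simp add: field_simps)
  define C where "C = \<alpha>0 / c / (1 / q - 1) + 1"
  have "real (stop ((1 + \<kappa>) * \<delta>)) + 1 \<le> C / \<delta>\<^sup>2" if \<delta>: "0 < \<delta>" "\<delta> < 1" and \<kappa>: "0 \<le> \<kappa>" for \<delta> \<kappa>
  proof -
    define K where "K = stop ((1 + \<kappa>) * \<delta>)"
    have \<delta>2: "0 < \<delta>\<^sup>2" "\<delta>\<^sup>2 \<le> 1" using \<delta> by (auto simp: power_le_one)
    have "1 * \<delta> \<le> (1 + \<kappa>) * \<delta>" using \<kappa> \<delta> by (intro mult_right_mono) auto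
    then have "\<delta>\<^sup>2 \<le> ((1 + \<kappa>) * \<delta>)\<^sup>2" using \<delta> by (intro power_mono) auto
    then have "c * \<delta>\<^sup>2 \<le> c * min 1 (((1 + \<kappa>) * \<delta>)\<^sup>2)" using c \<delta>2 by (intro mult_left_mono) auto
    also have "\<dots> \<le> step K" using step_stop_lower[of "(1 + \<kappa>) * \<delta>"] \<kappa> \<delta> by (simp add: K_def c_def)
    finally have low: "c * \<delta>\<^sup>2 \<le> q ^ K * \<alpha>0" by (simp add: step_def)
    have "1 + real K * (1 / q - 1) \<le> (1 + (1 / q - 1)) ^ K" using p q by (intro Bernoulli_inequality) simp
    also have "\<dots> = 1 / q ^ K" by (simp add: power_one_over)
    also have "\<dots> \<le> \<alpha>0 / c / \<delta>\<^sup>2"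
      using low c \<delta>2 q by (simp add: divide_simps mult_ac)
    finally have "real K * (1 / q - 1) \<le> \<alpha>0 / c / \<delta>\<^sup>2" by simp
    then have "real K \<le> \<alpha>0 / c / \<delta>\<^sup>2 / (1 / q - 1)" by (simp only: pos_le_divide_eq[OF p])
    moreover have "1 \<le> 1 / \<delta>\<^sup>2" using \<delta>2 by simp
    ultimately show ?thesis by (simp add: C_def K_def add_divide_distrib mult_ac)
  qed
  moreover have "0 \<le> C" using c p \<alpha>0 by (simp add: C_def)
  ultimately show ?thesis by blast
qed

lemma risk_small_noise:
  "\<exists>C\<ge>0. \<exists>X\<ge>0. \<forall>\<delta> \<kappa> \<alpha>. 0 < \<delta> \<longrightarrow> \<delta> < 1 \<longrightarrow> 0 \<le> \<kappa> \<longrightarrow> exp (- 2 * \<kappa>\<^sup>2 * eff_dim A \<alpha>0) \<le> \<delta> ^ 16 \<longrightarrow>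
    0 < \<alpha> \<longrightarrow> \<alpha> \<le> \<alpha>0 \<longrightarrow>
    (LINT \<omega>|M. (err \<kappa> \<delta> \<omega>)\<^sup>2) \<le> (C * (norm (diag (r \<alpha>) w) + (1 + \<kappa>) * \<delta> / Theta_N A \<alpha>))\<^sup>2 + X * \<delta>\<^sup>2"
proof -
  obtain C where C: "0 \<le> C" and on_good: "\<And>\<delta> \<kappa> K v \<alpha>. 0 < \<delta> \<Longrightarrow> 0 \<le> \<kappa> \<Longrightarrow>
    Theta_N A (step K) \<le> \<eta> * (1 + \<kappa>) * \<delta> \<Longrightarrow>
    (\<And>k. k \<le> K \<Longrightarrow> norm (diag (s (step k)) v) \<le> (1 + \<kappa>) * sqrt (step k * eff_dim A (step k))) \<Longrightarrow>
    0 < \<alpha> \<Longrightarrow> \<alpha> \<le> \<alpha>0 \<Longrightarrow>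
    norm (xdag - reg_approx A g x0 (A xdag + \<delta> *\<^sub>R v)
      (step (LEAST k. RG_criterion A g x0 \<tau> \<eta> \<kappa> \<delta> (A xdag + \<delta> *\<^sub>R v) (step k))))
    \<le> C * (norm (diag (r \<alpha>) w) + (1 + \<kappa>) * \<delta> / Theta_N A \<alpha>)"
    using error_on_good_event by blast
  obtain Ck where Ck: "0 \<le> Ck" "\<And>\<delta> \<kappa>. 0 < \<delta> \<Longrightarrow> \<delta> < 1 \<Longrightarrow> 0 \<le> \<kappa> \<Longrightarrow>
    real (stop ((1 + \<kappa>) * \<delta>)) + 1 \<le> Ck / \<delta>\<^sup>2" using stop_le by blast
  define c where "c = min \<alpha>0 (q * eff_dim A \<alpha>0 * \<eta>\<^sup>2)"
  have c: "0 < c" using \<alpha>0 q \<eta> eff_dim_pos[OF \<alpha>0] by (simp add: c_def)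
  define D where "D = 2 * (norm w)\<^sup>2 + 2 * (\<gamma> / c)\<^sup>2"
  have D: "0 \<le> D" by (simp add: D_def)
  define m4 where "m4 = (LINT \<omega>|M. norm (\<zeta> \<omega>) ^ 4)"
  have m4: "0 \<le> m4" by (simp add: m4_def)
  define X where "X = D * (2 * Ck + m4)"
  have X: "0 \<le> X" using D m4 Ck by (simp add: X_def)
  have "(LINT \<omega>|M. (err \<kappa> \<delta> \<omega>)\<^sup>2) \<le> (C * (norm (diag (r \<alpha>) w) + (1 + \<kappa>) * \<delta> / Theta_N A \<alpha>))\<^sup>2 + X * \<delta>\<^sup>2"
    if \<delta>: "0 < \<delta>" "\<delta> < 1" and \<kappa>: "0 \<le> \<kappa>" and P: "exp (- 2 * \<kappa>\<^sup>2 * eff_dim A \<alpha>0) \<le> \<delta> ^ 16"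
      and \<alpha>: "0 < \<alpha>" "\<alpha> \<le> \<alpha>0" for \<delta> \<kappa> \<alpha>
  proof -
    define d where "d = (1 + \<kappa>) * \<delta>"
    define B where "B = bad \<kappa> \<delta>"
    define H where "H = C * (norm (diag (r \<alpha>) w) + (1 + \<kappa>) * \<delta> / Theta_N A \<alpha>)"
    have d: "\<delta> \<le> d" unfolding d_def using \<delta> \<kappa> by (simp add: distrib_right)
    have "\<delta>\<^sup>2 \<le> d\<^sup>2" "\<delta>\<^sup>2 \<le> 1" using d \<delta> by (auto intro: power_mono simp: power_le_one)
    then have "c * \<delta>\<^sup>2 \<le> c * min 1 (d\<^sup>2)" using c by (intro mult_left_mono) auto
    then have low: "c * \<delta>\<^sup>2 \<le> step (stop d)"
      using step_stop_lower[of d] d \<delta> by (simp add: c_def)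
    have all: "(err \<kappa> \<delta> \<omega>)\<^sup>2 \<le> D / \<delta>\<^sup>2 * (1 + (norm (\<zeta> \<omega>))\<^sup>2)" for \<omega>
    proof -
      have "\<gamma> * \<delta> / step (stop d) \<le> \<gamma> * \<delta> / (c * \<delta>\<^sup>2)"
        using gamma(1) \<delta> c low step_pos by (intro divide_left_mono) auto
      also have "\<dots> = \<gamma> / c / \<delta>" using \<delta> by (simp add: power2_eq_square)
      finally have "(\<gamma> * \<delta> / step (stop d))\<^sup>2 \<le> (\<gamma> / c / \<delta>)\<^sup>2"
        using gamma(1) \<delta> step_pos[of "stop d"] by (intro power_mono) auto
      then have "2 * (\<gamma> * \<delta> / step (stop d))\<^sup>2 * (norm (\<zeta> \<omega>))\<^sup>2 \<le> 2 * (\<gamma> / c / \<delta>)\<^sup>2 * (norm (\<zeta> \<omega>))\<^sup>2"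
        by (intro mult_right_mono) auto
      also have "\<dots> = 2 * (\<gamma> / c)\<^sup>2 / \<delta>\<^sup>2 * (norm (\<zeta> \<omega>))\<^sup>2" by (simp add: power_divide power_mult_distrib)
      also have "\<dots> \<le> D / \<delta>\<^sup>2 * (norm (\<zeta> \<omega>))\<^sup>2"
        by (intro mult_right_mono divide_right_mono) (auto simp: D_def)
      finally have 1: "2 * (\<gamma> * \<delta> / step (stop d))\<^sup>2 * (norm (\<zeta> \<omega>))\<^sup>2 \<le> D / \<delta>\<^sup>2 * (norm (\<zeta> \<omega>))\<^sup>2" .
      have "2 * (norm w)\<^sup>2 \<le> D" by (simp add: D_def)
      also have "\<dots> \<le> D / \<delta>\<^sup>2"
        using D \<delta> \<open>\<delta>\<^sup>2 \<le> 1\<close> by (simp add: pos_le_divide_eq mult_left_le)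
      finally show ?thesis
        using 1 err_power2_le[OF \<delta>(1) \<kappa>, of \<omega>] unfolding d_def[symmetric] by (simp add: distrib_left)
    qed
    have good: "(err \<kappa> \<delta> \<omega>)\<^sup>2 \<le> H\<^sup>2" if "\<omega> \<in> space M - B" for \<omega>
    proof (intro power_mono)
      show "err \<kappa> \<delta> \<omega> \<le> H"
        unfolding err_def index_def data_def H_def
      proof (rule on_good[OF \<delta>(1) \<kappa> _ _ \<alpha>])
        show "Theta_N A (step (stop d)) \<le> \<eta> * (1 + \<kappa>) * \<delta>"
          using Theta_N_stop[of d] d \<delta> by (simp add: d_def mult.assoc)
        show "norm (diag (s (step k)) (\<zeta> \<omega>)) \<le> (1 + \<kappa>) * sqrt (step k * eff_dim A (step k))"
          if "k \<le> stop d" for k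
          using \<open>\<omega> \<in> space M - B\<close> that by (auto simp: B_def bad_def d_def not_less)
      qed
    qed (simp add: err_def)
    \<comment> \<open>A weighted Young inequality instead of Cauchy-Schwarz. After multiplication by
      \<open>D / \<delta>\<^sup>2\<close> the weights leave the moment term of order \<delta>^2 and
      the probability term, with \<open>prob B\<close> of order \<delta>^14, of order
      \<delta>^8.\<close>
    have pt: "(err \<kappa> \<delta> \<omega>)\<^sup>2 \<le> H\<^sup>2 + D / \<delta>\<^sup>2 * (2 / \<delta> ^ 4 * indicator B \<omega> + \<delta> ^ 4 * norm (\<zeta> \<omega>) ^ 4)"
      if \<omega>: "\<omega> \<in> space M" for \<omega>
    proof (cases "\<omega> \<in> B")
      case False
      have "0 \<le> D / \<delta>\<^sup>2 * (\<delta> ^ 4 * norm (\<zeta> \<omega>) ^ 4)" using D by simp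
      then show ?thesis using good[of \<omega>] \<omega> False by simp
    next
      case True
      define z where "z = (norm (\<zeta> \<omega>))\<^sup>2"
      have d4: "0 < \<delta> ^ 4" "\<delta> ^ 4 \<le> 1" using \<delta> by (auto simp: power_le_one)
      have "0 \<le> (\<delta>\<^sup>2 * z - 1 / \<delta>\<^sup>2)\<^sup>2" by simp
      also have "\<dots> = \<delta> ^ 4 * z\<^sup>2 + 1 / \<delta> ^ 4 - 2 * z"
        using \<delta> by (simp add: power2_diff power_mult_distrib power_divide flip: power_mult)
      finally have "2 * z \<le> \<delta> ^ 4 * z\<^sup>2 + 1 / \<delta> ^ 4" by simp
      moreover have "1 \<le> 1 / \<delta> ^ 4" using d4 by simp
      moreover have "0 \<le> z" by (simp add: z_def)
      ultimately have "1 + z \<le> 2 * (1 / \<delta> ^ 4) + \<delta> ^ 4 * z\<^sup>2" by linarith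
      moreover have "z\<^sup>2 = norm (\<zeta> \<omega>) ^ 4" by (simp add: z_def flip: power_mult)
      ultimately have "1 + z \<le> 2 / \<delta> ^ 4 * indicator B \<omega> + \<delta> ^ 4 * norm (\<zeta> \<omega>) ^ 4"
        using True by simp
      then have "D / \<delta>\<^sup>2 * (1 + z) \<le> D / \<delta>\<^sup>2 * (2 / \<delta> ^ 4 * indicator B \<omega> + \<delta> ^ 4 * norm (\<zeta> \<omega>) ^ 4)"
        using D by (intro mult_left_mono) auto
      then show ?thesis using all[of \<omega>] by (simp add: z_def add_increasing)
    qed
    have intB: "integrable M (indicator B :: 'w \<Rightarrow> real)" by (simp add: B_def less_top[symmetric])
    have "(LINT \<omega>|M. (err \<kappa> \<delta> \<omega>)\<^sup>2)
        \<le> (LINT \<omega>|M. H\<^sup>2 + D / \<delta>\<^sup>2 * (2 / \<delta> ^ 4 * indicator B \<omega> + \<delta> ^ 4 * norm (\<zeta> \<omega>) ^ 4))"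
      using intB integrable_norm_zeta_power4 \<delta> \<kappa>
      by (intro integral_mono integrable_err pt) auto
    also have "\<dots> = H\<^sup>2 + D / \<delta>\<^sup>2 * (2 / \<delta> ^ 4 * prob B + \<delta> ^ 4 * m4)"
      using intB integrable_norm_zeta_power4 by (simp add: m4_def prob_space B_def)
    also have "\<dots> \<le> H\<^sup>2 + D / \<delta>\<^sup>2 * (2 / \<delta> ^ 4 * (Ck / \<delta>\<^sup>2 * \<delta> ^ 16) + \<delta> ^ 4 * m4)"
    proof (intro add_left_mono mult_left_mono add_right_mono)
      have "prob B \<le> (real (stop d) + 1) * exp (- 2 * \<kappa>\<^sup>2 * eff_dim A \<alpha>0)"
        unfolding B_def d_def by (rule prob_bad_le[OF \<kappa>])
      also have "\<dots> \<le> Ck / \<delta>\<^sup>2 * \<delta> ^ 16"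
        using Ck(2)[OF \<delta> \<kappa>] P Ck(1) by (intro mult_mono) (auto simp: d_def)
      finally show "prob B \<le> Ck / \<delta>\<^sup>2 * \<delta> ^ 16" .
    qed (use \<delta> D in auto)
    also have "\<dots> = H\<^sup>2 + D * (2 * Ck * \<delta> ^ 8 + \<delta>\<^sup>2 * m4)"
      using \<delta> by (simp add: field_simps eval_nat_numeral)
    also have "\<dots> \<le> H\<^sup>2 + D * (2 * Ck * \<delta>\<^sup>2 + \<delta>\<^sup>2 * m4)"
      using D Ck(1) \<delta> by (intro add_left_mono mult_left_mono add_right_mono power_decreasing) auto
    finally show ?thesis by (simp add: H_def X_def algebra_simps)
  qed
  with C X show ?thesis by blast
qed

lemma risk_bound:
  assumes \<kappa>_def: "\<And>\<delta>. \<kappa> \<delta> = sqrt (8 * \<bar>ln (1 / \<delta>)\<bar> / eff_dim A \<alpha>0)"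
  shows "\<exists>C. \<forall>\<delta>>0. sqrt (LINT \<omega>|M. (err (\<kappa> \<delta>) \<delta> \<omega>)\<^sup>2)
    \<le> C * (INF \<alpha>\<in>{0<..\<alpha>0}. norm (reg_approx A g x0 (A xdag) \<alpha> - xdag)
      + \<delta> * (1 + sqrt \<bar>ln (1 / \<delta>)\<bar>) / Theta_N A \<alpha>)"
proof -
  define N where "N = eff_dim A \<alpha>0"
  have N: "0 < N" using eff_dim_pos[OF \<alpha>0] by (simp add: N_def)
  define L where "L \<delta> = sqrt \<bar>ln (1 / \<delta>)\<bar>" for \<delta> :: real
  have L: "0 \<le> L \<delta>" for \<delta> by (simp add: L_def)
  have \<kappa>: "\<kappa> \<delta> = sqrt (8 / N) * L \<delta>" for \<delta>
    unfolding \<kappa>_def L_def N_def real_sqrt_mult[symmetric] by simp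
  have \<kappa>0: "0 \<le> \<kappa> \<delta>" for \<delta> unfolding \<kappa> using N L by simp
  define c where "c = max 1 (sqrt (8 / N))"
  have c: "1 \<le> c" by (simp add: c_def)
  have \<kappa>_le: "1 + \<kappa> \<delta> \<le> c * (1 + L \<delta>)" for \<delta>
  proof -
    have "\<kappa> \<delta> \<le> c * L \<delta>" unfolding \<kappa> c_def using L by (intro mult_right_mono) auto
    then show ?thesis using c by (simp add: distrib_left)
  qed
  obtain X1 where X1: "0 \<le> X1" "\<And>\<delta> \<kappa>. 1 \<le> \<delta> \<Longrightarrow> 0 \<le> \<kappa> \<Longrightarrow> (LINT \<omega>|M. (err \<kappa> \<delta> \<omega>)\<^sup>2) \<le> X1 * \<delta>\<^sup>2"
    using risk_large_noise by blast
  obtain C1 X2 where C1: "0 \<le> C1" "0 \<le> X2" "\<And>\<delta> \<kappa> \<alpha>. 0 < \<delta> \<Longrightarrow> \<delta> < 1 \<Longrightarrow> 0 \<le> \<kappa> \<Longrightarrow>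
    exp (- 2 * \<kappa>\<^sup>2 * eff_dim A \<alpha>0) \<le> \<delta> ^ 16 \<Longrightarrow> 0 < \<alpha> \<Longrightarrow> \<alpha> \<le> \<alpha>0 \<Longrightarrow>
    (LINT \<omega>|M. (err \<kappa> \<delta> \<omega>)\<^sup>2) \<le> (C1 * (norm (diag (r \<alpha>) w) + (1 + \<kappa>) * \<delta> / Theta_N A \<alpha>))\<^sup>2 + X2 * \<delta>\<^sup>2"
    using risk_small_noise by blast
  define T where "T = Theta_N A \<alpha>0"
  have T: "0 < T" using Theta_N_pos[OF \<alpha>0] by (simp add: T_def)
  \<comment> \<open>Collects the constant from the good event and the absorbed remainders; the
    summand 1 makes C positive, so that it can be divided out before taking the infimum.\<close>
  define C where "C = sqrt ((C1 * c)\<^sup>2 + (X1 + X2) * T\<^sup>2 + 1)"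
  have C2: "C\<^sup>2 = (C1 * c)\<^sup>2 + (X1 + X2) * T\<^sup>2 + 1" using X1(1) C1(2) by (simp add: C_def)
  have C0: "0 < C" unfolding C_def using X1(1) C1(2) by (simp add: add_nonneg_pos)
  have main: "sqrt (LINT \<omega>|M. (err (\<kappa> \<delta>) \<delta> \<omega>)\<^sup>2)
      \<le> C * (norm (reg_approx A g x0 (A xdag) \<alpha> - xdag) + \<delta> * (1 + L \<delta>) / Theta_N A \<alpha>)"
    if \<delta>: "0 < \<delta>" and \<alpha>: "0 < \<alpha>" "\<alpha> \<le> \<alpha>0" for \<delta> \<alpha>
  proof -
    have T\<alpha>: "0 < Theta_N A \<alpha>" "Theta_N A \<alpha> \<le> T"
      using Theta_N_pos[OF \<alpha>(1)] Theta_N_mono[OF \<alpha>] by (auto simp: T_def)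
    define b where "b = norm (diag (r \<alpha>) w)"
    define h where "h = b + \<delta> * (1 + L \<delta>) / Theta_N A \<alpha>"
    have "diag (g \<alpha>) 0 = 0"
      by (rule linear_0[OF bounded_linear.linear[OF bounded_linear_diag[OF bounded_symbol_g[OF \<alpha>(1)]]]])
    then have b: "norm (reg_approx A g x0 (A xdag) \<alpha> - xdag) = b"
      using approx_error[OF \<alpha>(1), of 0] by (simp add: b_def norm_minus_commute)
    have b0: "0 \<le> b" by (simp add: b_def)
    have h0: "0 \<le> h" using b0 \<delta> L[of \<delta>] T\<alpha> by (simp add: h_def)
    \<comment> \<open>\<open>Theta_N\<close> is largest at \<alpha>0; this converts the remainders
      in \<delta>^2 into multiples of h^2.\<close>
    have "\<delta> / T \<le> \<delta> * (1 + L \<delta>) / Theta_N A \<alpha>"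
      using \<delta> L[of \<delta>] T\<alpha> by (intro frac_le) auto
    then have "\<delta> / T \<le> h" using b0 by (simp add: h_def)
    then have "\<delta> \<le> T * h" using T by (simp add: pos_divide_le_eq mult.commute)
    then have \<delta>h: "\<delta>\<^sup>2 \<le> T\<^sup>2 * h\<^sup>2" using \<delta> power_mono[of \<delta> "T * h" 2] by (simp add: power_mult_distrib)
    have X: "X * \<delta>\<^sup>2 \<le> X * T\<^sup>2 * h\<^sup>2" if "0 \<le> X" for X
      using mult_left_mono[OF \<delta>h that] by (simp add: mult.assoc)
    have "(LINT \<omega>|M. (err (\<kappa> \<delta>) \<delta> \<omega>)\<^sup>2) \<le> (C1 * c * h)\<^sup>2 + (X1 + X2) * T\<^sup>2 * h\<^sup>2"
    proof (cases "1 \<le> \<delta>")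
      case True
      have "(LINT \<omega>|M. (err (\<kappa> \<delta>) \<delta> \<omega>)\<^sup>2) \<le> X1 * \<delta>\<^sup>2" by (rule X1(2)[OF True \<kappa>0])
      also have "\<dots> \<le> X1 * T\<^sup>2 * h\<^sup>2" by (rule X[OF X1(1)])
      also have "\<dots> \<le> (C1 * c * h)\<^sup>2 + (X1 + X2) * T\<^sup>2 * h\<^sup>2"
        using C1(2) by (simp add: distrib_right)
      finally show ?thesis .
    next
      case False
      then have \<delta>1: "\<delta> < 1" by simp
      have "(\<kappa> \<delta>)\<^sup>2 * N = 8 * \<bar>ln (1 / \<delta>)\<bar>" using N by (simp add: \<kappa> power_mult_distrib L_def)
      also have "\<dots> = - 8 * ln \<delta>" using \<delta> \<delta>1 by (simp add: ln_div)
      finally have "- 2 * (\<kappa> \<delta>)\<^sup>2 * eff_dim A \<alpha>0 = 16 * ln \<delta>"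
        unfolding N_def mult.assoc by linarith
      moreover have "exp (real 16 * ln \<delta>) = exp (ln \<delta>) ^ 16" by (rule exp_of_nat_mult)
      ultimately have "exp (- 2 * (\<kappa> \<delta>)\<^sup>2 * eff_dim A \<alpha>0) = \<delta> ^ 16"
        by (simp only: exp_ln[OF \<delta>] of_nat_numeral)
      then have "(LINT \<omega>|M. (err (\<kappa> \<delta>) \<delta> \<omega>)\<^sup>2)
          \<le> (C1 * (b + (1 + \<kappa> \<delta>) * \<delta> / Theta_N A \<alpha>))\<^sup>2 + X2 * \<delta>\<^sup>2"
        unfolding b_def by (intro C1(3) \<delta> \<delta>1 \<kappa>0 \<alpha>) simp
      also have "\<dots> \<le> (C1 * c * h)\<^sup>2 + X2 * T\<^sup>2 * h\<^sup>2"
      proof (intro add_mono X C1(2) power_mono)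
        have "(1 + \<kappa> \<delta>) * \<delta> / Theta_N A \<alpha> \<le> c * (1 + L \<delta>) * \<delta> / Theta_N A \<alpha>"
          using \<kappa>_le \<delta> T\<alpha> by (intro divide_right_mono mult_right_mono) auto
        moreover have "1 * b \<le> c * b" using c b0 by (intro mult_right_mono)
        ultimately have "b + (1 + \<kappa> \<delta>) * \<delta> / Theta_N A \<alpha> \<le> c * h"
          by (simp add: h_def distrib_left mult_ac)
        from mult_left_mono[OF this C1(1)]
        show "C1 * (b + (1 + \<kappa> \<delta>) * \<delta> / Theta_N A \<alpha>) \<le> C1 * c * h" by (simp add: mult.assoc)
        show "0 \<le> C1 * (b + (1 + \<kappa> \<delta>) * \<delta> / Theta_N A \<alpha>)"
          using C1(1) b0 \<kappa>0[of \<delta>] \<delta> T\<alpha> by simp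
      qed
      also have "\<dots> \<le> (C1 * c * h)\<^sup>2 + (X1 + X2) * T\<^sup>2 * h\<^sup>2"
        using X1(1) by (simp add: distrib_right)
      finally show ?thesis .
    qed
    also have "\<dots> \<le> C\<^sup>2 * h\<^sup>2" unfolding C2 by (simp add: power_mult_distrib distrib_right)
    also have "\<dots> = (C * h)\<^sup>2" by (simp add: power_mult_distrib)
    finally have "sqrt (LINT \<omega>|M. (err (\<kappa> \<delta>) \<delta> \<omega>)\<^sup>2) \<le> sqrt ((C * h)\<^sup>2)" by (rule real_sqrt_le_mono)
    also have "\<dots> = C * h" using C0 h0 by simp
    finally show ?thesis by (simp add: h_def b)
  qed
  have "sqrt (LINT \<omega>|M. (err (\<kappa> \<delta>) \<delta> \<omega>)\<^sup>2)
    \<le> C * (INF \<alpha>\<in>{0<..\<alpha>0}. norm (reg_approx A g x0 (A xdag) \<alpha> - xdag)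
      + \<delta> * (1 + sqrt \<bar>ln (1 / \<delta>)\<bar>) / Theta_N A \<alpha>)" if \<delta>: "0 < \<delta>" for \<delta>
  proof -
    have "sqrt (LINT \<omega>|M. (err (\<kappa> \<delta>) \<delta> \<omega>)\<^sup>2) / C
      \<le> (INF \<alpha>\<in>{0<..\<alpha>0}. norm (reg_approx A g x0 (A xdag) \<alpha> - xdag)
        + \<delta> * (1 + sqrt \<bar>ln (1 / \<delta>)\<bar>) / Theta_N A \<alpha>)"
    proof (rule cINF_greatest)
      show "{0<..\<alpha>0} \<noteq> {}" using \<alpha>0 by simp
      fix \<alpha> assume "\<alpha> \<in> {0<..\<alpha>0}"
      then show "sqrt (LINT \<omega>|M. (err (\<kappa> \<delta>) \<delta> \<omega>)\<^sup>2) / C \<le> norm (reg_approx A g x0 (A xdag) \<alpha> - xdag)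
        + \<delta> * (1 + sqrt \<bar>ln (1 / \<delta>)\<bar>) / Theta_N A \<alpha>"
        using main[OF \<delta>, of \<alpha>] C0 by (simp add: pos_divide_le_eq mult.commute L_def)
    qed
    then show ?thesis using C0 by (simp add: pos_divide_le_eq mult.commute)
  qed
  then show ?thesis by blast
qed

end

theorem theorem2p1:
  fixes T :: "'a::{real_inner,complete_space} \<Rightarrow> 'b::{real_inner,complete_space}"
    and A :: "'a \<Rightarrow> 'a"
    and M :: "'w measure"
    and \<xi> :: "'b \<Rightarrow> 'w \<Rightarrow> real"
    and \<zeta> :: "'w \<Rightarrow> 'a"
    and xdag x0 :: 'a
    and g :: "real \<Rightarrow> real \<Rightarrow> real"
    and c1 c2 t0 \<alpha>0 q \<tau> \<eta> :: real
    and \<kappa> :: "real \<Rightarrow> real"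
    and zdata :: "real \<Rightarrow> 'w \<Rightarrow> 'a"
    and \<alpha>RG :: "real \<Rightarrow> 'w \<Rightarrow> real"
  assumes "compact_operator T" and "T \<noteq> (\<lambda>x. 0)"
    and A_def: "A = adjoint T \<circ> T"
    and trace: "op_trace A < \<infinity>"
    and "prob_space M" and "complete_measure M"
    and "gaussian_white_noise M \<xi>"
    and "is_adjoint_noise M T \<xi> \<zeta>"
    and zdata_def: "\<And>\<delta> \<omega>. zdata \<delta> \<omega> = A xdag + \<delta> *\<^sub>R \<zeta> \<omega>"
    and "regularization (onorm A) g"
    and "1 < c1" and "0 < c2" and "c2 < 1" and "0 < t0" and "t0 < onorm A"
    and source: "\<And>\<alpha>. 0 < \<alpha> \<Longrightarrow> \<alpha> \<le> t0 \<Longrightarrow>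
          (LINT t:{0..<\<alpha>}|spectral_measure A (xdag - x0). 1)
            \<le> c1\<^sup>2 * (LINT t:{c2 * \<alpha>..}|spectral_measure A (xdag - x0). (residual g \<alpha> t)\<^sup>2)"
    and "0 < \<alpha>0" and "0 < q" and "q < 1" and "1 < \<tau>" and "0 < \<eta>"
    and \<kappa>_def: "\<And>\<delta>. \<kappa> \<delta> = sqrt (8 * \<bar>ln (1 / \<delta>)\<bar> / eff_dim A \<alpha>0)"
    and \<alpha>RG_def: "\<And>\<delta> \<omega>. \<alpha>RG \<delta> \<omega> = alpha_RG A g x0 q \<alpha>0 \<tau> \<eta> (\<kappa> \<delta>) \<delta> (zdata \<delta> \<omega>)"
  shows "\<exists>C. \<forall>\<delta>>0.
      integrable M (\<lambda>\<omega>. (norm (xdag - reg_approx A g x0 (zdata \<delta> \<omega>) (\<alpha>RG \<delta> \<omega>)))\<^sup>2) \<and>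
      sqrt (LINT \<omega>|M. (norm (xdag - reg_approx A g x0 (zdata \<delta> \<omega>) (\<alpha>RG \<delta> \<omega>)))\<^sup>2)
        \<le> C * (INF \<alpha>\<in>{0<..\<alpha>0}.
                 norm (reg_approx A g x0 (A xdag) \<alpha> - xdag)
                 + \<delta> * (1 + sqrt \<bar>ln (1 / \<delta>)\<bar>) / Theta_N A \<alpha>)"
proof -
  have bT: "bounded_linear T" using \<open>compact_operator T\<close> by (simp add: compact_operator_def)
  have A: "A x = adjoint T (T x)" for x by (simp add: A_def)
  have A_inner_T: "inner (A x) y = inner (T x) (T y)" for x y
    using adjoint_hilbert(1)[OF bT, of y "T x"] by (simp add: A inner_commute)
  have A_lin: "bounded_linear A"
    unfolding A_def comp_def by (rule bounded_linear_compose[OF adjoint_hilbert(2)[OF bT] bT])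
  obtain F where F: "orthonormal_basis F" "\<And>e. e \<in> F \<Longrightarrow> \<exists>m\<ge>0. A e = m *\<^sub>R e"
    using eigenbasis_exists[OF \<open>compact_operator T\<close>] by (auto simp: A)
  define ev where "ev e = inner (A e) e" for e
  have ev_T: "ev e = (norm (T e))\<^sup>2" for e
    by (simp add: ev_def A_inner_T power2_norm_eq_inner)
  have eig: "A e = ev e *\<^sub>R e" if e: "e \<in> F" for e
  proof -
    obtain m where m: "A e = m *\<^sub>R e" using F(2)[OF e] by blast
    have "norm e = 1" using F(1) e by (simp add: orthonormal_basis_def)
    then show ?thesis using m by (simp add: ev_def norm_eq_1)
  qed
  interpret diagonal_operator A F ev
  proof (rule diagonal_operator.intro)
    show "inner (A x) y = inner x (A y)" for x y
      using A_inner_T[of x y] A_inner_T[of y x] by (simp add: inner_commute)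
  qed (use A_lin F(1) eig in \<open>auto simp: ev_T\<close>)
  \<comment> \<open>Here T \<noteq> 0 enters: it makes the effective dimension positive, so that
    \<kappa> and \<open>Theta_N\<close> involve no division by zero.\<close>
  have "\<exists>e\<in>F. 0 < ev e"
  proof (rule ccontr)
    assume neg: "\<not> (\<exists>e\<in>F. 0 < ev e)"
    have "T x = 0" for x
    proof -
      have "A x = 0" by (rule eqI) (use neg ev_nonneg in \<open>force simp: A_inner\<close>)
      then show ?thesis using A_inner_T[of x x] by simp
    qed
    with \<open>T \<noteq> (\<lambda>x. 0)\<close> show False by blast
  qed
  then interpret trace_class_operator A F ev using trace by unfold_locales
  obtain \<gamma> where \<gamma>: "1 \<le> \<gamma>" "\<And>\<alpha> t. 0 < \<alpha> \<Longrightarrow> t \<in> {0..onorm A} \<Longrightarrow> \<alpha> * \<bar>g \<alpha> t\<bar> \<le> \<gamma>"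
    using \<open>regularization (onorm A) g\<close> unfolding regularization_def by blast
  interpret regularized_problem A F ev g xdag x0 c1 c2 t0 \<alpha>0 q \<tau> \<eta> \<gamma>
    using assms \<gamma> by unfold_locales (auto simp: regularization_def)
  interpret prob_space M by fact
  have noise_T: "AE \<omega> in M. inner (\<zeta> \<omega>) u = \<xi> (T u) \<omega>" for u
    using \<open>is_adjoint_noise M T \<xi> \<zeta>\<close> by (simp add: is_adjoint_noise_def)
  have re: "random_element M \<zeta>" using \<open>is_adjoint_noise M T \<xi> \<zeta>\<close> by (simp add: is_adjoint_noise_def)
  have gauss: "centered_gaussian M (\<xi> y)" "expectation (\<lambda>\<omega>. (\<xi> y \<omega>)\<^sup>2) = inner y y"
    "integrable M (\<lambda>\<omega>. (\<xi> y \<omega>)\<^sup>2)" for y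
    using \<open>gaussian_white_noise M \<xi>\<close> by (auto simp: gaussian_white_noise_def power2_eq_square)
  \<comment> \<open>\<open>?P\<close> projects onto the kernel of T. For fixed d,
    \<open>inner (\<zeta> \<omega>) (?P d)\<close> equals \<open>\<xi> 0 \<omega>\<close>, which
    vanishes almost surely because its second moment is 0. This holds jointly for d in a countable
    D, extends to the closure by continuity, and can then be tested with
    \<open>\<zeta> \<omega>\<close> itself.\<close>
  have kernel: "AE \<omega> in M. \<forall>e\<in>F. ev e = 0 \<longrightarrow> inner (\<zeta> \<omega>) e = 0"
  proof -
    let ?P = "diag (indicator {0})"
    note P = diag_inner[OF bounded_symbol_indicator, of _ "{0}"]
    have P_sym: "inner (?P x) y = inner x (?P y)" for x y
    proof (rule has_sum_unique[OF parseval_inner[OF onb]])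
      show "((\<lambda>e. inner (?P x) e * inner y e) has_sum inner x (?P y)) F"
        by (rule has_sum_cong[THEN iffD1, OF _ parseval_inner[OF onb]]) (simp add: P)
    qed
    have P_idem: "?P (?P x) = ?P x" for x by (rule eqI) (simp add: P indicator_def)
    have TP: "T (?P x) = 0" for x
    proof -
      have "A (?P x) = 0" by (rule eqI) (simp add: A_inner P indicator_def)
      then show ?thesis using A_inner_T[of "?P x" "?P x"] by simp
    qed
    obtain D where D: "countable D" "AE \<omega> in M. \<zeta> \<omega> \<in> closure D"
      using re by (auto simp: random_element_def)
    have "AE \<omega> in M. \<xi> 0 \<omega> = 0"
      using gauss(2)[of 0] integral_nonneg_eq_0_iff_AE[OF gauss(3)[of 0]] by simp
    then have "AE \<omega> in M. inner (\<zeta> \<omega>) (?P d) = 0" for d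
      using noise_T[of "?P d"] by eventually_elim (simp add: TP)
    then have "AE \<omega> in M. \<forall>d\<in>D. inner (\<zeta> \<omega>) (?P d) = 0"
      using D(1) by (simp add: AE_ball_countable)
    with D(2) show ?thesis
    proof eventually_elim
      case (elim \<omega>)
      have "closed {x. inner (?P (\<zeta> \<omega>)) x = 0}" by (intro closed_Collect_eq continuous_intros)
      moreover have "D \<subseteq> {x. inner (?P (\<zeta> \<omega>)) x = 0}" using elim(2) by (auto simp: P_sym)
      ultimately have "closure D \<subseteq> {x. inner (?P (\<zeta> \<omega>)) x = 0}" by (rule closure_minimal[rotated])
      with elim(1) have "inner (?P (\<zeta> \<omega>)) (\<zeta> \<omega>) = 0" by blast
      then have "inner (?P (\<zeta> \<omega>)) (?P (\<zeta> \<omega>)) = 0" by (simp add: P_sym[symmetric] P_idem)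
      then have 0: "?P (\<zeta> \<omega>) = 0" by simp
      show ?case
      proof (intro ballI impI)
        fix e assume "e \<in> F" "ev e = 0"
        then show "inner (\<zeta> \<omega>) e = 0" using P[of e "\<zeta> \<omega>"] 0 by simp
      qed
    qed
  qed
  interpret gaussian_noise A F ev M \<zeta>
  proof unfold_locales
    show "\<zeta> \<in> borel_measurable M" using re by (simp add: random_element_def)
    show "(\<integral>\<^sup>+\<omega>. ennreal (exp (inner (\<zeta> \<omega>) u)) \<partial>M) = ennreal (exp (inner (A u) u / 2))" for u
    proof -
      have "(\<integral>\<^sup>+\<omega>. ennreal (exp (inner (\<zeta> \<omega>) u)) \<partial>M) = (\<integral>\<^sup>+\<omega>. ennreal (exp (\<xi> (T u) \<omega>)) \<partial>M)"
        using noise_T[of u] by (intro nn_integral_cong_AE) auto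
      also have "\<dots> = ennreal (exp (inner (T u) (T u) / 2))"
        by (rule centered_gaussian_exp(2)[OF gauss(1,2)])
      finally show ?thesis by (simp add: A_inner_T)
    qed
  qed (rule kernel)
  interpret statistical_problem A F ev g xdag x0 c1 c2 t0 \<alpha>0 q \<tau> \<eta> \<gamma> M \<zeta> ..
  have \<kappa>: "0 \<le> \<kappa> \<delta>" for \<delta> using eff_dim_pos[OF \<alpha>0] by (simp add: \<kappa>_def)
  have err: "norm (xdag - reg_approx A g x0 (zdata \<delta> \<omega>) (\<alpha>RG \<delta> \<omega>)) = err (\<kappa> \<delta>) \<delta> \<omega>" if "0 < \<delta>" for \<delta> \<omega>
    using err_eq[OF that \<kappa>, where \<omega> = \<omega>] by (simp add: \<alpha>RG_def zdata_def data_def)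
  \<comment> \<open>Integrability accompanies the bound because the integral of a non-integrable
    function is 0 by convention.\<close>
  show ?thesis
    using risk_bound[OF \<kappa>_def] integrable_err[OF _ \<kappa>] by (simp add: err)
qed

end
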